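(* Let $t_1,t_2\ge 0$ be integers with $t_1\ge 1$ or $t_2\ge 2$, let $k_1,\ldots,k_{t_1}\ge 2$ and $p_1,\ldots,p_{t_2}\ge 2$ be integers with $\max\{k_1,\ldots,k_{t_1},p_1,\ldots,p_{t_2}\}\ge 3$, and let $\kappa:=\sum_{i=1}^{t_1}k_i+\sum_{i=1}^{t_2}p_i-(t_1+t_2)$. There is $n_0$ such that for every $n\ge n_0$: if $G$ is a graph on $n$ vertices with $\lambda(G)\ge \lambda(S_{n,\kappa}^+)$, then $G$ contains $\mathcal{CP}_{2k_1,\ldots,2k_{t_1};2p_1,\ldots,2p_{t_2}}$ as a subgraph unless $G=S_{n,\kappa}^+$.
   Context: $\lambda(G)$ is the adjacency spectral radius. $\mathcal{CP}_{2k_1,\ldots,2k_{t_1};2p_1,\ldots,2p_{t_2}}$ is the graph obtained by taking $t_1$ cycles of lengths $2k_1,\ldots,2k_{t_1}$ and $t_2$ paths on $2p_1,\ldots,2p_{t_2}$ vertices, all sharing exactly one common vertex and otherwise vertex-disjoint, where each path has the common vertex as an endpoint; equivalently, it is obtained from the graph formed by $t_1+t_2$ cycles $C_{2k_1},\ldots,C_{2k_{t_1}},C_{2p_1},\ldots,C_{2p_{t_2}}$ meeting at exactly one common vertex by deleting, from each cycle $C_{2p_i}$, one edge incident to the common vertex. $S_{n,k}:=K_k\vee(n-k)K_1$ and $S_{n,k}^+$ is $S_{n,k}$ with one edge added inside the independent set. *)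

theory Defs
  imports "Jordan_Normal_Form.Spectral_Radius" "Graph_Theory.Graph_Theory"
begin

text \<open>
  A finite simple graph is a \<^emph>\<open>pair_graph\<close>: a finite vertex set with a finite, symmetric,
  irreflexive arc relation, so that an edge \<open>uv\<close> is the pair of arcs \<open>(u,v)\<close>, \<open>(v,u)\<close>.
\<close>

definition adjacency_matrix :: "'a pair_pre_digraph \<Rightarrow> 'a list \<Rightarrow> complex mat" where
  "adjacency_matrix G vs =
     mat (length vs) (length vs) (\<lambda>(i, j). if (vs ! i, vs ! j) \<in> parcs G then 1 else 0)"

text \<open>
  The enumeration of the vertices is chosen arbitrarily; the value does not depend on it,
  see \<open>adj_spectral_radius_eq\<close> below.
\<close>

definition adj_spectral_radius :: "'a pair_pre_digraph \<Rightarrow> real" where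
  "adj_spectral_radius G =
     spectral_radius (adjacency_matrix G (SOME vs. distinct vs \<and> set vs = pverts G))"

definition contains_subgraph :: "'a pair_pre_digraph \<Rightarrow> 'b pair_pre_digraph \<Rightarrow> bool" where
  "contains_subgraph G F \<longleftrightarrow>
     (\<exists>H. subgraph (with_proj H) (with_proj G) \<and> digraph_iso (with_proj H) (with_proj F))"

text \<open>
  \<open>S_graph n k\<close> is $K_k \vee (n-k)K_1$ on \<open>{..<n}\<close>, the clique being \<open>{..<k}\<close>. The extra edge of
  \<open>S_plus_graph n k\<close> joins \<open>k\<close> and \<open>k + 1\<close>; this is the intended graph for \<open>k + 2 \<le> n\<close>.
\<close>

definition S_graph :: "nat \<Rightarrow> nat \<Rightarrow> nat pair_pre_digraph" where
  "S_graph n k =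
     \<lparr> pverts = {..<n},
       parcs = {(u, v). u < n \<and> v < n \<and> u \<noteq> v \<and> (u < k \<or> v < k)} \<rparr>"

definition S_plus_graph :: "nat \<Rightarrow> nat \<Rightarrow> nat pair_pre_digraph" where
  "S_plus_graph n k =
     \<lparr> pverts = pverts (S_graph n k),
       parcs = parcs (S_graph n k) \<union> {(k, k + 1), (k + 1, k)} \<rparr>"

datatype cp_vertex = Centre | Cycle_Vertex nat nat | Path_Vertex nat nat

text \<open>
  \<open>cycle_pos i j\<close> is the vertex in position \<open>j\<close> of the \<open>i\<close>-th cycle, and \<open>path_pos i j\<close> that of the
  \<open>i\<close>-th path; position 0 is always the common vertex.
\<close>

definition cycle_pos :: "nat \<Rightarrow> nat \<Rightarrow> cp_vertex" where
  "cycle_pos i j = (if j = 0 then Centre else Cycle_Vertex i j)"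

definition path_pos :: "nat \<Rightarrow> nat \<Rightarrow> cp_vertex" where
  "path_pos i j = (if j = 0 then Centre else Path_Vertex i j)"

definition CP_oriented_arcs :: "nat list \<Rightarrow> nat list \<Rightarrow> cp_vertex rel" where
  "CP_oriented_arcs ks ps =
     {(cycle_pos i j, cycle_pos i (Suc j mod (2 * ks ! i))) | i j.
        i < length ks \<and> j < 2 * ks ! i} \<union>
     {(path_pos i j, path_pos i (Suc j)) | i j.
        i < length ps \<and> Suc j < 2 * ps ! i}"

definition CP_graph :: "nat list \<Rightarrow> nat list \<Rightarrow> cp_vertex pair_pre_digraph" where
  "CP_graph ks ps =
     \<lparr> pverts = {Centre} \<union>
         {cycle_pos i j | i j. i < length ks \<and> j < 2 * ks ! i} \<union>
         {path_pos i j | i j. i < length ps \<and> j < 2 * ps ! i},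
       parcs = CP_oriented_arcs ks ps \<union> (CP_oriented_arcs ks ps)\<inverse> \<rparr>"

lemma adjacency_matrix_eigenvalue_reorder:
  assumes us: "distinct us" "set us = pverts G" and vs: "distinct vs" "set vs = pverts G"
    and ev: "eigenvalue (adjacency_matrix G us) x"
  shows "eigenvalue (adjacency_matrix G vs) x"
proof -
  define n where "n = length us"
  have n: "length vs = n"
    using us vs distinct_card unfolding n_def by metis
  have "\<forall>i\<in>{..<n}. \<exists>j. j < n \<and> us ! j = vs ! i"
    using us vs n by (metis in_set_conv_nth lessThan_iff n_def)
  then obtain f where f: "\<And>i. i < n \<Longrightarrow> f i < n \<and> us ! f i = vs ! i"
    by (metis lessThan_iff)
  have inj: "inj_on f {..<n}"
  proof (rule inj_onI)
    fix i j assume "i \<in> {..<n}" "j \<in> {..<n}" "f i = f j"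
    then have "vs ! i = vs ! j" using f by (metis lessThan_iff)
    then show "i = j"
      using vs n \<open>i \<in> {..<n}\<close> \<open>j \<in> {..<n}\<close> by (simp add: nth_eq_iff_index_eq)
  qed
  have "f ` {..<n} \<subseteq> {..<n}" using f by auto
  then have bij: "bij_betw f {0..<n} {0..<n}"
    using inj endo_inj_surj[of "{..<n}" f] by (simp add: bij_betw_def lessThan_atLeast0)
  from ev obtain v where v: "v \<in> carrier_vec n" "v \<noteq> 0\<^sub>v n"
      and eq: "adjacency_matrix G us *\<^sub>v v = x \<cdot>\<^sub>v v"
    by (auto simp: eigenvalue_def eigenvector_def adjacency_matrix_def n_def)
  have row: "(\<Sum>j\<in>{0..<n}. (if (us ! i, us ! j) \<in> parcs G then 1 else 0) * v $ j) = x * v $ i"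
    if "i < n" for i
    using arg_cong[OF eq, of "\<lambda>w. w $ i"] that v
    by (simp add: adjacency_matrix_def n_def scalar_prod_def)
  define w where "w = vec n (\<lambda>i. v $ f i)"
  have "w \<noteq> 0\<^sub>v n"
  proof
    assume w0: "w = 0\<^sub>v n"
    have "v $ j = 0" if "j < n" for j
    proof -
      have "j \<in> f ` {0..<n}" using bij_betw_imp_surj_on[OF bij] that by simp
      then obtain i where "i < n" "j = f i" by auto
      then show ?thesis using arg_cong[OF w0, of "\<lambda>u. u $ i"] by (simp add: w_def)
    qed
    then have "v = 0\<^sub>v n" using v(1) by (intro eq_vecI) auto
    then show False using v(2) by simp
  qed
  moreover have "adjacency_matrix G vs *\<^sub>v w = x \<cdot>\<^sub>v w"
  proof (rule eq_vecI)
    fix i assume "i < dim_vec (x \<cdot>\<^sub>v w)"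
    then have i: "i < n" by (simp add: w_def)
    have "(adjacency_matrix G vs *\<^sub>v w) $ i =
        (\<Sum>j\<in>{0..<n}. (if (vs ! i, vs ! j) \<in> parcs G then 1 else 0) * v $ f j)"
      using i n by (simp add: adjacency_matrix_def scalar_prod_def w_def)
    also have "\<dots> = (\<Sum>j\<in>{0..<n}. (if (us ! f i, us ! f j) \<in> parcs G then 1 else 0) * v $ f j)"
      using f i by (intro sum.cong) auto
    also have "\<dots> = (\<Sum>j\<in>{0..<n}. (if (us ! f i, us ! j) \<in> parcs G then 1 else 0) * v $ j)"
      by (rule sum.reindex_bij_betw[OF bij])
    also have "\<dots> = x * v $ f i" using row f i by blast
    finally show "(adjacency_matrix G vs *\<^sub>v w) $ i = (x \<cdot>\<^sub>v w) $ i"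
      using i by (simp add: w_def)
  qed (simp add: adjacency_matrix_def w_def n)
  ultimately show ?thesis
    unfolding eigenvalue_def eigenvector_def
    by (intro exI[of _ w]) (simp add: adjacency_matrix_def w_def n)
qed

lemma adj_spectral_radius_eq:
  assumes "distinct vs" "set vs = pverts G"
  shows "adj_spectral_radius G = spectral_radius (adjacency_matrix G vs)"
proof -
  let ?us = "SOME vs. distinct vs \<and> set vs = pverts G"
  have "distinct ?us \<and> set ?us = pverts G"
    by (rule someI[of _ vs]) (use assms in simp)
  then have "spectrum (adjacency_matrix G ?us) = spectrum (adjacency_matrix G vs)"
    unfolding spectrum_def using assms
      adjacency_matrix_eigenvalue_reorder[of ?us G vs] adjacency_matrix_eigenvalue_reorder[of vs G ?us]
    by auto
  then show ?thesis by (simp add: adj_spectral_radius_def spectral_radius_def)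
qed

lemma pair_graph_S_plus_graph:
  assumes "k + 2 \<le> n"
  shows "pair_graph (S_plus_graph n k)"
proof -
  let ?G = "S_plus_graph n k"
  have V: "pverts ?G = {..<n}" by (simp add: S_plus_graph_def S_graph_def)
  have arc: "(u, v) \<in> parcs ?G \<longleftrightarrow>
      u < n \<and> v < n \<and> u \<noteq> v \<and> (u < k \<or> v < k) \<or> u = k \<and> v = k + 1 \<or> u = k + 1 \<and> v = k" for u v
    by (auto simp: S_plus_graph_def S_graph_def)
  have sub: "u < n \<and> v < n \<and> u \<noteq> v" if "(u, v) \<in> parcs ?G" for u v
    using that assms unfolding arc by auto
  have fin: "finite (parcs ?G)"
    by (rule finite_subset[of _ "{..<n} \<times> {..<n}"]) (use sub in auto)
  have "sym (parcs ?G)" by (rule symI) (use arc in blast)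
  then have "symmetric (with_proj ?G)" by (simp add: symmetric_def)
  then show ?thesis
    by unfold_locales (use sub fin in \<open>auto simp: V\<close>)
qed

lemma pair_graph_CP_graph:
  assumes "\<forall>k\<in>set ks. k \<ge> 2" "\<forall>p\<in>set ps. p \<ge> 2"
  shows "pair_graph (CP_graph ks ps)"
proof -
  let ?V = "pverts (CP_graph ks ps)"
  have fin: "finite ?V"
  proof -
    have "?V = {Centre} \<union> (\<Union>i<length ks. cycle_pos i ` {..<2 * ks ! i}) \<union>
        (\<Union>i<length ps. path_pos i ` {..<2 * ps ! i})"
      by (auto simp: CP_graph_def)
    then show ?thesis by simp
  qed
  have pos: "0 < ks ! i" "2 \<le> ks ! i" if "i < length ks" for i
    using assms(1) nth_mem[OF that] by force+
  have mod: "Suc j mod (2 * ks ! i) \<noteq> j" if "i < length ks" "j < 2 * ks ! i" for i j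
    using pos[OF that(1)] that(2) by (auto simp: mod_Suc)
  have cV: "cycle_pos i j \<in> ?V" if "i < length ks" "j < 2 * ks ! i" for i j
    using that unfolding CP_graph_def pair_pre_digraph.simps by blast
  have pV: "path_pos i j \<in> ?V" if "i < length ps" "j < 2 * ps ! i" for i j
    using that unfolding CP_graph_def pair_pre_digraph.simps by blast
  have arc: "u \<in> ?V \<and> v \<in> ?V \<and> u \<noteq> v" if uv: "(u, v) \<in> CP_oriented_arcs ks ps" for u v
  proof -
    consider i j where "i < length ks" "j < 2 * ks ! i" "u = cycle_pos i j"
        "v = cycle_pos i (Suc j mod (2 * ks ! i))"
      | i j where "i < length ps" "Suc j < 2 * ps ! i" "u = path_pos i j" "v = path_pos i (Suc j)"
      using uv unfolding CP_oriented_arcs_def by blast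
    then show ?thesis
    proof cases
      case 1
      have "Suc j mod (2 * ks ! i) < 2 * ks ! i" using pos[OF 1(1)] by simp
      moreover have "u \<noteq> v"
        using mod[OF 1(1,2)] unfolding 1(3,4) cycle_pos_def by (simp split: if_split)
      ultimately show ?thesis using cV[OF 1(1)] 1 by simp
    next
      case 2
      have "u \<noteq> v" unfolding 2(3,4) path_pos_def by simp
      then show ?thesis using pV[OF 2(1), of j] pV[OF 2(1), of "Suc j"] 2 by simp
    qed
  qed
  have arcs: "parcs (CP_graph ks ps) = CP_oriented_arcs ks ps \<union> (CP_oriented_arcs ks ps)\<inverse>"
    by (simp add: CP_graph_def)
  have sub: "parcs (CP_graph ks ps) \<subseteq> ?V \<times> ?V"
    unfolding arcs using arc by fast
  have no_loop: "u \<noteq> v" if "(u, v) \<in> parcs (CP_graph ks ps)" for u v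
    using that arc unfolding arcs by blast
  show ?thesis
  proof unfold_locales
    show "finite (parcs (CP_graph ks ps))"
      using finite_subset[OF sub] fin by simp
    show "symmetric (with_proj (CP_graph ks ps))"
      unfolding symmetric_def with_proj_simps arcs by (rule symI) blast
  qed (use fin sub no_loop in auto)
qed

end

theory Submission
  imports Defs "HOL-Analysis.Convex"
begin

text \<open>
  Let \<open>x\<close> be the entrywise modulus of an eigenvector for the spectral radius \<open>\<lambda>\<close> of a graph without
  the forbidden fan, scaled to maximum 1; then \<open>\<lambda> x \<le> A x\<close> entrywise, and \<open>\<lambda>\<^sup>2 \<ge> \<kappa> (n - \<kappa>)\<close>.
  Dense bipartite graphs contain long alternating paths, and one of them between a neighbourhood
  \<open>N(w)\<close> and the rest closes up to a branch centred at \<open>w\<close>; so few edges leave \<open>N(w)\<close>, and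
  comparing \<open>\<lambda>\<^sup>2 x\<^sub>w\<close> with the number of walks of length two from \<open>w\<close> shows that every vertex of
  degree below \<open>\<delta> n\<close> has small weight. (A single even cycle needs a second argument, on the edges
  leaving the second neighbourhood.) As \<open>\<kappa> + 1\<close> vertices have boundedly many common neighbours,
  the same comparison at a vertex of weight 1 leaves exactly \<open>\<kappa>\<close> vertices, forming a set \<open>L\<close>, of
  weight close to 1 and degree close to \<open>n\<close>.

  The common neighbourhood of \<open>L\<close> spans at most one edge, since a path on three vertices or two
  disjoint edges would complete a fan. Finally the quadratic form of \<open>x\<close> does not decrease when the
  graph is replaced by \<open>S\<^sup>+\<close> with clique \<open>L\<close>: the edges outside \<open>L\<close> that are lost at the exceptional
  vertices weigh less than the missing edges to \<open>L\<close>. The positive eigenvector of \<open>S\<^sup>+\<close> is explicit,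
  so Rayleigh's inequality and its equality case are elementary, and force the graph to be \<open>S\<^sup>+\<close>.
\<close>

section \<open>Alternating paths in dense bipartite graphs\<close>

text \<open>The bound on the edges leaving \<open>N(w)\<close> helps only if it lies below
  \<lambda>^2, which is at least about \<kappa> n. A branch of parameter k is forced by slightly
  more than (k - 1) n edges. With two or more branches each parameter is at most \<kappa>, because
  every other branch adds at least 1 to \<kappa>, and the margin is about n. A single branch has k =
  \<kappa> + 1 and no margin is left; the hypothesis on the numbers of cycles and paths makes it a
  cycle. A parameter of at least 3 is what excludes two disjoint edges in the common neighbourhood.

  Two small quantities occur, \<delta> for degrees and \<epsilon> for weights, with \<delta> =
  \<epsilon>^2: a total error of order \<delta> n in a walk count is charged to vertices whose
  weight misses 1 by at least \<epsilon>, so these account for at most order \<epsilon> n walks. The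
  constants in front depend only on the fan, so that \<epsilon> can be fixed before n.

  Weights may vanish until the very end; positivity comes out of the equality case.\<close>

lemma card_filter_eq_sum:
  "finite A \<Longrightarrow> card {a\<in>A. P a} = (\<Sum>a\<in>A. if P a then 1 else 0)"
  unfolding card_eq_sum by (rule sum.inter_filter)

text \<open>Deleting a vertex of \<open>B\<close> with at most \<open>p\<close> neighbours, or one
  of \<open>A\<close> with at most \<open>q\<close>, keeps the density inequality strict. It fails
  when a side is empty, so the deletions stop at a nonempty core. Separate thresholds for the two
  sides are what later gives a sharp coefficient of \<open>card B\<close>.\<close>

lemma bipartite_core:
  fixes r :: "'a \<Rightarrow> 'b \<Rightarrow> bool"
  assumes "finite A" "finite B" "p * card B + q * card A < (\<Sum>a\<in>A. card {b\<in>B. r a b})"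
  shows "\<exists>A' B'. A' \<subseteq> A \<and> B' \<subseteq> B \<and> A' \<noteq> {} \<and> B' \<noteq> {} \<and>
     (\<forall>b\<in>B'. p < card {a\<in>A'. r a b}) \<and> (\<forall>a\<in>A'. q < card {b\<in>B'. r a b})"
  using assms
proof (induction "card A + card B" arbitrary: A B rule: less_induct)
  case less
  show ?case
  proof (cases "(\<forall>b\<in>B. p < card {a\<in>A. r a b}) \<and> (\<forall>a\<in>A. q < card {b\<in>B. r a b})")
    case True
    have "A \<noteq> {}" using less.prems(3) by auto
    moreover have "B \<noteq> {}" using less.prems(3) by auto
    ultimately show ?thesis using True by blast
  next
    case False
    then consider b where "b \<in> B" "card {a\<in>A. r a b} \<le> p" | a where "a \<in> A" "card {b\<in>B. r a b} \<le> q"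
      by force
    then show ?thesis
    proof cases
      case 1
      have cB: "card B = Suc (card (B - {b}))" using 1 less.prems(2) by (metis card.remove)
      have "(\<Sum>a\<in>A. card {b\<in>B. r a b}) = (\<Sum>a\<in>A. card {b'\<in>B - {b}. r a b'} + (if r a b then 1 else 0))"
      proof (rule sum.cong[OF refl])
        fix a assume "a \<in> A"
        show "card {b\<in>B. r a b} = card {b'\<in>B - {b}. r a b'} + (if r a b then 1 else 0)"
        proof (cases "r a b")
          case True
          have "{b\<in>B. r a b} = insert b {b'\<in>B - {b}. r a b'}" using True 1 by auto
          then show ?thesis using True less.prems(2) by simp
        next
          case False
          then have "{b\<in>B. r a b} = {b'\<in>B - {b}. r a b'}" by auto
          then show ?thesis using False by simp
        qed
      qed
      also have "\<dots> = (\<Sum>a\<in>A. card {b'\<in>B - {b}. r a b'}) + card {a\<in>A. r a b}"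
        by (simp only: sum.distrib card_filter_eq_sum[OF less.prems(1)])
      finally have dense: "p * card (B - {b}) + q * card A < (\<Sum>a\<in>A. card {b'\<in>B - {b}. r a b'})"
        using less.prems(3) 1(2) mult_Suc_right[of p "card (B - {b})", folded cB] by linarith
      have fewer: "card A + card (B - {b}) < card A + card B"
        using cB by linarith
      obtain A' B' where "A' \<subseteq> A \<and> B' \<subseteq> B - {b} \<and> A' \<noteq> {} \<and> B' \<noteq> {} \<and>
          (\<forall>b\<in>B'. p < card {a\<in>A'. r a b}) \<and> (\<forall>a\<in>A'. q < card {b\<in>B'. r a b})"
        using less.hyps[OF fewer less.prems(1) finite_Diff[OF less.prems(2)] dense] by (elim exE)
      then show ?thesis by (intro exI[of _ A'] exI[of _ B']) auto
    next
      case 2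
      have cA: "card A = Suc (card (A - {a}))" using 2 less.prems(1) by (metis card.remove)
      have "(\<Sum>a\<in>A. card {b\<in>B. r a b}) = card {b\<in>B. r a b} + (\<Sum>a\<in>A - {a}. card {b\<in>B. r a b})"
        using 2 less.prems(1) by (simp add: sum.remove)
      then have dense: "p * card B + q * card (A - {a}) < (\<Sum>a\<in>A - {a}. card {b\<in>B. r a b})"
        using less.prems(3) 2(2) mult_Suc_right[of q "card (A - {a})", folded cA] by linarith
      have fewer: "card (A - {a}) + card B < card A + card B"
        using cA by linarith
      obtain A' B' where "A' \<subseteq> A - {a} \<and> B' \<subseteq> B \<and> A' \<noteq> {} \<and> B' \<noteq> {} \<and>
          (\<forall>b\<in>B'. p < card {a\<in>A'. r a b}) \<and> (\<forall>a\<in>A'. q < card {b\<in>B'. r a b})"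
        using less.hyps[OF fewer finite_Diff[OF less.prems(1)] less.prems(2) dense] by (elim exE)
      then show ?thesis by (intro exI[of _ A'] exI[of _ B']) auto
    qed
  qed
qed

locale fin_graph =
  fixes V :: "'a set" and E :: "'a \<Rightarrow> 'a \<Rightarrow> bool"
  assumes finV: "finite V"
    and E_sym: "E u v \<Longrightarrow> E v u"
    and E_irrefl: "\<not> E v v"
    and E_V: "E u v \<Longrightarrow> u \<in> V"
begin

definition nb :: "'a \<Rightarrow> 'a set" where
  "nb v = {u. E v u}"

text \<open>Ordered pairs are counted: an edge with both ends in \<open>A \<inter> B\<close> counts
  twice.\<close>

definition ed :: "'a set \<Rightarrow> 'a set \<Rightarrow> nat" where
  "ed A B = (\<Sum>a\<in>A. card (nb a \<inter> B))"

text \<open>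
  The list omits the centre \<open>c\<close>. A cycle of length \<open>2k\<close> and a path on \<open>2k\<close> vertices both leave
  \<open>2k - 1\<close> vertices and differ only in the closing edge.
\<close>

definition branch :: "'a \<Rightarrow> bool \<Rightarrow> nat \<Rightarrow> 'a list \<Rightarrow> bool" where
  "branch c cy k xs \<longleftrightarrow> length xs = 2 * k - 1 \<and> distinct xs \<and> c \<notin> set xs \<and> E c (hd xs) \<and>
     successively E xs \<and> (cy \<longrightarrow> E (last xs) c)"

lemma nb_V: "nb v \<subseteq> V"
  using E_V E_sym by (auto simp: nb_def)

lemma finite_nb [simp]: "finite (nb v)"
  using finite_subset[OF nb_V finV] .

lemma nb_sym: "u \<in> nb v \<longleftrightarrow> v \<in> nb u"
  using E_sym by (auto simp: nb_def)

lemma nb_irrefl [simp]: "v \<notin> nb v"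
  using E_irrefl by (simp add: nb_def)

lemma card_nb_le: "card (nb v) \<le> card V"
  by (rule card_mono[OF finV nb_V])

lemma ed_commute:
  assumes "finite A" "finite B"
  shows "ed A B = ed B A"
proof -
  have 1: "card (nb a \<inter> B) = (\<Sum>b\<in>B. if E a b then 1 else 0)" for a
  proof -
    have "nb a \<inter> B = {b\<in>B. E a b}" by (auto simp: nb_def)
    then show ?thesis using assms by (simp only: card_filter_eq_sum)
  qed
  have 2: "card (nb b \<inter> A) = (\<Sum>a\<in>A. if E a b then 1 else 0)" for b
  proof -
    have "nb b \<inter> A = {a\<in>A. E a b}" using E_sym by (auto simp: nb_def)
    then show ?thesis using assms by (simp only: card_filter_eq_sum)
  qed
  show ?thesis unfolding ed_def 1 2 by (rule sum.swap)
qed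

lemma ed_mono:
  assumes "finite A'" "A \<subseteq> A'" "B \<subseteq> B'"
  shows "ed A B \<le> ed A' B'"
proof -
  have "ed A B \<le> ed A B'"
    unfolding ed_def by (intro sum_mono card_mono) (use assms in auto)
  also have "\<dots> \<le> ed A' B'"
    unfolding ed_def by (intro sum_mono2) (use assms in auto)
  finally show ?thesis .
qed

lemma ed_Un_right:
  assumes "B \<inter> B' = {}"
  shows "ed A (B \<union> B') = ed A B + ed A B'"
proof -
  have "card (nb a \<inter> (B \<union> B')) = card (nb a \<inter> B) + card (nb a \<inter> B')" for a
    using assms by (subst card_Un_disjoint[symmetric]) (auto simp: Int_Un_distrib)
  then show ?thesis by (simp add: ed_def sum.distrib)
qed

lemma ed_Un_left: "finite A \<Longrightarrow> finite A' \<Longrightarrow> A \<inter> A' = {} \<Longrightarrow> ed (A \<union> A') B = ed A B + ed A' B"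
  unfolding ed_def by (rule sum.union_disjoint)

lemma ed_le_mult: "finite B \<Longrightarrow> ed A B \<le> card A * card B"
  unfolding ed_def using sum_bounded_above[of A "\<lambda>a. card (nb a \<inter> B)" "card B"]
  by (simp add: card_mono)

text \<open>
  The first alternative for the degrees from \<open>B\<close> has the sharp bound \<open>k\<close>: when the sides are
  disjoint, only the vertices of the path in \<open>A\<close> have to be avoided.
\<close>

lemma alternating_path:
  assumes a0: "a0 \<in> A - U" "Q a0" and k: "1 \<le> k" and "finite A" "finite B"
    and dA: "\<And>a. a \<in> A \<Longrightarrow> 2 * k \<le> card (nb a \<inter> B - U)"
    and dB: "A \<inter> B = {} \<and> (\<forall>b\<in>B. k \<le> card (nb b \<inter> A - U)) \<or> (\<forall>b\<in>B. 2 * k \<le> card (nb b \<inter> A - U))"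
    and Q: "\<And>a b a'. a \<in> A \<Longrightarrow> b \<in> B \<Longrightarrow> a' \<in> A \<Longrightarrow> E a b \<Longrightarrow> E b a' \<Longrightarrow> a \<noteq> a' \<Longrightarrow> Q a \<Longrightarrow> Q a'"
  shows "\<exists>xs. length xs = 2 * k - 1 \<and> distinct xs \<and> successively E xs \<and> hd xs \<in> A \<and> last xs = a0 \<and>
     set xs \<subseteq> (A \<union> B) - U \<and> Q (hd xs)"
proof -
  \<comment> \<open>The path grows at its head, two vertices at a time, with \<open>a0\<close> fixed
    as its last vertex. In the disjoint case a new vertex of \<open>A\<close> has to avoid only
    \<open>set xs \<inter> A\<close>, whose size is therefore carried along.\<close>
  have "\<exists>xs. length xs = 2 * j - 1 \<and> distinct xs \<and> successively E xs \<and> hd xs \<in> A \<and> last xs = a0 \<and>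
     set xs \<subseteq> (A \<union> B) - U \<and> Q (hd xs) \<and> (A \<inter> B = {} \<longrightarrow> card (set xs \<inter> A) \<le> j)"
    if "1 \<le> j" "j \<le> k" for j
    using that
  proof (induction j rule: dec_induct)
    case base
    show ?case by (rule exI[of _ "[a0]"]) (use a0 in \<open>auto simp: card_insert_if\<close>)
  next
    case (step j)
    then obtain xs where xs: "length xs = 2 * j - 1" "distinct xs" "successively E xs" "hd xs \<in> A"
      "last xs = a0" "set xs \<subseteq> (A \<union> B) - U" "Q (hd xs)" "A \<inter> B = {} \<longrightarrow> card (set xs \<inter> A) \<le> j"
      by auto
    have ne: "xs \<noteq> []" using xs(1) step by auto
    have cxs: "card (set xs) = 2 * j - 1" using xs(1,2) distinct_card by metis
    have "\<not> nb (hd xs) \<inter> B - U \<subseteq> set xs"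
    proof
      assume "nb (hd xs) \<inter> B - U \<subseteq> set xs"
      then have "card (nb (hd xs) \<inter> B - U) \<le> card (set xs)" by (rule card_mono[rotated]) simp
      then show False using dA[OF xs(4)] cxs step by linarith
    qed
    then obtain b where b: "b \<in> nb (hd xs)" "b \<in> B" "b \<notin> U" "b \<notin> set xs" by blast
    let ?F = "insert b (set xs) \<inter> A"
    have "card ?F < card (nb b \<inter> A - U)"
    proof (cases "A \<inter> B = {} \<and> (\<forall>b\<in>B. k \<le> card (nb b \<inter> A - U))")
      case True
      then have "?F = set xs \<inter> A" using b by auto
      then show ?thesis using True xs(8) b(2) step by fastforce
    next
      case False
      then have "2 * k \<le> card (nb b \<inter> A - U)" using dB b by blast
      moreover have "card ?F \<le> card (insert b (set xs))" by (rule card_mono) auto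
      moreover have "card (insert b (set xs)) \<le> Suc (2 * j - 1)" using cxs by (simp add: card_insert_if)
      ultimately show ?thesis using step by linarith
    qed
    then have "\<not> nb b \<inter> A - U \<subseteq> ?F" by (metis card_mono finite_Int finite_insert finite_set linorder_not_le)
    then obtain a where a: "a \<in> nb b" "a \<in> A" "a \<notin> U" "a \<notin> insert b (set xs)" by blast
    show ?case
    proof (rule exI[of _ "a # b # xs"], intro conjI)
      show "successively E (a # b # xs)" using xs(3) a b ne E_sym by (cases xs) (auto simp: nb_def)
      show "Q (hd (a # b # xs))"
        using Q[of "hd xs" b a] xs(4,7) a b ne E_sym by (auto simp: nb_def)
      show "A \<inter> B = {} \<longrightarrow> card (set (a # b # xs) \<inter> A) \<le> Suc j"
      proof
        assume AB: "A \<inter> B = {}"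
        then have "set (a # b # xs) \<inter> A = insert a (set xs \<inter> A)" using a b by auto
        then show "card (set (a # b # xs) \<inter> A) \<le> Suc j" using xs(8) AB by (simp add: card_insert_if)
      qed
    qed (use xs a b step ne in auto)
  qed
  from this[of k] k show ?thesis by auto
qed

lemma ed_core:
  assumes "finite A" "finite B" "p * card B + q * card A < ed A B"
  obtains A' B' where "A' \<subseteq> A" "B' \<subseteq> B" "A' \<noteq> {}" "B' \<noteq> {}"
     "\<And>b. b \<in> B' \<Longrightarrow> p < card (nb b \<inter> A')" "\<And>a. a \<in> A' \<Longrightarrow> q < card (nb a \<inter> B')"
proof -
  have 1: "nb a \<inter> B = {b\<in>B. E a b}" for a B by (auto simp: nb_def)
  have 2: "nb b \<inter> A = {a\<in>A. E a b}" for b A using E_sym by (auto simp: nb_def)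
  from bipartite_core[OF assms(1,2), of p q E] assms(3)
  obtain A' B' where "A' \<subseteq> A \<and> B' \<subseteq> B \<and> A' \<noteq> {} \<and> B' \<noteq> {} \<and>
     (\<forall>b\<in>B'. p < card {a\<in>A'. E a b}) \<and> (\<forall>a\<in>A'. q < card {b\<in>B'. E a b})"
    unfolding ed_def 1 by blast
  then show ?thesis using that[of A' B'] by (simp add: 1[of _ B'] 2[of _ A'])
qed

text \<open>The alternating path starts and ends in \<open>A\<close>, hence at neighbours of
  \<open>w\<close>, so the same path serves as a branch of either kind.\<close>

lemma branch_of_dense:
  assumes "finite A" "finite B" "A \<subseteq> nb w" "w \<notin> B" "1 \<le> k"
    and dense: "A \<inter> B = {} \<and> (k - 1) * card B + 2 * k * card A < ed A B
        \<or> 2 * k * card B + 2 * k * card A < ed A B"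
  shows "\<exists>xs. branch w cy k xs \<and> set xs \<subseteq> A \<union> B"
proof -
  \<comment> \<open>Core degrees are strictly above \<open>p\<close>, so \<open>k - 1\<close> yields
    the degree \<open>k\<close> that suffices for disjoint sides.\<close>
  define p where "p = (if A \<inter> B = {} \<and> (k - 1) * card B + 2 * k * card A < ed A B then k - 1 else 2 * k)"
  have "p * card B + 2 * k * card A < ed A B" using dense by (auto simp: p_def)
  from ed_core[OF assms(1,2) this] obtain A' B' where
    AB: "A' \<subseteq> A" "B' \<subseteq> B" "A' \<noteq> {}" "B' \<noteq> {}"
     "\<And>b. b \<in> B' \<Longrightarrow> p < card (nb b \<inter> A')" "\<And>a. a \<in> A' \<Longrightarrow> 2 * k < card (nb a \<inter> B')" by blast
  obtain a0 where a0: "a0 \<in> A'" using AB by blast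
  have "\<exists>xs. length xs = 2 * k - 1 \<and> distinct xs \<and> successively E xs \<and> hd xs \<in> A' \<and> last xs = a0 \<and>
     set xs \<subseteq> (A' \<union> B') - {} \<and> True"
  proof (rule alternating_path[where Q = "\<lambda>_. True"])
    show "A' \<inter> B' = {} \<and> (\<forall>b\<in>B'. k \<le> card (nb b \<inter> A' - {})) \<or> (\<forall>b\<in>B'. 2 * k \<le> card (nb b \<inter> A' - {}))"
    proof (cases "p = k - 1 \<and> A \<inter> B = {}")
      case True
      then have "A' \<inter> B' = {}" using AB by blast
      moreover have "\<forall>b\<in>B'. k \<le> card (nb b \<inter> A')" using AB(5) True assms(5) by force
      ultimately show ?thesis by simp
    next
      case False
      then have "p = 2 * k" by (auto simp: p_def split: if_splits)
      then show ?thesis using AB(5) by (metis Diff_empty less_imp_le)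
    qed
    show "2 * k \<le> card (nb a \<inter> B' - {})" if "a \<in> A'" for a using AB(6)[OF that] by simp
    show "finite A'" "finite B'" using AB(1,2) assms(1,2) finite_subset by blast+
  qed (use a0 assms(5) in auto)
  then obtain xs where xs: "length xs = 2 * k - 1" "distinct xs" "successively E xs" "hd xs \<in> A'" "last xs = a0"
     "set xs \<subseteq> A' \<union> B'" by auto
  have "branch w cy k xs"
    unfolding branch_def
  proof (intro conjI impI)
    show "w \<notin> set xs" using xs(6) AB assms(3,4) nb_irrefl by blast
    show "E w (hd xs)" using xs(4) AB assms(3) by (auto simp: nb_def)
    show "E (last xs) w" using xs(5) a0 AB assms(3) E_sym by (auto simp: nb_def)
  qed (use xs in auto)
  then show ?thesis using xs AB by blast
qed

end

section \<open>Fans\<close>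

context fin_graph
begin

definition fan :: "nat set \<Rightarrow> (nat \<Rightarrow> nat) \<Rightarrow> (nat \<Rightarrow> bool) \<Rightarrow> 'a \<Rightarrow> (nat \<Rightarrow> 'a list) \<Rightarrow> bool" where
  "fan I kk cyc c xss \<longleftrightarrow> (\<forall>i\<in>I. branch c (cyc i) (kk i) (xss i)) \<and>
     (\<forall>i\<in>I. \<forall>j\<in>I. i \<noteq> j \<longrightarrow> set (xss i) \<inter> set (xss j) = {})"

lemma fan_insert:
  assumes "fan I kk cyc c xss" "i \<notin> I" "branch c (cyc i) (kk i) xs"
    and "\<And>j. j \<in> I \<Longrightarrow> set (xss j) \<inter> set xs = {}"
  shows "fan (insert i I) kk cyc c (xss(i := xs))"
  using assms unfolding fan_def by (auto simp: Int_commute)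

text \<open>The bound on \<open>card U\<close> is at least the number of vertices in the branches of
  any partial fan, so these can be passed as the forbidden set.\<close>

lemma greedy_fan:
  assumes "finite I"
    and ex: "\<And>i U. i \<in> I \<Longrightarrow> finite U \<Longrightarrow> card U \<le> (\<Sum>i\<in>I. 2 * kk i) \<Longrightarrow>
        \<exists>xs. branch c (cyc i) (kk i) xs \<and> set xs \<inter> U = {}"
  shows "\<exists>xss. fan I kk cyc c xss"
proof -
  have "\<exists>xss. fan J kk cyc c xss" if "J \<subseteq> I" for J
    using finite_subset[OF that assms(1)] that
  proof (induction J rule: finite_induct)
    case empty
    show ?case by (simp add: fan_def)
  next
    case (insert i J)
    then obtain xss where xss: "fan J kk cyc c xss" by auto
    let ?U = "\<Union>j\<in>J. set (xss j)"
    have "card ?U \<le> (\<Sum>j\<in>J. card (set (xss j)))" by (rule card_UN_le[OF insert.hyps(1)])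
    also have "\<dots> \<le> (\<Sum>j\<in>J. 2 * kk j)"
    proof (rule sum_mono)
      fix j assume "j \<in> J"
      then have "length (xss j) = 2 * kk j - 1" using xss by (auto simp: fan_def branch_def)
      then show "card (set (xss j)) \<le> 2 * kk j" using card_length[of "xss j"] by linarith
    qed
    also have "\<dots> \<le> (\<Sum>j\<in>I. 2 * kk j)"
      by (rule sum_mono2) (use insert assms in auto)
    finally obtain xs where xs: "branch c (cyc i) (kk i) xs" "set xs \<inter> ?U = {}"
      using ex[of i ?U] insert by auto
    have "fan (insert i J) kk cyc c (xss(i := xs))"
      by (rule fan_insert) (use xss xs insert in auto)
    then show ?case by blast
  qed
  then show ?thesis by blast
qed

text \<open>\<open>S\<close> holds the hubs and \<open>Q\<close> the leaves. The list alternates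
  leaf, hub, ..., leaf; the exact numbers used of each are recorded because hubs are scarce when
  branches are combined.\<close>

lemma hub_list:
  assumes "finite S" "finite Q" "S \<inter> Q = {}" "\<And>s q. s \<in> S \<Longrightarrow> q \<in> Q \<Longrightarrow> E s q"
    "q0 \<in> Q" "j \<le> card S" "Suc j \<le> card Q"
  shows "\<exists>xs. length xs = 2 * j + 1 \<and> distinct xs \<and> successively E xs \<and> hd xs = q0 \<and> last xs \<in> Q \<and>
      set xs \<subseteq> S \<union> Q \<and> card (set xs \<inter> S) = j \<and> card (set xs \<inter> Q) = Suc j"
  using assms
proof (induction j arbitrary: q0 S Q)
  case 0
  then have "{q0} \<inter> S = {}" "{q0} \<inter> Q = {q0}" by auto
  then show ?case using 0 by (intro exI[of _ "[q0]"]) simp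
next
  case (Suc j)
  have "S \<noteq> {}" using Suc.prems(6) by auto
  then obtain s where s: "s \<in> S" by auto
  have cQ: "card (Q - {q0}) \<ge> Suc j" using Suc.prems by simp
  have "Q - {q0} \<noteq> {}"
  proof
    assume "Q - {q0} = {}"
    then show False using cQ by (simp only: card.empty)
  qed
  then obtain q1 where q1: "q1 \<in> Q - {q0}" by blast
  have "card (S - {s}) \<ge> j" using Suc.prems s by simp
  then obtain xs where xs: "length xs = 2 * j + 1" "distinct xs" "successively E xs" "hd xs = q1"
     "last xs \<in> Q - {q0}" "set xs \<subseteq> (S - {s}) \<union> (Q - {q0})" "card (set xs \<inter> (S - {s})) = j"
     "card (set xs \<inter> (Q - {q0})) = Suc j"
    using Suc.IH[of "S - {s}" "Q - {q0}" q1] Suc.prems(1-4) q1 cQ by auto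
  have ne: "xs \<noteq> []" using xs(1) by auto
  have sQ: "s \<notin> Q" "q0 \<notin> S" "s \<noteq> q0" using s Suc.prems by auto
  have 1: "set (q0 # s # xs) \<inter> S = insert s (set xs \<inter> (S - {s}))" using s sQ by auto
  have 2: "set (q0 # s # xs) \<inter> Q = insert q0 (set xs \<inter> (Q - {q0}))" using sQ Suc.prems by auto
  have "successively E (q0 # s # xs)"
    using xs(3,4) ne s q1 Suc.prems(4,5) E_sym by (cases xs) auto
  moreover have "distinct (q0 # s # xs)" using xs(2,6) sQ by auto
  moreover have "card (set (q0 # s # xs) \<inter> S) = Suc j" unfolding 1 using xs(7) by simp
  moreover have "card (set (q0 # s # xs) \<inter> Q) = Suc (Suc j)" unfolding 2 using xs(8) by simp
  moreover have "set (q0 # s # xs) \<subseteq> S \<union> Q" using xs(6) s Suc.prems(5) by auto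
  ultimately show ?case using xs(1,5) ne by (intro exI[of _ "q0 # s # xs"]) auto
qed

text \<open>A branch of parameter k alternates k leaves with k - 1 hubs, and both its ends are
  leaves, hence adjacent to \<open>c\<close>. This is where \<kappa> comes from: it is the number of
  hubs needed besides the centre.\<close>

lemma hub_fan:
  assumes "finite I" "finite S" "finite Q" "S \<inter> Q = {}" "\<And>s q. s \<in> S \<Longrightarrow> q \<in> Q \<Longrightarrow> E s q"
    "\<And>q. q \<in> Q \<Longrightarrow> E c q" "c \<notin> S" "c \<notin> Q" "\<And>i. i \<in> I \<Longrightarrow> 1 \<le> kk i"
    "(\<Sum>i\<in>I. kk i - 1) \<le> card S" "(\<Sum>i\<in>I. kk i) \<le> card Q"
  shows "\<exists>xss. fan I kk cyc c xss \<and> (\<forall>i\<in>I. set (xss i) \<subseteq> S \<union> Q)"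
  using assms
proof (induction I arbitrary: S Q rule: finite_induct)
  case empty
  show ?case by (simp add: fan_def)
next
  case (insert i I)
  have k1: "1 \<le> kk i" using insert.prems by auto
  have sums: "(\<Sum>i\<in>insert i I. kk i - 1) = (kk i - 1) + (\<Sum>i\<in>I. kk i - 1)"
    "(\<Sum>i\<in>insert i I. kk i) = kk i + (\<Sum>i\<in>I. kk i)" using insert.hyps by auto
  have "Q \<noteq> {}" using insert.prems(10) sums k1 by (metis add_leE card.empty le_zero_eq not_one_le_zero)
  then obtain q0 where q0: "q0 \<in> Q" by auto
  have "\<exists>xs. length xs = 2 * (kk i - 1) + 1 \<and> distinct xs \<and> successively E xs \<and> hd xs = q0 \<and> last xs \<in> Q \<and>
      set xs \<subseteq> S \<union> Q \<and> card (set xs \<inter> S) = kk i - 1 \<and> card (set xs \<inter> Q) = Suc (kk i - 1)"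
    by (rule hub_list[OF insert.prems(1-4) q0]) (use insert.prems(9,10) sums k1 in auto)
  moreover have "2 * (kk i - 1) + 1 = 2 * kk i - 1" "Suc (kk i - 1) = kk i" using k1 by auto
  ultimately obtain xs where xs: "length xs = 2 * kk i - 1" "distinct xs" "successively E xs" "hd xs = q0" "last xs \<in> Q"
      "set xs \<subseteq> S \<union> Q" "card (set xs \<inter> S) = kk i - 1" "card (set xs \<inter> Q) = kk i"
    by metis
  have "card (S - set xs) = card S - (kk i - 1)"
    using xs(7) insert.prems(1) by (metis Int_commute card_Diff_subset_Int finite_Int)
  then have cS: "(\<Sum>i\<in>I. kk i - 1) \<le> card (S - set xs)" using insert.prems(9) sums by linarith
  have "card (Q - set xs) = card Q - kk i"
    using xs(8) insert.prems(2) by (metis Int_commute card_Diff_subset_Int finite_Int)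
  then have cQ: "(\<Sum>i\<in>I. kk i) \<le> card (Q - set xs)" using insert.prems(10) sums by linarith
  have "\<exists>xss. fan I kk cyc c xss \<and> (\<forall>i\<in>I. set (xss i) \<subseteq> (S - set xs) \<union> (Q - set xs))"
    by (rule insert.IH) (use insert.prems cS cQ in auto)
  then obtain xss where xss: "fan I kk cyc c xss" "\<forall>i\<in>I. set (xss i) \<subseteq> (S - set xs) \<union> (Q - set xs)"
    by blast
  have br: "branch c (cyc i) (kk i) xs"
    unfolding branch_def using xs insert.prems(5,6,7) q0 E_sym by blast
  have "fan (insert i I) kk cyc c (xss(i := xs))"
    by (rule fan_insert[OF xss(1) insert.hyps(2) br]) (use xss(2) in blast)
  moreover have "\<forall>j\<in>insert i I. set ((xss(i := xs)) j) \<subseteq> S \<union> Q"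
    using xss(2) xs(6) by auto
  ultimately show ?case by blast
qed

text \<open>Meant for a prescribed branch \<open>xs\<close> that spends fewer hubs than the regular
  \<open>kk i - 1\<close>: the hubs and leaves outside \<open>xs\<close> have to suffice for the
  remaining branches only.\<close>

lemma hub_fan_with_branch:
  assumes "finite I" "i \<in> I" "branch c (cyc i) (kk i) xs"
    "finite S" "finite Q" "S \<inter> Q = {}" "\<And>s q. s \<in> S \<Longrightarrow> q \<in> Q \<Longrightarrow> E s q"
    "\<And>q. q \<in> Q \<Longrightarrow> E c q" "c \<notin> S" "c \<notin> Q" "\<And>i. i \<in> I \<Longrightarrow> 1 \<le> kk i"
    "(\<Sum>i\<in>I. kk i - 1) \<le> card (S - set xs) + (kk i - 1)" "(\<Sum>i\<in>I. kk i) \<le> card (Q - set xs) + kk i"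
  shows "\<exists>xss. fan I kk cyc c xss"
proof -
  have "\<exists>xss. fan (I - {i}) kk cyc c xss \<and> (\<forall>j\<in>I - {i}. set (xss j) \<subseteq> (S - set xs) \<union> (Q - set xs))"
  proof (rule hub_fan)
    show "(\<Sum>i\<in>I - {i}. kk i - 1) \<le> card (S - set xs)"
      using assms(12) sum.remove[OF assms(1,2), of "\<lambda>i. kk i - 1"] by linarith
    show "(\<Sum>i\<in>I - {i}. kk i) \<le> card (Q - set xs)"
      using assms(13) sum.remove[OF assms(1,2), of kk] by linarith
  qed (use assms in auto)
  then obtain xss where xss: "fan (I - {i}) kk cyc c xss"
    "\<forall>j\<in>I - {i}. set (xss j) \<subseteq> (S - set xs) \<union> (Q - set xs)" by blast
  have "fan (insert i (I - {i})) kk cyc c (xss(i := xs))"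
    by (rule fan_insert[OF xss(1) _ assms(3)]) (use xss(2) in auto)
  then show ?thesis using assms(2) by (metis insert_Diff)
qed

text \<open>A deleted vertex of \<open>A\<close> costs at most \<Delta> edges, a deleted vertex of
  \<open>B\<close> at most \<open>card A\<close>. For small \<Delta> the cost contains no term of
  the order of \<open>card B\<close>.\<close>

lemma ed_remove:
  assumes "finite A" "finite B" "finite U" and \<Delta>: "\<And>a. a \<in> A \<Longrightarrow> card (nb a \<inter> B) \<le> \<Delta>"
  shows "ed A B \<le> ed (A - U) (B - U) + card U * (\<Delta> + card A)"
proof -
  have "ed A B = ed ((A - U) \<union> (A \<inter> U)) B" by (simp add: Un_Diff_Int)
  also have "\<dots> = ed (A - U) B + ed (A \<inter> U) B" by (rule ed_Un_left) (use assms in auto)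
  also have "ed (A \<inter> U) B \<le> card (A \<inter> U) * \<Delta>"
    unfolding ed_def using sum_bounded_above[of "A \<inter> U" "\<lambda>a. card (nb a \<inter> B)" \<Delta>] \<Delta> by simp
  also have "\<dots> \<le> card U * \<Delta>" by (simp add: assms(3) card_mono)
  also have "ed (A - U) B = ed (A - U) ((B - U) \<union> (B \<inter> U))" by (simp add: Un_Diff_Int)
  also have "\<dots> = ed (A - U) (B - U) + ed (A - U) (B \<inter> U)" by (rule ed_Un_right) auto
  also have "ed (A - U) (B \<inter> U) \<le> card (A - U) * card (B \<inter> U)" by (rule ed_le_mult) (use assms in auto)
  also have "\<dots> \<le> card A * card U" by (rule mult_le_mono) (use assms in \<open>auto intro: card_mono\<close>)
  finally show ?thesis by (simp add: algebra_simps)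
qed

end

section \<open>Edge counts and common neighbourhoods in the absence of the fan\<close>

locale fan_free = fin_graph V E for V :: "'a set" and E +
  fixes I :: "nat set" and kk :: "nat \<Rightarrow> nat" and cyc :: "nat \<Rightarrow> bool"
  assumes finI: "finite I" and I_ne: "I \<noteq> {}"
    and kk2: "i \<in> I \<Longrightarrow> 2 \<le> kk i"
    and no_fan: "\<not> fan I kk cyc c xss"
begin

text \<open>\<open>kap\<close> is the \<kappa> of the theorem and counts hubs, \<open>mm\<close>
  counts leaves, and \<open>MM\<close> bounds the number of vertices of a fan other than its
  centre.\<close>

definition kap :: nat where "kap = (\<Sum>i\<in>I. kk i - 1)"
definition mm :: nat where "mm = (\<Sum>i\<in>I. kk i)"
definition MM :: nat where "MM = (\<Sum>i\<in>I. 2 * kk i)"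

lemma kk_le_MM: "i \<in> I \<Longrightarrow> 2 * kk i \<le> MM"
  unfolding MM_def by (rule member_le_sum) (use finI in auto)

lemma kap_pos: "1 \<le> kap"
proof -
  obtain i where i: "i \<in> I" using I_ne by auto
  have "kk i - 1 \<le> kap" unfolding kap_def by (rule member_le_sum) (use i finI in auto)
  then show ?thesis using kk2[OF i] by linarith
qed

text \<open>Half of the allowance \<open>2 * MM\<close> pays for deleting the branches already
  placed, the other half is the density that \<open>branch_of_dense\<close> asks for without
  disjointness. \<open>A\<close> is a subset of the neighbourhood so that the bound also applies
  inside an induced subgraph.\<close>

lemma ed_nb_subset_le:
  assumes "A \<subseteq> nb w" "B \<subseteq> V" "w \<notin> B"
  shows "ed A B \<le> 2 * MM * (card A + card B)"
proof (rule ccontr)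
  assume *: "\<not> ?thesis"
  have fB: "finite B" using assms finV finite_subset by blast
  have fA: "finite A" using assms finite_subset finite_nb by blast
  have "\<exists>xss. fan I kk cyc w xss"
  proof (rule greedy_fan[OF finI], fold MM_def)
    fix i and U :: "'a set" assume i: "i \<in> I" and U: "finite U" "card U \<le> MM"
    let ?A = "A - U" and ?B = "B - U"
    have "ed A B \<le> ed ?A ?B + card U * (card B + card A)"
      by (rule ed_remove) (use fA fB U in \<open>auto intro: card_mono\<close>)
    also have "\<dots> \<le> ed ?A ?B + MM * (card B + card A)" using U by simp
    finally have "MM * (card B + card A) < ed ?A ?B" using * by (simp add: algebra_simps)
    moreover have "2 * kk i * card ?B + 2 * kk i * card ?A \<le> MM * card B + MM * card A"
      by (intro add_mono mult_le_mono kk_le_MM[OF i] card_mono) (use fA fB in auto)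
    ultimately have "2 * kk i * card ?B + 2 * kk i * card ?A < ed ?A ?B" by (simp add: algebra_simps)
    then obtain xs where xs: "branch w (cyc i) (kk i) xs" "set xs \<subseteq> ?A \<union> ?B"
      using branch_of_dense[of ?A ?B w "kk i" "cyc i"] fA fB assms(1,3) kk2[OF i] by auto
    then show "\<exists>xs. branch w (cyc i) (kk i) xs \<and> set xs \<inter> U = {}" by blast
  qed
  then show False using no_fan by blast
qed

lemmas ed_nb_le = ed_nb_subset_le[OF order_refl]

text \<open>The cost given by \<open>ed_remove\<close> has no term in \<open>card B\<close> here, so
  the leading coefficient is the sharp one of \<open>branch_of_dense\<close> for disjoint
  sides.\<close>

lemma ed_nb_le_bounded_degree:
  assumes "A \<subseteq> nb w" "B \<subseteq> V" "w \<notin> B" "A \<inter> B = {}" "\<And>i. i \<in> I \<Longrightarrow> kk i \<le> K"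
    and \<Delta>: "\<And>a. a \<in> A \<Longrightarrow> card (nb a \<inter> B) \<le> \<Delta>"
  shows "ed A B \<le> (K - 1) * card B + MM * card A + MM * (\<Delta> + card A)"
proof (rule ccontr)
  assume *: "\<not> ?thesis"
  have fB: "finite B" using assms finV finite_subset by blast
  have fA: "finite A" using assms finite_subset finite_nb by blast
  have "\<exists>xss. fan I kk cyc w xss"
  proof (rule greedy_fan[OF finI], fold MM_def)
    fix i and U :: "'a set" assume i: "i \<in> I" and U: "finite U" "card U \<le> MM"
    let ?A = "A - U" and ?B = "B - U"
    have "ed A B \<le> ed ?A ?B + card U * (\<Delta> + card A)"
      by (rule ed_remove) (use fA fB U \<Delta> in auto)
    also have "\<dots> \<le> ed ?A ?B + MM * (\<Delta> + card A)" using U by simp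
    finally have "(K - 1) * card B + MM * card A < ed ?A ?B" using * by (simp add: algebra_simps)
    moreover have "(kk i - 1) * card ?B + 2 * kk i * card ?A \<le> (K - 1) * card B + MM * card A"
      by (intro add_mono mult_le_mono kk_le_MM[OF i] card_mono diff_le_mono assms(5)[OF i]) (use fA fB in auto)
    ultimately have "(kk i - 1) * card ?B + 2 * kk i * card ?A < ed ?A ?B" by linarith
    moreover have "?A \<inter> ?B = {}" using assms(4) by blast
    ultimately obtain xs where xs: "branch w (cyc i) (kk i) xs" "set xs \<subseteq> ?A \<union> ?B"
      using branch_of_dense[of ?A ?B w "kk i" "cyc i"] fA fB assms(1,3) kk2[OF i] by auto
    then show "\<exists>xs. branch w (cyc i) (kk i) xs \<and> set xs \<inter> U = {}" by blast
  qed
  then show False using no_fan by blast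
qed

definition common :: "'a set \<Rightarrow> 'a set" where
  "common S = {u\<in>V. \<forall>s\<in>S. E s u}"

lemma finite_common [simp]: "finite (common S)"
  using finV by (simp add: common_def)

lemma common_disjoint: "S \<inter> common S = {}"
  using E_irrefl by (auto simp: common_def)

text \<open>One of the \<open>Suc kap\<close> vertices is taken as the centre; the other
  \<open>kap\<close> are exactly the hubs that \<open>hub_fan\<close> asks for.\<close>

lemma card_common_less:
  assumes "S \<subseteq> V" "card S = Suc kap"
  shows "card (common S) < mm"
proof (rule ccontr)
  assume *: "\<not> ?thesis"
  obtain c where c: "c \<in> S" using assms(2) by fastforce
  have fS: "finite S" using assms finV finite_subset by blast
  have "\<exists>xss. fan I kk cyc c xss \<and> (\<forall>i\<in>I. set (xss i) \<subseteq> (S - {c}) \<union> common S)"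
  proof (rule hub_fan[OF finI])
    show "(\<Sum>i\<in>I. kk i - 1) \<le> card (S - {c})" using assms(2) c fS by (simp add: kap_def)
    show "(\<Sum>i\<in>I. kk i) \<le> card (common S)" using * by (simp add: mm_def)
    show "1 \<le> kk i" if "i \<in> I" for i using kk2[OF that] by simp
  qed (use fS finV c common_disjoint[of S] in \<open>auto simp: common_def\<close>)
  then show False using no_fan by blast
qed

text \<open>A vertex with more than \<open>kap\<close> neighbours in \<open>S\<close> lies in
  \<open>common T\<close> for one of the at most \<open>2 ^ card S\<close> sets
  \<open>T \<subseteq> S\<close> with \<open>Suc kap\<close> elements, and each of these has fewer
  than \<open>mm\<close> common neighbours. All other vertices contribute at most
  \<open>kap\<close>.\<close>

lemma sum_nb_inter_le:
  assumes "S \<subseteq> V" "W \<subseteq> V"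
  shows "(\<Sum>v\<in>W. card (nb v \<inter> S)) \<le> kap * card W + card S * (mm * 2 ^ card S)"
proof -
  have fS: "finite S" and fW: "finite W" using assms finV finite_subset by blast+
  define bad where "bad = {v\<in>V. kap < card (nb v \<inter> S)}"
  have fb: "finite bad" using finV by (simp add: bad_def)
  let ?T = "{T. T \<subseteq> S \<and> card T = Suc kap}"
  have "bad \<subseteq> (\<Union>T\<in>?T. common T)"
  proof
    fix v assume v: "v \<in> bad"
    then have "Suc kap \<le> card (nb v \<inter> S)" by (simp add: bad_def)
    then obtain T where T: "T \<subseteq> nb v \<inter> S" "card T = Suc kap"
      by (meson obtain_subset_with_card_n)
    then have "v \<in> common T" using v E_sym by (auto simp: common_def bad_def nb_def)
    then show "v \<in> (\<Union>T\<in>?T. common T)" using T by blast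
  qed
  moreover have fT: "finite ?T" by (rule finite_subset[of _ "Pow S"]) (use fS in auto)
  ultimately have "card bad \<le> card (\<Union>T\<in>?T. common T)" by (intro card_mono) auto
  also have "\<dots> \<le> (\<Sum>T\<in>?T. card (common T))" by (rule card_UN_le[OF fT])
  also have "\<dots> \<le> card ?T * mm"
  proof -
    have "card (common T) \<le> mm" if "T \<in> ?T" for T
      using card_common_less[of T] that subset_trans[of T S V] assms(1) by auto
    then show ?thesis using sum_bounded_above[of ?T "\<lambda>T. card (common T)" mm] by simp
  qed
  also have "\<dots> \<le> 2 ^ card S * mm"
  proof -
    have "card ?T \<le> card (Pow S)" by (rule card_mono) (use fS in auto)
    then show ?thesis using fS by (simp add: card_Pow)
  qed
  finally have cb: "card bad \<le> 2 ^ card S * mm" .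
  have "(\<Sum>v\<in>W. card (nb v \<inter> S)) \<le> (\<Sum>v\<in>W. kap + (if v \<in> bad then card S else 0))"
  proof (rule sum_mono)
    fix v assume "v \<in> W"
    then have "v \<in> V" using assms by auto
    show "card (nb v \<inter> S) \<le> kap + (if v \<in> bad then card S else 0)"
    proof (cases "v \<in> bad")
      case True
      have "card (nb v \<inter> S) \<le> card S" by (rule card_mono) (use fS in auto)
      then show ?thesis using True by simp
    next
      case False
      then show ?thesis using \<open>v \<in> V\<close> by (auto simp: bad_def)
    qed
  qed
  also have "\<dots> = kap * card W + card (W \<inter> bad) * card S"
    using fW by (simp add: sum.distrib sum.If_cases)
  also have "card (W \<inter> bad) \<le> card bad" by (rule card_mono) (use fb in auto)
  also note cb
  finally show ?thesis by (simp add: algebra_simps)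
qed

text \<open>Taking the centre from \<open>L\<close> leaves \<open>kap - 1\<close> hubs, one too few.
  A branch that runs along \<open>p\<close>, \<open>q\<close>, \<open>r\<close> inside the common
  neighbourhood and alternates with hubs from \<open>r\<close> on uses \<open>k - 2\<close> hubs
  instead of \<open>k - 1\<close>, which makes up the deficit.\<close>

lemma common_no_P3:
  assumes L: "L \<subseteq> V" "card L = kap" and big: "mm + 2 \<le> card (common L)"
    and pqr: "p \<in> common L" "q \<in> common L" "r \<in> common L" "p \<noteq> r" "E p q" "E q r"
  shows False
proof -
  have fL: "finite L" using L finV finite_subset by blast
  obtain c where c: "c \<in> L" using L(2) kap_pos by (metis card.empty equals0I not_one_le_zero)
  obtain i where i: "i \<in> I" using I_ne by auto
  define k where "k = kk i"
  have k: "2 \<le> k" using kk2[OF i] by (simp add: k_def)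
  let ?S = "L - {c}" and ?Q = "common L - {p, q}"
  have pq: "p \<noteq> q" "q \<noteq> r" using pqr E_irrefl by auto
  have kap: "k - 1 \<le> kap" unfolding kap_def k_def by (rule member_le_sum) (use i finI in auto)
  have mmk: "k \<le> mm" unfolding mm_def k_def by (rule member_le_sum) (use i finI in auto)
  have cS: "card ?S = kap - 1" using c fL L(2) by simp
  have cQ: "card ?Q = card (common L) - 2" using pqr pq by (simp add: card_Diff_subset)
  have dis: "L \<inter> common L = {}" by (rule common_disjoint)
  have "\<exists>ys. length ys = 2 * (k - 2) + 1 \<and> distinct ys \<and> successively E ys \<and> hd ys = r \<and> last ys \<in> ?Q \<and>
      set ys \<subseteq> ?S \<union> ?Q \<and> card (set ys \<inter> ?S) = k - 2 \<and> card (set ys \<inter> ?Q) = Suc (k - 2)"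
  proof (rule hub_list)
    show "k - 2 \<le> card ?S" using cS kap by linarith
    show "Suc (k - 2) \<le> card ?Q" using cQ big mmk k by linarith
    show "r \<in> ?Q" using pqr pq by auto
    show "E s q'" if "s \<in> ?S" "q' \<in> ?Q" for s q' using that by (auto simp: common_def)
  qed (use fL dis in auto)
  then obtain ys where ys: "length ys = 2 * (k - 2) + 1" "distinct ys" "successively E ys" "hd ys = r" "last ys \<in> ?Q"
      "set ys \<subseteq> ?S \<union> ?Q" "card (set ys \<inter> ?S) = k - 2" "card (set ys \<inter> ?Q) = Suc (k - 2)" by blast
  have ne: "ys \<noteq> []" using ys(1) by auto
  let ?xs = "p # q # ys"
  have br: "branch c (cyc i) (kk i) ?xs"
    unfolding branch_def
  proof (intro conjI impI)
    show "length ?xs = 2 * kk i - 1" using ys(1) k by (simp add: k_def)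
    show "distinct ?xs" using ys(2,6) pq pqr dis by auto
    show "c \<notin> set ?xs" using ys(6) c pqr dis by auto
    show "E c (hd ?xs)" using pqr(1) c by (simp add: common_def)
    show "successively E ?xs" using ys(3,4) pqr(5,6) ne by (cases ys) auto
    show "E (last ?xs) c" using ys(5) ne c E_sym by (auto simp: common_def)
  qed
  have "set ?xs \<inter> ?S = set ys \<inter> ?S" using pqr dis by auto
  then have "card (?S - set ?xs) = card ?S - (k - 2)"
    using ys(7) fL by (metis Int_commute card_Diff_subset_Int finite_Diff finite_Int)
  then have 1: "(\<Sum>i\<in>I. kk i - 1) \<le> card (?S - set ?xs) + (kk i - 1)"
    using cS kap k unfolding kap_def[symmetric] k_def[symmetric] by linarith
  have "set ?xs \<inter> ?Q = set ys \<inter> ?Q" by auto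
  then have "card (?Q - set ?xs) = card ?Q - Suc (k - 2)"
    using ys(8) by (metis Int_commute card_Diff_subset_Int finite_Diff finite_Int finite_common)
  then have 2: "(\<Sum>i\<in>I. kk i) \<le> card (?Q - set ?xs) + kk i"
    using cQ big mmk k unfolding mm_def[symmetric] k_def[symmetric] by linarith
  have "\<exists>xss. fan I kk cyc c xss"
  proof (rule hub_fan_with_branch[where i = i and xs = ?xs and S = ?S and Q = ?Q])
    show "1 \<le> kk i" if "i \<in> I" for i using kk2[OF that] by simp
    show "E s q'" if "s \<in> ?S" "q' \<in> ?Q" for s q' using that by (auto simp: common_def)
    show "E c q'" if "q' \<in> ?Q" for q' using that c by (auto simp: common_def)
  qed (use fL dis c 1 2 br finI i in auto)
  then show False using no_fan by blast
qed

text \<open>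
  The first edge is followed by a hub, then by the second edge, and hubs and leaves alternate from
  there on. This branch skips two even positions, 2 and 4, and spends only one hub on them,
  which requires \<open>kk i \<ge> 3\<close>.
\<close>

lemma common_no_2K2:
  assumes i: "i \<in> I" "3 \<le> kk i" and L: "L \<subseteq> V" "card L = kap" and big: "mm + 2 \<le> card (common L)"
    and pq: "p1 \<in> common L" "p2 \<in> common L" "q1 \<in> common L" "q2 \<in> common L"
      "distinct [p1, p2, q1, q2]" "E p1 p2" "E q1 q2"
  shows False
proof -
  have fL: "finite L" using L finV finite_subset by blast
  define k where "k = kk i"
  have k: "3 \<le> k" using i by (simp add: k_def)
  have kap: "k - 1 \<le> kap" unfolding kap_def k_def by (rule member_le_sum) (use i finI in auto)
  have mmk: "k \<le> mm" unfolding mm_def k_def by (rule member_le_sum) (use i finI in auto)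
  obtain c where c: "c \<in> L" using L(2) kap_pos by (metis card.empty equals0I not_one_le_zero)
  have cS0: "card (L - {c}) = kap - 1" using c fL L(2) by simp
  then have "L - {c} \<noteq> {}" using kap k by fastforce
  then obtain h where h: "h \<in> L - {c}" by auto
  let ?S = "L - {c} - {h}" and ?Q = "common L - {p1, p2, q1}"
  have cS: "card ?S = kap - 2" using cS0 h fL by simp
  have cQ: "card ?Q = card (common L) - 3" using pq by (simp add: card_Diff_subset)
  have dis: "L \<inter> common L = {}" by (rule common_disjoint)
  have "\<exists>ys. length ys = 2 * (k - 3) + 1 \<and> distinct ys \<and> successively E ys \<and> hd ys = q2 \<and> last ys \<in> ?Q \<and>
      set ys \<subseteq> ?S \<union> ?Q \<and> card (set ys \<inter> ?S) = k - 3 \<and> card (set ys \<inter> ?Q) = Suc (k - 3)"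
  proof (rule hub_list)
    show "k - 3 \<le> card ?S" using cS kap by linarith
    show "Suc (k - 3) \<le> card ?Q" using cQ big mmk k by linarith
    show "q2 \<in> ?Q" using pq by auto
    show "E s q'" if "s \<in> ?S" "q' \<in> ?Q" for s q' using that by (auto simp: common_def)
  qed (use fL dis in auto)
  then obtain ys where ys: "length ys = 2 * (k - 3) + 1" "distinct ys" "successively E ys" "hd ys = q2" "last ys \<in> ?Q"
      "set ys \<subseteq> ?S \<union> ?Q" "card (set ys \<inter> ?S) = k - 3" "card (set ys \<inter> ?Q) = Suc (k - 3)" by blast
  have ne: "ys \<noteq> []" using ys(1) by auto
  \<comment> \<open>The hubs used are \<open>h\<close> and the \<open>k - 3\<close> hubs in
    \<open>ys\<close>, again one less than the regular \<open>k - 1\<close>.\<close>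
  let ?xs = "p1 # p2 # h # q1 # ys"
  have hc: "E h u" if "u \<in> common L" for u using that h by (auto simp: common_def)
  have br: "branch c (cyc i) (kk i) ?xs"
    unfolding branch_def
  proof (intro conjI impI)
    show "length ?xs = 2 * kk i - 1" using ys(1) k by (simp add: k_def)
    show "distinct ?xs" using ys(2,6) pq h dis by auto
    show "c \<notin> set ?xs" using ys(6) c h pq dis by auto
    show "E c (hd ?xs)" using pq(1) c by (simp add: common_def)
    show "successively E ?xs" using ys(3,4) pq ne hc E_sym by (cases ys) auto
    show "E (last ?xs) c" using ys(5) ne c E_sym by (auto simp: common_def)
  qed
  have "set ?xs \<inter> ?S = set ys \<inter> ?S" using pq dis by auto
  then have "card (?S - set ?xs) = card ?S - (k - 3)"
    using ys(7) fL by (metis Int_commute card_Diff_subset_Int finite_Diff finite_Int)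
  then have 1: "(\<Sum>i\<in>I. kk i - 1) \<le> card (?S - set ?xs) + (kk i - 1)"
    using cS kap k unfolding kap_def[symmetric] k_def[symmetric] by linarith
  have "set ?xs \<inter> ?Q = set ys \<inter> ?Q" using h dis by auto
  then have "card (?Q - set ?xs) = card ?Q - Suc (k - 3)"
    using ys(8) by (metis Int_commute card_Diff_subset_Int finite_Diff finite_Int finite_common)
  then have 2: "(\<Sum>i\<in>I. kk i) \<le> card (?Q - set ?xs) + kk i"
    using cQ big mmk k unfolding mm_def[symmetric] k_def[symmetric] by linarith
  have "\<exists>xss. fan I kk cyc c xss"
  proof (rule hub_fan_with_branch[where i = i and xs = ?xs and S = ?S and Q = ?Q])
    show "1 \<le> kk i" if "i \<in> I" for i using kk2[OF that] by simp
    show "E s q'" if "s \<in> ?S" "q' \<in> ?Q" for s q' using that by (auto simp: common_def)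
    show "E c q'" if "q' \<in> ?Q" for q' using that c by (auto simp: common_def)
  qed (use fL dis c 1 2 br finI i in auto)
  then show False using no_fan by blast
qed

text \<open>
  Colour each vertex of \<open>N2\<close> by a neighbour in \<open>nb w\<close>. In a dense core, a path of length \<open>2k - 4\<close>
  with ends of different colours closes through \<open>w\<close> to a cycle of length \<open>2k\<close>. Hence two
  neighbours \<open>x1\<close>, \<open>x2\<close> of a vertex \<open>y\<close> have the same colour, namely that of the end of a path that
  starts with \<open>y\<close> and a third neighbour. So all vertices of an alternating path in the core have one
  colour \<open>a\<close>, and such a path closes through \<open>a\<close>.
\<close>

lemma ed_second_neighbourhood_le:
  assumes I: "I = {i}" "cyc i" "3 \<le> kk i"
    and Y: "Y = V - insert w (nb w)" and N2: "N2 = {u\<in>Y. \<exists>a\<in>nb w. E a u}"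
  shows "ed N2 Y \<le> (2 * kk i + 3) * (card Y + card N2)"
proof (rule ccontr)
  assume *: "\<not> ?thesis"
  define k where "k = kk i"
  have k: "3 \<le> k" using I by (simp add: k_def)
  have no_branch: "\<not> branch c True k xs" for c xs
    using no_fan[of c "\<lambda>_. xs"] I by (simp add: fan_def k_def)
  have fin: "finite Y" "finite N2" using finV by (auto simp: Y N2)
  have "(2 * k + 3) * card Y + (2 * k + 3) * card N2 < ed N2 Y"
    using * by (simp add: k_def algebra_simps)
  from ed_core[OF fin(2,1) this] obtain X Z where XZ: "X \<subseteq> N2" "Z \<subseteq> Y" "X \<noteq> {}" "Z \<noteq> {}"
     "\<And>b. b \<in> Z \<Longrightarrow> 2 * k + 3 < card (nb b \<inter> X)" "\<And>a. a \<in> X \<Longrightarrow> 2 * k + 3 < card (nb a \<inter> Z)" by blast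
  have finXZ: "finite X" "finite Z" using XZ fin finite_subset by blast+
  have "\<forall>u\<in>N2. \<exists>a. a \<in> nb w \<and> E a u" by (auto simp: N2)
  then obtain \<phi> where \<phi>: "\<And>u. u \<in> N2 \<Longrightarrow> \<phi> u \<in> nb w \<and> E (\<phi> u) u" by metis
  have XY: "X \<subseteq> Y" using XZ(1) by (auto simp: N2)
  have nY: "w \<notin> Y" "nb w \<inter> Y = {}" by (auto simp: Y)
  \<comment> \<open>The origin of \<open>2 * k + 3\<close>: a degree \<open>2 * k\<close> for the
    alternating path, plus the three vertices \<open>x1\<close>, \<open>x2\<close>, \<open>y\<close>
    that it has to avoid.\<close>
  have large: "card (D - {x1, x2, y}) \<ge> 2 * k" if "2 * k + 3 < card D" for D :: "'a set" and x1 x2 y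
  proof -
    have "card {x1, x2, y} \<le> 3" by (simp add: card_insert_if)
    then show ?thesis using diff_card_le_card_Diff[of "{x1, x2, y}" D] that by simp
  qed
  have same: "\<phi> x1 = \<phi> x2" if y: "y \<in> Z" and x: "x1 \<in> X" "x2 \<in> X" "E x1 y" "E y x2" "x1 \<noteq> x2" for x1 x2 y
  proof -
    have "card (nb y \<inter> X - {x1, x2, y}) \<ge> 2 * k" using large XZ(5)[OF y] by blast
    then have "nb y \<inter> X - {x1, x2, y} \<noteq> {}" using k by (metis card.empty le_zero_eq mult_is_0 not_numeral_le_zero zero_neq_numeral)
    then obtain x3 where x3: "x3 \<in> nb y" "x3 \<in> X - {x1, x2, y}" by blast
    \<comment> \<open>The path ends in \<open>x3\<close>. Appending \<open>y\<close> and
      \<open>x1\<close> or \<open>x2\<close> gives 2k - 3 vertices, and the colours of the two ends,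
      if different, complete a branch of 2k - 1 vertices at \<open>w\<close>.\<close>
    have "\<exists>zs. length zs = 2 * (k - 2) - 1 \<and> distinct zs \<and> successively E zs \<and> hd zs \<in> X \<and> last zs = x3 \<and>
      set zs \<subseteq> (X \<union> Z) - {x1, x2, y} \<and> True"
    proof (rule alternating_path[where Q = "\<lambda>_. True"])
      show "2 * (k - 2) \<le> card (nb a \<inter> Z - {x1, x2, y})" if "a \<in> X" for a
        using large[OF XZ(6)[OF that], of x1 x2 y] by linarith
      show "X \<inter> Z = {} \<and> (\<forall>b\<in>Z. k - 2 \<le> card (nb b \<inter> X - {x1, x2, y})) \<or>
          (\<forall>b\<in>Z. 2 * (k - 2) \<le> card (nb b \<inter> X - {x1, x2, y}))"
        using large[OF XZ(5), of _ x1 x2 y] by fastforce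
    qed (use x3 k finXZ in auto)
    then obtain zs where zs: "length zs = 2 * (k - 2) - 1" "distinct zs" "successively E zs" "hd zs \<in> X"
      "last zs = x3" "set zs \<subseteq> (X \<union> Z) - {x1, x2, y}" by blast
    have ne: "zs \<noteq> []" using zs(1) k by auto
    have zsY: "set zs \<subseteq> Y" using zs(6) XY XZ(2) by blast
    have "\<phi> x = \<phi> (hd zs)" if x': "x \<in> {x1, x2}" for x
    proof (rule ccontr)
      assume neq: "\<phi> x \<noteq> \<phi> (hd zs)"
      have xX: "x \<in> X" and Eyx: "E y x" using x x' E_sym by auto
      have \<phi>x: "\<phi> x \<in> nb w" "E (\<phi> x) x" "\<phi> (hd zs) \<in> nb w" "E (\<phi> (hd zs)) (hd zs)"
        using \<phi> xX zs(4) XZ(1) by blast+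
      have yY: "y \<in> Y" and xY: "x \<in> Y" using y xX XY XZ(2) by auto
      have xy: "x \<noteq> y" using Eyx E_irrefl by auto
      have x3y: "E x3 y" using x3 E_sym by (auto simp: nb_def)
      have suc: "successively E (zs @ [y, x, \<phi> x])"
        using zs(3,5) ne x3y Eyx \<phi>x(2) E_sym by (auto simp: successively_append_iff)
      let ?xs = "\<phi> (hd zs) # zs @ [y, x, \<phi> x]"
      have "branch w True k ?xs"
        unfolding branch_def
      proof (intro conjI impI)
        show "length ?xs = 2 * k - 1" using zs(1) k by simp
        have "\<phi> x \<notin> Y" "\<phi> (hd zs) \<notin> Y" using \<phi>x nY by auto
        moreover have "y \<notin> set zs" "x \<notin> set zs" using zs(6) x' by auto
        ultimately show "distinct ?xs" using zs(2) neq xy zsY yY xY by auto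
        show "w \<notin> set ?xs" using zsY nY yY xY \<phi>x nb_irrefl[of w] by (auto simp del: nb_irrefl)
        show "E w (hd ?xs)" using \<phi>x by (simp add: nb_def)
        show "successively E ?xs" using suc ne \<phi>x(4) by (cases zs) auto
        show "E (last ?xs) w" using \<phi>x E_sym by (simp add: nb_def)
      qed
      then show False using no_branch by blast
    qed
    then show ?thesis by simp
  qed
  obtain a0 where a0: "a0 \<in> X" using XZ by auto
  have "\<exists>zs. length zs = 2 * k - 1 \<and> distinct zs \<and> successively E zs \<and> hd zs \<in> X \<and> last zs = a0 \<and>
      set zs \<subseteq> (X \<union> Z) - {} \<and> \<phi> (hd zs) = \<phi> a0"
  proof (rule alternating_path[where Q = "\<lambda>u. \<phi> u = \<phi> a0"])
    show "2 * k \<le> card (nb a \<inter> Z - {})" if "a \<in> X" for a using XZ(6)[OF that] by simp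
    show "X \<inter> Z = {} \<and> (\<forall>b\<in>Z. k \<le> card (nb b \<inter> X - {})) \<or> (\<forall>b\<in>Z. 2 * k \<le> card (nb b \<inter> X - {}))"
      using XZ(5) by fastforce
    show "\<phi> a' = \<phi> a0" if "a \<in> X" "b \<in> Z" "a' \<in> X" "E a b" "E b a'" "a \<noteq> a'" "\<phi> a = \<phi> a0" for a b a'
      using same[of b a a'] that by simp
  qed (use a0 k finXZ in auto)
  then obtain zs where zs: "length zs = 2 * k - 1" "distinct zs" "successively E zs" "hd zs \<in> X" "last zs = a0"
      "set zs \<subseteq> X \<union> Z" "\<phi> (hd zs) = \<phi> a0" by auto
  have "branch (\<phi> a0) True k zs"
    unfolding branch_def
  proof (intro conjI impI)
    have "\<phi> a0 \<notin> Y" using \<phi>[of a0] a0 XZ(1) nY by auto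
    then show "\<phi> a0 \<notin> set zs" using zs(6) XY XZ(2) by blast
    show "E (\<phi> a0) (hd zs)" using \<phi>[of "hd zs"] zs XZ(1) by auto
    show "E (last zs) (\<phi> a0)" using \<phi>[of a0] zs a0 XZ(1) E_sym by auto
  qed (use zs in auto)
  then show False using no_branch by blast
qed

end

section \<open>Embeddings, spectral radius and the extremal graph\<close>

lemma digraph_iso_image:
  fixes F :: "'a pair_pre_digraph" and f :: "'a \<Rightarrow> 'b"
  assumes "pair_graph F" "inj_on f (pverts F)"
  shows "digraph_iso (with_proj F) (with_proj \<lparr>pverts = f ` pverts F, parcs = map_prod f f ` parcs F\<rparr>)"
proof -
  interpret pair_graph F by fact
  have sub: "parcs F \<subseteq> pverts F \<times> pverts F" using in_arcsD1 in_arcsD2 by auto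
  have "inj_on (map_prod f f) (parcs F)"
    using map_prod_inj_on[OF assms(2,2)] sub inj_on_subset by blast
  then have "digraph_isomorphism \<lparr>iso_verts = f, iso_arcs = map_prod f f, iso_head = snd, iso_tail = fst\<rparr>"
    using assms(2) wf_digraph_axioms by (auto simp: digraph_isomorphism_def)
  moreover have "with_proj \<lparr>pverts = f ` pverts F, parcs = map_prod f f ` parcs F\<rparr>
     = app_iso \<lparr>iso_verts = f, iso_arcs = map_prod f f, iso_head = snd, iso_tail = fst\<rparr> (with_proj F)"
    by (simp add: app_iso_def with_proj_def)
  ultimately show ?thesis unfolding digraph_iso_def by blast
qed

lemma contains_subgraph_of_inj:
  assumes G: "pair_graph G" and F: "pair_graph F" and inj: "inj_on f (pverts F)"
    and verts: "f ` pverts F \<subseteq> pverts G" and arcs: "\<And>u v. (u, v) \<in> parcs F \<Longrightarrow> (f u, f v) \<in> parcs G"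
  shows "contains_subgraph G F"
proof -
  interpret G: pair_graph G by fact
  interpret F: pair_graph F by fact
  let ?H = "\<lparr>pverts = f ` pverts F, parcs = map_prod f f ` parcs F\<rparr>"
  have "digraph_iso (with_proj ?H) (with_proj F)"
    by (rule digraph_iso_swap[OF F.wf_digraph_axioms digraph_iso_image[OF F inj]])
  moreover have "subgraph (with_proj ?H) (with_proj G)"
    unfolding subgraph_def compatible_def
  proof (intro conjI)
    show "wf_digraph (with_proj ?H)"
      by unfold_locales (use F.in_arcsD1 F.in_arcsD2 in \<open>auto\<close>)
    show "wf_digraph (with_proj G)" by (rule G.wf_digraph_axioms)
  qed (use verts arcs in auto)
  ultimately show ?thesis unfolding contains_subgraph_def by blast
qed

lemma fin_graph_of_pair_graph:
  assumes "pair_graph G"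
  shows "fin_graph (pverts G) (\<lambda>u v. (u, v) \<in> parcs G)"
proof -
  interpret pair_graph G by fact
  have "sym (parcs G)" using sym_arcs by (simp add: symmetric_def)
  show ?thesis
  proof
    show "(v, u) \<in> parcs G" if "(u, v) \<in> parcs G" for u v
      using that \<open>sym (parcs G)\<close> by (auto dest: symD)
    show "(v, v) \<notin> parcs G" for v using no_loops[of "(v, v)"] by auto
    show "u \<in> pverts G" if "(u, v) \<in> parcs G" for u v using in_arcsD1 that by auto
  qed simp
qed

text \<open>Cycles and paths are numbered jointly, cycles being the indices below
  \<open>length ks\<close>. \<open>g i j\<close> is the image of position \<open>j\<close> of branch
  \<open>i\<close>, with the shift \<open>j - 1\<close> because the lists omit the centre;
  \<open>pos\<close> names the vertices of \<open>CP_graph\<close> by the same pairs.\<close>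

lemma contains_CP_of_fan:
  assumes G: "pair_graph G" and ks: "\<forall>k\<in>set ks. k \<ge> 2" and ps: "\<forall>p\<in>set ps. p \<ge> 2"
    and fan: "fin_graph.fan (\<lambda>u v. (u, v) \<in> parcs G) {..<length ks + length ps} (nth (ks @ ps))
       (\<lambda>i. i < length ks) c xss"
    and ne: "0 < length ks + length ps"
  shows "contains_subgraph G (CP_graph ks ps)"
proof -
  define E where "E = (\<lambda>u v. (u, v) \<in> parcs G)"
  interpret fin_graph "pverts G" E unfolding E_def by (rule fin_graph_of_pair_graph[OF G])
  let ?t = "length ks + length ps"
  define kk where "kk = nth (ks @ ps)"
  have kk: "2 \<le> kk i" if "i < ?t" for i
    unfolding kk_def using nth_mem[of i "ks @ ps"] that ks ps by auto
  have kks: "i < length ks \<Longrightarrow> kk i = ks ! i" "kk (length ks + i) = ps ! i" for i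
    by (auto simp: kk_def nth_append)
  have fan': "fan {..<?t} kk (\<lambda>i. i < length ks) c xss" using fan by (simp only: kk_def E_def)
  have br: "branch c (i < length ks) (kk i) (xss i)" if "i < ?t" for i
    using fan' that unfolding fan_def by auto
  have dis: "set (xss i) \<inter> set (xss j) = {}" if "i < ?t" "j < ?t" "i \<noteq> j" for i j
    using fan' that unfolding fan_def by auto
  have len: "length (xss i) = 2 * kk i - 1" "distinct (xss i)" "c \<notin> set (xss i)" if "i < ?t" for i
    using br[OF that] by (auto simp: branch_def)
  have nonempty: "xss i \<noteq> []" if "i < ?t" for i using len(1)[OF that] kk[OF that] by auto
  define f where "f v = (case v of Centre \<Rightarrow> c | Cycle_Vertex i j \<Rightarrow> xss i ! (j - 1)
      | Path_Vertex i j \<Rightarrow> xss (length ks + i) ! (j - 1))" for v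
  define g where "g i j = (if j = 0 then c else xss i ! (j - 1))" for i j
  have fc: "f (cycle_pos i j) = g i j" for i j by (simp add: f_def g_def cycle_pos_def)
  have fp: "f (path_pos i j) = g (length ks + i) j" for i j by (simp add: f_def g_def path_pos_def)
  define pos where "pos = (\<lambda>(i, j). if i < length ks then cycle_pos i j else path_pos (i - length ks) j)"
  have verts: "pverts (CP_graph ks ps) = pos ` (SIGMA i:{..<?t}. {..<2 * kk i})"
  proof -
    have "pverts (CP_graph ks ps) \<subseteq> pos ` (SIGMA i:{..<?t}. {..<2 * kk i})"
    proof
      fix v assume "v \<in> pverts (CP_graph ks ps)"
      then consider "v = Centre" | i j where "v = cycle_pos i j" "i < length ks" "j < 2 * ks ! i"
        | i j where "v = path_pos i j" "i < length ps" "j < 2 * ps ! i"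
        by (auto simp: CP_graph_def)
      then show "v \<in> pos ` (SIGMA i:{..<?t}. {..<2 * kk i})"
      proof cases
        case 1
        \<comment> \<open>The centre is position 0 of every branch, so at least one branch must
          exist for it to be covered.\<close>
        then have "v = pos (0, 0)" by (simp add: pos_def cycle_pos_def path_pos_def)
        moreover have "(0, 0) \<in> (SIGMA i:{..<?t}. {..<2 * kk i})" using ne kk[of 0] by auto
        ultimately show ?thesis by blast
      next
        case 2
        then have "v = pos (i, j)" by (simp add: pos_def)
        moreover have "(i, j) \<in> (SIGMA i:{..<?t}. {..<2 * kk i})" using 2 kks by auto
        ultimately show ?thesis by blast
      next
        case 3
        then have "v = pos (length ks + i, j)" by (simp add: pos_def)
        moreover have "(length ks + i, j) \<in> (SIGMA i:{..<?t}. {..<2 * kk i})" using 3 kks by auto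
        ultimately show ?thesis by blast
      qed
    qed
    moreover have "pos (i, j) \<in> pverts (CP_graph ks ps)" if "i < ?t" "j < 2 * kk i" for i j
    proof (cases "i < length ks")
      case True
      then show ?thesis using that kks by (auto simp: pos_def CP_graph_def)
    next
      case False
      then have "ps ! (i - length ks) = kk i" using kks(2)[of "i - length ks"] by simp
      then have "path_pos (i - length ks) j \<in> {path_pos i j | i j. i < length ps \<and> j < 2 * ps ! i}"
        using that False by (intro CollectI exI[of _ "i - length ks"] exI[of _ j]) auto
      then show ?thesis using False by (simp add: pos_def CP_graph_def)
    qed
    ultimately show ?thesis by auto
  qed
  have fpos: "f (pos (i, j)) = g i j" for i j by (simp add: pos_def fc fp)
  have g_mem: "g i j \<in> set (xss i)" if "i < ?t" "0 < j" "j < 2 * kk i" for i j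
    using that len(1)[of i] by (auto simp: g_def)
  have g_inj: "pos (i, j) = pos (i', j')"
    if "i < ?t" "j < 2 * kk i" "i' < ?t" "j' < 2 * kk i'" "g i j = g i' j'" for i j i' j'
  proof (cases "j = 0 \<or> j' = 0")
    case True
    have "j = 0 \<and> j' = 0"
    proof (rule ccontr)
      assume "\<not> (j = 0 \<and> j' = 0)"
      then show False using True that g_mem[of i j] g_mem[of i' j'] len(3)[of i] len(3)[of i'] by (auto simp: g_def)
    qed
    then show ?thesis by (simp add: pos_def cycle_pos_def path_pos_def)
  next
    case False
    then have "g i j \<in> set (xss i)" "g i j \<in> set (xss i')" using g_mem[of i j] g_mem[of i' j'] that by auto
    then have "i = i'" using dis[of i i'] that by blast
    moreover
    have "j - 1 = j' - 1"
      using that False len(1,2)[of i] \<open>i = i'\<close> by (auto simp: g_def nth_eq_iff_index_eq)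
    then have "j = j'" using False by linarith
    ultimately show ?thesis by simp
  qed
  have step: "E (g i j) (g i (Suc j))" if "i < ?t" "Suc j < 2 * kk i" for i j
  proof (cases "j = 0")
    case True
    then show ?thesis using br[OF that(1)] nonempty[OF that(1)] by (simp add: g_def branch_def hd_conv_nth)
  next
    case False
    then have "Suc (j - 1) < length (xss i)" using that len(1)[of i] by auto
    then show ?thesis using br[OF that(1)] False successively_nth[of E "xss i" "j - 1"] by (simp add: g_def branch_def)
  qed
  have close: "E (g i (2 * kk i - 1)) c" if "i < length ks" for i
  proof -
    have i: "i < ?t" using that by simp
    have "last (xss i) = g i (2 * kk i - 1)"
      using nonempty[OF i] len(1)[OF i] kk[OF i] by (simp add: g_def last_conv_nth)
    then show ?thesis using br[OF i] that by (simp add: branch_def)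
  qed
  have arc: "E (f u) (f v)" if uv: "(u, v) \<in> CP_oriented_arcs ks ps" for u v
  proof -
    consider i j where "i < length ks" "j < 2 * ks ! i" "u = cycle_pos i j"
        "v = cycle_pos i (Suc j mod (2 * ks ! i))"
      | i j where "i < length ps" "Suc j < 2 * ps ! i" "u = path_pos i j" "v = path_pos i (Suc j)"
      using uv unfolding CP_oriented_arcs_def by blast
    then show ?thesis
    proof cases
      case 1
      show ?thesis
      proof (cases "Suc j = 2 * ks ! i")
        case True
        then have "v = cycle_pos i 0" using 1 by simp
        moreover have "j = 2 * kk i - 1" using True 1 kks by simp
        ultimately show ?thesis using close[OF 1(1)] 1 by (simp add: fc) (simp add: g_def)
      next
        case False
        then have "Suc j < 2 * ks ! i" using 1 by simp
        then show ?thesis using step[of i j] 1 kks by (simp add: fc)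
      qed
    next
      case 2
      then show ?thesis using step[of "length ks + i" j] kks by (simp add: fp)
    qed
  qed
  show ?thesis
  proof (rule contains_subgraph_of_inj[OF G pair_graph_CP_graph[OF ks ps]])
    show "inj_on f (pverts (CP_graph ks ps))"
      unfolding verts by (rule inj_onI) (auto simp: fpos intro: g_inj)
    show "(f u, f v) \<in> parcs G" if "(u, v) \<in> parcs (CP_graph ks ps)" for u v
      using that arc E_sym by (auto simp: CP_graph_def E_def)
    show "f ` pverts (CP_graph ks ps) \<subseteq> pverts G"
    proof -
      have "g i j \<in> pverts G" if "i < ?t" "j < 2 * kk i" for i j
      proof (cases j)
        case 0
        then show ?thesis using step[of i 0] that kk[of i] E_V by fastforce
      next
        case (Suc j')
        then show ?thesis using step[of i j'] that E_V E_sym by fastforce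
      qed
      then show ?thesis unfolding verts by (auto simp: fpos)
    qed
  qed
qed

section \<open>Subinvariant vectors and Rayleigh's inequality\<close>

lemma adjacency_sum:
  fixes h :: "'a \<Rightarrow> 'b :: comm_semiring_1"
  assumes "pair_graph G" "distinct vs" "set vs = pverts G" "i < length vs"
  shows "(\<Sum>j\<in>{0..<length vs}. (if (vs ! i, vs ! j) \<in> parcs G then 1 else 0) * h (vs ! j))
    = (\<Sum>u\<in>{u. (vs ! i, u) \<in> parcs G}. h u)"
proof -
  interpret pair_graph G by fact
  have bij: "bij_betw (nth vs) {0..<length vs} (pverts G)"
    using bij_betw_nth[OF assms(2) _ assms(3)[symmetric]] by (simp add: lessThan_atLeast0)
  have "(\<Sum>j\<in>{0..<length vs}. (if (vs ! i, vs ! j) \<in> parcs G then 1 else 0) * h (vs ! j))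
    = (\<Sum>u\<in>pverts G. (if (vs ! i, u) \<in> parcs G then 1 else 0) * h u)"
    by (rule sum.reindex_bij_betw[OF bij])
  also have "\<dots> = (\<Sum>u\<in>pverts G. if (vs ! i, u) \<in> parcs G then h u else 0)"
    by (rule sum.cong) auto
  also have "\<dots> = (\<Sum>u\<in>{u\<in>pverts G. (vs ! i, u) \<in> parcs G}. h u)"
    by (rule sum.inter_filter[symmetric]) simp
  also have "{u\<in>pverts G. (vs ! i, u) \<in> parcs G} = {u. (vs ! i, u) \<in> parcs G}"
    using in_arcsD2 by auto
  finally show ?thesis .
qed

text \<open>For an eigenvalue of largest modulus, the triangle inequality turns each row of the
  eigenvector equation into an inequality between moduli; dividing by the largest modulus produces
  the vertex of weight 1.\<close>

lemma spectral_radius_subinvariant: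
  assumes G: "pair_graph G" and ne: "pverts G \<noteq> {}"
  shows "\<exists>x :: 'a \<Rightarrow> real. (\<forall>v\<in>pverts G. 0 \<le> x v \<and> x v \<le> 1) \<and> (\<exists>z\<in>pverts G. x z = 1) \<and>
     (\<forall>v\<in>pverts G. adj_spectral_radius G * x v \<le> (\<Sum>u\<in>{u. (v, u) \<in> parcs G}. x u))"
proof -
  interpret pair_graph G by fact
  obtain vs where vs: "distinct vs" "set vs = pverts G"
    using finite_distinct_list[of "pverts G"] by auto
  define n where "n = length vs"
  have n0: "n > 0" using vs ne by (auto simp: n_def)
  let ?A = "adjacency_matrix G vs"
  have A: "?A \<in> carrier_mat n n" by (simp add: adjacency_matrix_def n_def)
  have rad: "adj_spectral_radius G = spectral_radius ?A" by (rule adj_spectral_radius_eq[OF vs])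
  obtain \<theta> where \<theta>: "eigenvalue ?A \<theta>" "adj_spectral_radius G = norm \<theta>"
    using spectral_radius_mem_max(1)[OF A n0] rad by (auto simp: spectrum_def)
  then obtain w where w: "w \<in> carrier_vec n" "w \<noteq> 0\<^sub>v n" "?A *\<^sub>v w = \<theta> \<cdot>\<^sub>v w"
    by (auto simp: eigenvalue_def eigenvector_def adjacency_matrix_def n_def)
  have bij: "bij_betw (nth vs) {..<n} (pverts G)"
    using bij_betw_nth[OF vs(1) _ vs(2)[symmetric]] by (simp add: n_def)
  define idx where "idx = the_inv_into {..<n} (nth vs)"
  have idx: "idx (vs ! i) = i" if "i < n" for i
    unfolding idx_def using the_inv_into_f_f[OF bij_betw_imp_inj_on[OF bij]] that by simp
  have idx': "idx v < n \<and> vs ! idx v = v" if "v \<in> pverts G" for v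
  proof -
    have "v \<in> nth vs ` {..<n}" using bij that by (simp add: bij_betw_def)
    then show ?thesis using idx by auto
  qed
  define y where "y v = norm (w $ idx v)" for v
  have row: "norm \<theta> * y v \<le> (\<Sum>u\<in>{u. (v, u) \<in> parcs G}. y u)" if "v \<in> pverts G" for v
  proof -
    define i where "i = idx v"
    have i: "i < n" "vs ! i = v" using idx'[OF that] by (auto simp: i_def)
    have "(\<Sum>j\<in>{0..<n}. (if (vs ! i, vs ! j) \<in> parcs G then 1 else 0) * w $ j) = \<theta> * w $ i"
      using arg_cong[OF w(3), of "\<lambda>w. w $ i"] i w(1)
      by (simp add: adjacency_matrix_def n_def scalar_prod_def)
    moreover have "(\<Sum>j\<in>{0..<n}. (if (vs ! i, vs ! j) \<in> parcs G then 1 else 0) * w $ j)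
        = (\<Sum>j\<in>{0..<n}. (if (vs ! i, vs ! j) \<in> parcs G then 1 else 0) * (\<lambda>u. w $ idx u) (vs ! j))"
      by (rule sum.cong) (auto simp: idx)
    ultimately have "(\<Sum>u\<in>{u. (v, u) \<in> parcs G}. w $ idx u) = \<theta> * w $ i"
      using adjacency_sum[OF G vs, of i "\<lambda>u. w $ idx u"] i by (simp add: n_def)
    then have "norm \<theta> * y v = norm (\<Sum>u\<in>{u. (v, u) \<in> parcs G}. w $ idx u)"
      by (simp add: y_def norm_mult i_def)
    also have "\<dots> \<le> (\<Sum>u\<in>{u. (v, u) \<in> parcs G}. y u)"
      unfolding y_def by (rule norm_sum)
    finally show ?thesis .
  qed
  define m where "m = Max (y ` pverts G)"
  have "m \<in> y ` pverts G" unfolding m_def by (rule Max_in) (use ne in auto)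
  then obtain z where z: "z \<in> pverts G" "y z = m" by auto
  have ym: "y v \<le> m" if "v \<in> pverts G" for v unfolding m_def by (rule Max_ge) (use that in auto)
  have "\<exists>i<n. w $ i \<noteq> 0"
  proof (rule ccontr)
    assume "\<not> ?thesis"
    then have "w = 0\<^sub>v n" using w(1) by (intro eq_vecI) auto
    then show False using w(2) by simp
  qed
  then obtain i where i: "i < n" "w $ i \<noteq> 0" by auto
  have "vs ! i \<in> pverts G" using nth_mem[of i vs] i(1) vs(2) by (simp add: n_def)
  then have "norm (w $ i) \<le> m" using ym[of "vs ! i"] idx[OF i(1)] by (simp add: y_def)
  moreover have "0 < norm (w $ i)" using i(2) by simp
  ultimately have "0 < m" by linarith
  show ?thesis
  proof (intro exI[of _ "\<lambda>v. y v / m"] conjI ballI)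
    fix v assume v: "v \<in> pverts G"
    show "0 \<le> y v / m" "y v / m \<le> 1" using ym[OF v] \<open>0 < m\<close> by (auto simp: y_def)
    show "adj_spectral_radius G * (y v / m) \<le> (\<Sum>u\<in>{u. (v, u) \<in> parcs G}. y u / m)"
      using row[OF v] \<open>0 < m\<close> \<theta>(2) by (simp add: sum_divide_distrib[symmetric] divide_right_mono)
  qed (use z \<open>0 < m\<close> in auto)
qed

text \<open>Applied to the explicit eigenvector of the extremal graph, to bound its spectral radius
  from below.\<close>

lemma eigenvector_le_spectral_radius:
  fixes y :: "'a \<Rightarrow> real"
  assumes G: "pair_graph G" and z: "z \<in> pverts G" "y z \<noteq> 0"
    and ev: "\<And>v. v \<in> pverts G \<Longrightarrow> (\<Sum>u\<in>{u. (v, u) \<in> parcs G}. y u) = \<mu> * y v"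
  shows "\<mu> \<le> adj_spectral_radius G"
proof -
  interpret pair_graph G by fact
  obtain vs where vs: "distinct vs" "set vs = pverts G"
    using finite_distinct_list[of "pverts G"] by auto
  define n where "n = length vs"
  have n0: "n > 0" using vs z by (auto simp: n_def)
  let ?A = "adjacency_matrix G vs"
  have A: "?A \<in> carrier_mat n n" by (simp add: adjacency_matrix_def n_def)
  have rad: "adj_spectral_radius G = spectral_radius ?A" by (rule adj_spectral_radius_eq[OF vs])
  define w where "w = vec n (\<lambda>i. complex_of_real (y (vs ! i)))"
  have "w \<noteq> 0\<^sub>v n"
  proof
    assume w0: "w = 0\<^sub>v n"
    obtain i where "i < n" "vs ! i = z" using z vs by (metis in_set_conv_nth n_def)
    then show False using arg_cong[OF w0, of "\<lambda>u. u $ i"] z by (simp add: w_def)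
  qed
  moreover have "?A *\<^sub>v w = complex_of_real \<mu> \<cdot>\<^sub>v w"
  proof (rule eq_vecI)
    fix i assume "i < dim_vec (complex_of_real \<mu> \<cdot>\<^sub>v w)"
    then have i: "i < n" by (simp add: w_def)
    have "(?A *\<^sub>v w) $ i = (\<Sum>j\<in>{0..<n}. (if (vs ! i, vs ! j) \<in> parcs G then 1 else 0) * complex_of_real (y (vs ! j)))"
      using i by (simp add: adjacency_matrix_def scalar_prod_def w_def n_def)
    also have "\<dots> = (\<Sum>u\<in>{u. (vs ! i, u) \<in> parcs G}. complex_of_real (y u))"
      unfolding n_def by (rule adjacency_sum[OF G vs]) (use i in \<open>simp add: n_def\<close>)
    also have "\<dots> = complex_of_real (\<mu> * y (vs ! i))"
      using ev[of "vs ! i"] vs i nth_mem[of i vs] by (simp add: n_def flip: of_real_sum)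
    finally show "(?A *\<^sub>v w) $ i = (complex_of_real \<mu> \<cdot>\<^sub>v w) $ i" using i by (simp add: w_def)
  qed (simp add: adjacency_matrix_def w_def n_def)
  ultimately have "eigenvalue ?A (complex_of_real \<mu>)"
    unfolding eigenvalue_def eigenvector_def
    by (intro exI[of _ w]) (simp add: adjacency_matrix_def w_def n_def)
  then have "norm (complex_of_real \<mu>) \<le> spectral_radius ?A"
    by (intro spectral_radius_mem_max(2)[OF A n0] imageI) (simp add: spectrum_def)
  then show ?thesis using rad by simp
qed

text \<open>The ground state substitution: at each \<open>v\<close>, \<mu> is written as the sum of
  \<open>y u / y v\<close> over the neighbours \<open>u\<close>. Symmetrising in \<open>v\<close>
  and \<open>u\<close> then completes a square for every edge, and is the source of the factor
  1/2.\<close>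

lemma rayleigh_defect:
  fixes x y :: "'a \<Rightarrow> real"
  assumes "finite V" and E_sym: "\<And>u v. E u v \<Longrightarrow> E v u" and pos: "\<And>v. v \<in> V \<Longrightarrow> 0 < y v"
    and ev: "\<And>v. v \<in> V \<Longrightarrow> (\<Sum>u\<in>V. if E v u then y u else 0) = \<mu> * y v"
  shows "\<mu> * (\<Sum>v\<in>V. (x v)\<^sup>2) - (\<Sum>v\<in>V. \<Sum>u\<in>V. if E v u then x v * x u else 0)
    = (\<Sum>v\<in>V. \<Sum>u\<in>V. if E v u then (x v * y u - x u * y v)\<^sup>2 / (y v * y u) else 0) / 2"
proof -
  define T where "T = (\<Sum>v\<in>V. \<Sum>u\<in>V. if E v u then (x v)\<^sup>2 * y u / y v else 0)"
  have 1: "\<mu> * (\<Sum>v\<in>V. (x v)\<^sup>2) = T"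
    unfolding T_def sum_distrib_left
  proof (rule sum.cong[OF refl])
    fix v assume v: "v \<in> V"
    have "(\<Sum>u\<in>V. if E v u then (x v)\<^sup>2 * y u / y v else 0) = (x v)\<^sup>2 / y v * (\<Sum>u\<in>V. if E v u then y u else 0)"
      unfolding sum_distrib_left by (rule sum.cong) auto
    then show "\<mu> * (x v)\<^sup>2 = (\<Sum>u\<in>V. if E v u then (x v)\<^sup>2 * y u / y v else 0)"
      using ev[OF v] pos[OF v] by simp
  qed
  have 2: "T = (\<Sum>v\<in>V. \<Sum>u\<in>V. if E v u then (x u)\<^sup>2 * y v / y u else 0)"
    unfolding T_def by (subst sum.swap) (intro sum.cong refl, use E_sym in auto)
  have "(\<Sum>v\<in>V. \<Sum>u\<in>V. if E v u then (x v * y u - x u * y v)\<^sup>2 / (y v * y u) else 0)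
    = (\<Sum>v\<in>V. \<Sum>u\<in>V. (if E v u then (x v)\<^sup>2 * y u / y v else 0) + (if E v u then (x u)\<^sup>2 * y v / y u else 0)
         - 2 * (if E v u then x v * x u else 0))"
  proof (intro sum.cong refl)
    fix v u assume "v \<in> V" "u \<in> V"
    then have "y v \<noteq> 0" "y u \<noteq> 0" using pos by force+
    then show "(if E v u then (x v * y u - x u * y v)\<^sup>2 / (y v * y u) else 0)
       = (if E v u then (x v)\<^sup>2 * y u / y v else 0) + (if E v u then (x u)\<^sup>2 * y v / y u else 0)
         - 2 * (if E v u then x v * x u else 0)"
      by (simp add: field_simps power2_eq_square)
  qed
  also have "\<dots> = T + T - 2 * (\<Sum>v\<in>V. \<Sum>u\<in>V. if E v u then x v * x u else 0)"
    unfolding sum.distrib sum_subtractf sum_distrib_left[symmetric] by (simp only: T_def[symmetric] 2[symmetric])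
  finally show ?thesis using 1 by simp
qed

text \<open>All terms of the defect are nonnegative; if the defect vanishes, each of them does, and
  \<open>x\<close> is proportional to \<open>y\<close> along every edge.\<close>

lemma rayleigh_le:
  fixes x y :: "'a \<Rightarrow> real"
  assumes "finite V" and E_sym: "\<And>u v. E u v \<Longrightarrow> E v u" and pos: "\<And>v. v \<in> V \<Longrightarrow> 0 < y v"
    and ev: "\<And>v. v \<in> V \<Longrightarrow> (\<Sum>u\<in>V. if E v u then y u else 0) = \<mu> * y v"
  shows "(\<Sum>v\<in>V. \<Sum>u\<in>V. if E v u then x v * x u else 0) \<le> \<mu> * (\<Sum>v\<in>V. (x v)\<^sup>2)"
    and "(\<Sum>v\<in>V. \<Sum>u\<in>V. if E v u then x v * x u else 0) = \<mu> * (\<Sum>v\<in>V. (x v)\<^sup>2) \<Longrightarrow>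
      u \<in> V \<Longrightarrow> v \<in> V \<Longrightarrow> E v u \<Longrightarrow> x v * y u = x u * y v"
proof -
  let ?d = "\<lambda>v u. if E v u then (x v * y u - x u * y v)\<^sup>2 / (y v * y u) else 0"
  have nn: "0 \<le> ?d v u" if "v \<in> V" "u \<in> V" for v u using pos[OF that(1)] pos[OF that(2)] by simp
  have nn2: "0 \<le> (\<Sum>u\<in>V. ?d v u)" if "v \<in> V" for v by (rule sum_nonneg) (use nn that in blast)
  have nn3: "0 \<le> (\<Sum>v\<in>V. \<Sum>u\<in>V. ?d v u)" by (rule sum_nonneg) (use nn2 in blast)
  note id = rayleigh_defect[OF assms, of x]
  show "(\<Sum>v\<in>V. \<Sum>u\<in>V. if E v u then x v * x u else 0) \<le> \<mu> * (\<Sum>v\<in>V. (x v)\<^sup>2)"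
    using id nn3 by linarith
  assume eq: "(\<Sum>v\<in>V. \<Sum>u\<in>V. if E v u then x v * x u else 0) = \<mu> * (\<Sum>v\<in>V. (x v)\<^sup>2)"
    and uv: "u \<in> V" "v \<in> V" "E v u"
  have "(\<Sum>v\<in>V. \<Sum>u\<in>V. ?d v u) = 0" using id eq by linarith
  then have "(\<Sum>u\<in>V. ?d v u) = 0" using sum_nonneg_eq_0_iff[OF assms(1), of "\<lambda>v. \<Sum>u\<in>V. ?d v u"] nn2 uv(2) by blast
  then have "?d v u = 0" using sum_nonneg_eq_0_iff[OF assms(1), of "?d v"] nn[OF uv(2)] uv(1) by blast
  then show "x v * y u = x u * y v" using uv pos[OF uv(1)] pos[OF uv(2)] by simp
qed

section \<open>The extremal graph on an arbitrary vertex set and its positive eigenvector\<close>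

definition S_plus_rel :: "'a set \<Rightarrow> 'a set \<Rightarrow> 'a \<Rightarrow> 'a \<Rightarrow> 'a \<Rightarrow> 'a \<Rightarrow> bool" where
  "S_plus_rel V L r s u v \<longleftrightarrow> u \<in> V \<and> v \<in> V \<and> u \<noteq> v \<and> (u \<in> L \<or> v \<in> L \<or> {u, v} = {r, s})"

text \<open>With value 1 on \<open>L\<close>, the eigenvector equation at the other vertices forces
  these values: an ordinary vertex sees only \<open>L\<close>, while \<open>r\<close> and
  \<open>s\<close> also see each other. What remains is the equation at a vertex of
  \<open>L\<close>, which determines \<mu>.\<close>

definition S_plus_vec :: "'a set \<Rightarrow> 'a \<Rightarrow> 'a \<Rightarrow> real \<Rightarrow> 'a \<Rightarrow> real" where
  "S_plus_vec L r s \<mu> v =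
     (if v \<in> L then 1 else if v \<in> {r, s} then real (card L) / (\<mu> - 1) else real (card L) / \<mu>)"

text \<open>The root is found between a = sqrt (k (n - k)) and a crude upper end \<open>b\<close>,
  so the lower bound on \<open>\<mu>\<^sup>2\<close> comes from the interval itself. Since a = (n -
  k) k / a, the value \<open>g a\<close> equals 2 k / a - 2 k / (a - 1) - (k - 1), which is not
  positive. The margin 6 guarantees a \<ge> 2.\<close>

lemma S_plus_eigenvalue:
  fixes n k :: nat
  assumes "1 \<le> k" "k + 6 \<le> n"
  obtains \<mu> :: real where "2 \<le> \<mu>" "real k * (real n - real k) \<le> \<mu>\<^sup>2"
    "\<mu> = (real k - 1) + 2 * (real k / (\<mu> - 1)) + (real n - real k - 2) * (real k / \<mu>)"
proof -
  define a where "a = sqrt (real k * (real n - real k))"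
  define b where "b = real n * real k + 2 * real k + 2"
  define g where "g \<mu> = \<mu> - (real k - 1) - 2 * (real k / (\<mu> - 1)) - (real n - real k - 2) * (real k / \<mu>)" for \<mu>
  have k1: "1 \<le> real k" and nk: "6 \<le> real n - real k" using assms by auto
  have kn: "6 \<le> real k * (real n - real k)" using mult_mono[OF k1 nk] k1 by simp
  have a2: "a\<^sup>2 = real k * (real n - real k)" using kn by (simp add: a_def)
  have a: "2 \<le> a" unfolding a_def by (rule real_le_rsqrt) (use kn in simp)
  have ab: "a \<le> b"
  proof -
    have "real k * real k \<ge> 0" by simp
    then have "a\<^sup>2 \<le> real n * real k" unfolding a2 by (simp add: algebra_simps)
    also have "\<dots> \<le> b" using k1 by (simp add: b_def)
    also have "\<dots> \<le> b\<^sup>2"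
    proof -
      have "1 \<le> b" using k1 by (simp add: b_def)
      then show ?thesis by (simp add: power2_eq_square)
    qed
    finally show ?thesis by (rule power2_le_imp_le) (use k1 in \<open>simp add: b_def\<close>)
  qed
  have ga: "g a \<le> 0"
  proof -
    have "a - (real n - real k - 2) * (real k / a) = 2 * (real k / a)"
      using a a2 by (simp add: field_simps power2_eq_square)
    moreover have "real k / a \<le> real k / (a - 1)" by (rule divide_left_mono) (use a k1 in auto)
    ultimately show ?thesis using k1 by (simp add: g_def)
  qed
  have gb: "0 \<le> g b"
  proof -
    have nk0: "0 \<le> real n * real k" by simp
    have "2 * real k \<le> b - 1" "0 < b - 1" using k1 nk0 unfolding b_def by linarith+
    then have "2 * (real k / (b - 1)) \<le> 1" by (simp add: field_simps)
    moreover have "(real n - real k - 2) * (real k / b) \<le> 1"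
    proof -
      have "(real n - real k - 2) * real k \<le> b"
        using k1 by (simp add: b_def algebra_simps)
      moreover have "0 < b" using k1 nk0 unfolding b_def by linarith
      ultimately show ?thesis by (simp add: field_simps)
    qed
    moreover have "real k + 1 \<le> b" using k1 nk0 unfolding b_def by linarith
    ultimately show ?thesis unfolding g_def by linarith
  qed
  have "continuous_on {a..b} g"
    unfolding g_def by (intro continuous_intros) (use a in auto)
  then obtain \<mu> where \<mu>: "a \<le> \<mu>" "\<mu> \<le> b" "g \<mu> = 0" using IVT'[OF ga gb ab] by auto
  have "a\<^sup>2 \<le> \<mu>\<^sup>2" using \<mu>(1) a by (intro power_mono) auto
  then show ?thesis using that[of \<mu>] \<mu> a a2 by (simp add: g_def)
qed

lemma S_plus_vec_eigen:
  assumes fin: "finite V" and L: "L \<subseteq> V" "1 \<le> card L" and rs: "r \<in> V - L" "s \<in> V - L" "r \<noteq> s"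
    and \<mu>: "2 \<le> \<mu>"
    and root: "\<mu> = (real (card L) - 1) + 2 * (real (card L) / (\<mu> - 1)) +
        (real (card V) - real (card L) - 2) * (real (card L) / \<mu>)"
    and v: "v \<in> V"
  shows "(\<Sum>u\<in>V. if S_plus_rel V L r s v u then S_plus_vec L r s \<mu> u else 0) = \<mu> * S_plus_vec L r s \<mu> v"
proof -
  let ?y = "S_plus_vec L r s \<mu>"
  let ?k = "real (card L)"
  have fL: "finite L" using L fin finite_subset by blast
  have sumL: "sum ?y L = ?k" by (simp add: S_plus_vec_def)
  have filt: "(\<Sum>u\<in>V. if S_plus_rel V L r s v u then ?y u else 0) = sum ?y {u\<in>V. S_plus_rel V L r s v u}"
    by (rule sum.inter_filter[symmetric, OF fin])
  consider "v \<in> L" | "v \<in> {r, s}" | "v \<notin> L" "v \<notin> {r, s}" by blast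
  then show ?thesis
  proof cases
    case 1
    have set: "{u\<in>V. S_plus_rel V L r s v u} = (L - {v}) \<union> ({r, s} \<union> (V - L - {r, s}))"
      using 1 rs L v by (auto simp: S_plus_rel_def)
    have cardR: "real (card (V - L - {r, s})) = real (card V) - ?k - 2"
    proof -
      have sub: "insert r (insert s L) \<subseteq> V" using rs L by auto
      have "V - L - {r, s} = V - insert r (insert s L)" by auto
      then have "card (V - L - {r, s}) = card V - (card L + 2)"
        using sub fL rs by (simp add: card_Diff_subset)
      moreover have "card L + 2 \<le> card V" using card_mono[OF fin sub] fL rs by simp
      ultimately show ?thesis by linarith
    qed
    have "sum ?y {u\<in>V. S_plus_rel V L r s v u} = sum ?y (L - {v}) + (sum ?y {r, s} + sum ?y (V - L - {r, s}))"
    proof -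
      have "sum ?y (L - {v} \<union> ({r, s} \<union> (V - L - {r, s}))) = sum ?y (L - {v}) + sum ?y ({r, s} \<union> (V - L - {r, s}))"
        by (rule sum.union_disjoint) (use fin fL rs in auto)
      also have "sum ?y ({r, s} \<union> (V - L - {r, s})) = sum ?y {r, s} + sum ?y (V - L - {r, s})"
        by (rule sum.union_disjoint) (use fin in auto)
      finally show ?thesis unfolding set .
    qed
    also have "sum ?y (L - {v}) = ?k - 1" 
    proof -
      have "?y v = 1" using 1 by (simp add: S_plus_vec_def)
      then show ?thesis using sum.remove[OF fL 1, of ?y] sumL by linarith
    qed
    also have "sum ?y {r, s} = 2 * (?k / (\<mu> - 1))" using rs by (simp add: S_plus_vec_def)
    also have "sum ?y (V - L - {r, s}) = (\<Sum>u\<in>V - L - {r, s}. ?k / \<mu>)"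
      by (rule sum.cong) (auto simp: S_plus_vec_def)
    also have "\<dots> = (real (card V) - ?k - 2) * (?k / \<mu>)" using cardR by simp
    also have "?k - 1 + (2 * (?k / (\<mu> - 1)) + (real (card V) - ?k - 2) * (?k / \<mu>)) = \<mu>" using root by linarith
    finally show ?thesis using filt 1 by (simp add: S_plus_vec_def)
  next
    case 2
    define r' where "r' = (if v = r then s else r)"
    have r': "r' \<notin> L" "r' \<in> {r, s}" using 2 rs by (auto simp: r'_def)
    have set: "{u\<in>V. S_plus_rel V L r s v u} = insert r' L"
      using 2 rs L v by (auto simp: S_plus_rel_def r'_def doubleton_eq_iff)
    have "sum ?y {u\<in>V. S_plus_rel V L r s v u} = ?k / (\<mu> - 1) + ?k"
      unfolding set using r' fL sumL by (simp add: S_plus_vec_def)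
    also have "\<dots> = \<mu> * (?k / (\<mu> - 1))" using \<mu> by (simp add: field_simps)
    finally show ?thesis using filt 2 rs by (auto simp: S_plus_vec_def)
  next
    case 3
    have set: "{u\<in>V. S_plus_rel V L r s v u} = L"
      using 3 rs L v by (auto simp: S_plus_rel_def doubleton_eq_iff)
    show ?thesis using filt set sumL 3 \<mu> by (simp add: S_plus_vec_def)
  qed
qed

lemma S_plus_graph_radius_ge:
  assumes "1 \<le> k" "k + 6 \<le> n" "2 \<le> \<mu>"
    and "\<mu> = (real k - 1) + 2 * (real k / (\<mu> - 1)) + (real n - real k - 2) * (real k / \<mu>)"
  shows "\<mu> \<le> adj_spectral_radius (S_plus_graph n k)"
proof (rule eigenvector_le_spectral_radius)
  let ?y = "S_plus_vec {..<k} k (k + 1) \<mu>"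
  show "pair_graph (S_plus_graph n k)" by (rule pair_graph_S_plus_graph) (use assms in simp)
  have V: "pverts (S_plus_graph n k) = {..<n}" by (simp add: S_plus_graph_def S_graph_def)
  show "0 \<in> pverts (S_plus_graph n k)" using V assms by simp
  show "?y 0 \<noteq> 0" using assms by (simp add: S_plus_vec_def)
  fix v assume "v \<in> pverts (S_plus_graph n k)"
  then have v: "v < n" using V by simp
  have "{u. (v, u) \<in> parcs (S_plus_graph n k)} = {u\<in>{..<n}. S_plus_rel {..<n} {..<k} k (k + 1) v u}"
    using v assms(2) by (auto simp: S_plus_graph_def S_graph_def S_plus_rel_def doubleton_eq_iff)
  then have "(\<Sum>u\<in>{u. (v, u) \<in> parcs (S_plus_graph n k)}. ?y u)
     = (\<Sum>u\<in>{..<n}. if S_plus_rel {..<n} {..<k} k (k + 1) v u then ?y u else 0)"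
    by (simp only: sum.inter_filter[OF finite_lessThan])
  also have "\<dots> = \<mu> * ?y v"
    by (rule S_plus_vec_eigen) (use assms v in auto)
  finally show "(\<Sum>u\<in>{u. (v, u) \<in> parcs (S_plus_graph n k)}. ?y u) = \<mu> * ?y v" .
qed

lemma iso_S_plus_graph:
  assumes G: "pair_graph G" and V: "card (pverts G) = n" and L: "L \<subseteq> pverts G" "card L = k"
    and rs: "r \<in> pverts G - L" "s \<in> pverts G - L" "r \<noteq> s"
    and arcs: "\<And>u v. (u, v) \<in> parcs G \<longleftrightarrow> S_plus_rel (pverts G) L r s u v"
  shows "digraph_iso (with_proj G) (with_proj (S_plus_graph n k))"
proof -
  interpret pair_graph G by fact
  have fL: "finite L" using L finite_verts finite_subset[of L "pverts G"] by auto
  let ?R = "pverts G - L - {r, s}"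
  have sub: "insert r (insert s L) \<subseteq> pverts G" using rs L by auto
  have "?R = pverts G - insert r (insert s L)" by auto
  then have "card ?R = n - (k + 2)" using sub fL rs V L by (simp add: card_Diff_subset)
  moreover have kn: "k + 2 \<le> n" using card_mono[OF _ sub] fL rs V L by simp
  ultimately obtain h where h: "bij_betw h ?R {k + 2..<n}"
    using finite_same_card_bij[of ?R "{k + 2..<n}"] by auto
  obtain l where l: "bij_betw l L {..<k}"
    using finite_same_card_bij[of L "{..<k}"] fL L by auto
  define f where "f v = (if v \<in> L then l v else if v = r then k else if v = s then k + 1 else h v)" for v
  have fL': "bij_betw f L {..<k}" using l by (rule bij_betw_cong[THEN iffD1, rotated]) (simp add: f_def)
  have fR: "bij_betw f ?R {k + 2..<n}"
    using h by (rule bij_betw_cong[THEN iffD1, rotated]) (simp add: f_def)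
  have frs: "bij_betw f {r, s} {k, k + 1}" using rs by (auto simp: bij_betw_def f_def)
  have "bij_betw f (L \<union> {r, s} \<union> ?R) ({..<k} \<union> {k, k + 1} \<union> {k + 2..<n})"
    by (intro bij_betw_combine fL' fR frs) auto
  moreover have "L \<union> {r, s} \<union> ?R = pverts G" using rs L by auto
  moreover have "{..<k} \<union> {k, k + 1} \<union> {k + 2..<n} = {..<n}" using kn by auto
  ultimately have bij: "bij_betw f (pverts G) {..<n}" by simp
  have inj: "inj_on f (pverts G)" using bij by (simp add: bij_betw_def)
  have lt: "f v < k \<longleftrightarrow> v \<in> L" if vG: "v \<in> pverts G" for v
  proof -
    consider "v \<in> L" | "v \<in> {r, s}" "v \<notin> L" | "v \<in> ?R" "v \<notin> L" using vG rs by auto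
    then show ?thesis
    proof cases
      case 1
      then show ?thesis using bij_betwE[OF fL'] by auto
    next
      case 2
      then show ?thesis using bij_betwE[OF frs] by fastforce
    next
      case 3
      then have "f v \<in> {k + 2..<n}" using bij_betwE[OF fR] by blast
      then show ?thesis using 3(2) by simp
    qed
  qed
  have fr: "f r = k" "f s = k + 1" using rs by (auto simp: f_def)
  have inv: "f u = k \<longleftrightarrow> u = r" "f u = k + 1 \<longleftrightarrow> u = s" if "u \<in> pverts G" for u
    using inj_on_eq_iff[OF inj that, of r] inj_on_eq_iff[OF inj that, of s] fr rs by simp_all
  have pair: "{u, v} = {r, s} \<longleftrightarrow> f u = k \<and> f v = k + 1 \<or> f u = k + 1 \<and> f v = k"
    if "u \<in> pverts G" "v \<in> pverts G" for u v
    unfolding inv[OF that(1)] inv[OF that(2)] doubleton_eq_iff by blast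
  have S: "(f u, f v) \<in> parcs (S_plus_graph n k) \<longleftrightarrow> (u, v) \<in> parcs G"
    if uv: "u \<in> pverts G" "v \<in> pverts G" for u v
  proof -
    have n: "f u < n" "f v < n" using bij uv unfolding bij_betw_def by auto
    have "f u = f v \<longleftrightarrow> u = v" using inj uv by (auto dest: inj_onD)
    moreover have "k \<noteq> k + 1" by simp
    ultimately show ?thesis
      unfolding arcs S_plus_rel_def pair[OF uv] lt[OF uv(1), symmetric] lt[OF uv(2), symmetric]
      using uv n by (auto simp: S_plus_graph_def S_graph_def)
  qed
  have "map_prod f f ` parcs G = parcs (S_plus_graph n k)"
  proof
    show "map_prod f f ` parcs G \<subseteq> parcs (S_plus_graph n k)"
      using S in_arcsD1 in_arcsD2 by auto
    show "parcs (S_plus_graph n k) \<subseteq> map_prod f f ` parcs G"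
    proof
      fix e assume e: "e \<in> parcs (S_plus_graph n k)"
      obtain a b where ab: "e = (a, b)" by (cases e)
      have "a < n" "b < n" using e ab kn by (auto simp: S_plus_graph_def S_graph_def)
      then obtain u v where uv: "u \<in> pverts G" "v \<in> pverts G" "a = f u" "b = f v"
        using bij unfolding bij_betw_def by (metis imageE lessThan_iff)
      then have "(u, v) \<in> parcs G" using S e ab by simp
      then show "e \<in> map_prod f f ` parcs G" using uv ab by force
    qed
  qed
  moreover have "f ` pverts G = pverts (S_plus_graph n k)"
    using bij by (simp add: bij_betw_def S_plus_graph_def S_graph_def)
  ultimately have "S_plus_graph n k = \<lparr>pverts = f ` pverts G, parcs = map_prod f f ` parcs G\<rparr>"
    by simp
  then show ?thesis using digraph_iso_image[OF G inj] by simp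
qed

section \<open>Weights of vertices of small degree\<close>

lemma (in fin_graph) sum_walks:
  fixes x :: "'a \<Rightarrow> real"
  assumes "finite A" "finite H"
  shows "(\<Sum>a\<in>A. \<Sum>u\<in>nb a \<inter> H. x u) = (\<Sum>u\<in>H. real (card (nb u \<inter> A)) * x u)"
proof -
  have 1: "(\<Sum>u\<in>nb a \<inter> H. x u) = (\<Sum>u\<in>H. if E a u then x u else 0)" for a
  proof -
    have "nb a \<inter> H = {u\<in>H. E a u}" by (auto simp: nb_def)
    then show ?thesis by (simp only: sum.inter_filter[OF assms(2)])
  qed
  have 2: "real (card (nb u \<inter> A)) * x u = (\<Sum>a\<in>A. if E a u then x u else 0)" for u
  proof -
    have "nb u \<inter> A = {a\<in>A. E a u}" using E_sym by (auto simp: nb_def)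
    then have "(\<Sum>a\<in>nb u \<inter> A. x u) = (\<Sum>a\<in>A. if E a u then x u else 0)"
      by (simp only: sum.inter_filter[OF assms(1)])
    then show ?thesis by simp
  qed
  show ?thesis unfolding 1 2 by (rule sum.swap)
qed

lemma (in fin_graph) ed_real: "real (ed A B) = (\<Sum>a\<in>A. real (card (nb a \<inter> B)))"
  by (simp add: ed_def)

text \<open>\<open>ed_nb_le\<close> excludes \<open>w\<close> from the target set; the edges back to
  \<open>w\<close> account for the additional 1.\<close>

lemma (in fan_free) ed_nb_V: "ed (nb w) V \<le> (4 * MM + 1) * card V"
proof -
  have "ed (nb w) V \<le> ed (nb w) ((V - {w}) \<union> {w})" by (rule ed_mono) auto
  also have "\<dots> = ed (nb w) (V - {w}) + ed (nb w) {w}" by (rule ed_Un_right) auto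
  also have "ed (nb w) {w} \<le> card (nb w) * card {w}" by (rule ed_le_mult) auto
  also have "ed (nb w) (V - {w}) \<le> 2 * MM * (card (nb w) + card (V - {w}))" by (rule ed_nb_le) auto
  also have "2 * MM * (card (nb w) + card (V - {w})) \<le> 2 * MM * (card V + card V)"
    by (intro mult_le_mono add_mono card_nb_le card_mono order_refl) (use finV in auto)
  finally show ?thesis using card_nb_le[of w] by (simp add: algebra_simps)
qed

lemma (in fan_free) card_diff_common_le:
  assumes "finite S" and "\<And>s. s \<in> S \<Longrightarrow> real (card V) - real (card (nb s)) \<le> d"
  shows "real (card (V - common S)) \<le> real (card S) * d"
proof -
  have "V - common S \<subseteq> (\<Union>s\<in>S. V - nb s)" by (auto simp: common_def nb_def)
  then have "card (V - common S) \<le> card (\<Union>s\<in>S. V - nb s)" by (intro card_mono) (use assms finV in auto)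
  also have "\<dots> \<le> (\<Sum>s\<in>S. card (V - nb s))" by (rule card_UN_le[OF assms(1)])
  finally have "real (card (V - common S)) \<le> (\<Sum>s\<in>S. real (card (V - nb s)))" by (metis of_nat_le_iff of_nat_sum)
  also have "\<dots> \<le> (\<Sum>s\<in>S. d)"
  proof (rule sum_mono)
    fix s assume s: "s \<in> S"
    have "card (V - nb s) = card V - card (nb s)" by (rule card_Diff_subset) (use nb_V in auto)
    then show "real (card (V - nb s)) \<le> d" using assms(2)[OF s] card_nb_le[of s] by simp
  qed
  finally show ?thesis by simp
qed

lemma (in fan_free) card_nb_common_less:
  assumes L: "L \<subseteq> V" "card L = kap" and v: "v \<in> V - L"
  shows "card (nb v \<inter> common L) < mm"
proof -
  have fL: "finite L" using L finV finite_subset by blast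
  have "nb v \<inter> common L = common (insert v L)" by (auto simp: common_def nb_def)
  moreover have "card (common (insert v L)) < mm"
    by (rule card_common_less) (use L v fL in auto)
  ultimately show ?thesis by simp
qed

section \<open>Walks of length two weighted by a subinvariant vector\<close>

locale spectral_fan_free = fan_free V E I kk cyc
  for V :: "'a set" and E and I kk cyc +
  fixes x :: "'a \<Rightarrow> real" and lam :: real and z :: 'a
  assumes x_nonneg: "v \<in> V \<Longrightarrow> 0 \<le> x v" and x_le_1: "v \<in> V \<Longrightarrow> x v \<le> 1"
    and z: "z \<in> V" "x z = 1"
    and subinv: "v \<in> V \<Longrightarrow> lam * x v \<le> (\<Sum>u\<in>nb v. x u)"
    and lam0: "0 \<le> lam"
    and lamsq: "real kap * (real (card V) - real kap) \<le> lam\<^sup>2"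
begin

abbreviation n :: real where "n \<equiv> real (card V)"

lemma n_pos: "0 < n"
  using z finV by (auto simp: card_gt_0_iff)

lemma x_nb: "u \<in> nb v \<Longrightarrow> 0 \<le> x u" "u \<in> nb v \<Longrightarrow> x u \<le> 1"
  using x_nonneg x_le_1 nb_V by blast+

lemma deg_le: "real (card (nb v)) \<le> n"
  using card_nb_le by simp

lemma lam_x_le_deg: "v \<in> V \<Longrightarrow> lam * x v \<le> real (card (nb v))"
  using subinv[of v] sum_mono[of "nb v" x "\<lambda>_. 1"] x_nb(2) by fastforce

text \<open>Walks v, a, u are split by membership in \<open>H\<close>. For a in \<open>H\<close> the
  second step is not taken and \<open>x a\<close> is bounded by 1. For other a, the walks ending in
  \<open>H\<close> are counted through codegrees, and those avoiding \<open>H\<close> are kept as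
  they are.\<close>

lemma two_step:
  assumes v: "v \<in> V" and H: "H \<subseteq> V"
  shows "lam\<^sup>2 * x v \<le> real (card H) * lam + (\<Sum>u\<in>H. real (card (nb v \<inter> nb u)) * x u)
     + (\<Sum>a\<in>nb v - H. \<Sum>u\<in>nb a - H. x u)"
proof -
  have fH: "finite H" using H finV finite_subset by blast
  have "lam\<^sup>2 * x v = lam * (lam * x v)" by (simp add: power2_eq_square)
  also have "\<dots> \<le> lam * (\<Sum>u\<in>nb v. x u)" by (rule mult_left_mono[OF subinv[OF v] lam0])
  also have "(\<Sum>u\<in>nb v. x u) = (\<Sum>u\<in>nb v \<inter> H. x u) + (\<Sum>u\<in>nb v - H. x u)"
    using sum.union_disjoint[of "nb v \<inter> H" "nb v - H" x] by (simp add: Int_Diff_Un disjoint_iff)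
  also have "lam * ((\<Sum>u\<in>nb v \<inter> H. x u) + (\<Sum>u\<in>nb v - H. x u))
      = lam * (\<Sum>u\<in>nb v \<inter> H. x u) + (\<Sum>u\<in>nb v - H. lam * x u)"
    by (simp add: distrib_left sum_distrib_left)
  also have "lam * (\<Sum>u\<in>nb v \<inter> H. x u) \<le> lam * real (card H)"
  proof (rule mult_left_mono[OF _ lam0])
    have "(\<Sum>u\<in>nb v \<inter> H. x u) \<le> (\<Sum>u\<in>nb v \<inter> H. 1)" by (rule sum_mono) (use x_nb in auto)
    also have "\<dots> \<le> real (card H)" using card_mono[OF fH, of "nb v \<inter> H"] by simp
    finally show "(\<Sum>u\<in>nb v \<inter> H. x u) \<le> real (card H)" .
  qed
  also have "(\<Sum>u\<in>nb v - H. lam * x u) \<le> (\<Sum>a\<in>nb v - H. \<Sum>u\<in>nb a. x u)"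
    by (rule sum_mono) (use subinv nb_V in blast)
  also have "\<dots> = (\<Sum>a\<in>nb v - H. (\<Sum>u\<in>nb a \<inter> H. x u) + (\<Sum>u\<in>nb a - H. x u))"
  proof (rule sum.cong[OF refl])
    fix a
    show "(\<Sum>u\<in>nb a. x u) = (\<Sum>u\<in>nb a \<inter> H. x u) + (\<Sum>u\<in>nb a - H. x u)"
      using sum.union_disjoint[of "nb a \<inter> H" "nb a - H" x] by (simp add: Int_Diff_Un disjoint_iff)
  qed
  also have "\<dots> = (\<Sum>a\<in>nb v - H. \<Sum>u\<in>nb a \<inter> H. x u) + (\<Sum>a\<in>nb v - H. \<Sum>u\<in>nb a - H. x u)"
    by (rule sum.distrib)
  also have "(\<Sum>a\<in>nb v - H. \<Sum>u\<in>nb a \<inter> H. x u) = (\<Sum>u\<in>H. real (card (nb u \<inter> (nb v - H))) * x u)"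
    by (rule sum_walks) (use fH in auto)
  also have "\<dots> \<le> (\<Sum>u\<in>H. real (card (nb v \<inter> nb u)) * x u)"
  proof (rule sum_mono)
    fix u assume "u \<in> H"
    moreover have "card (nb u \<inter> (nb v - H)) \<le> card (nb v \<inter> nb u)" by (rule card_mono) auto
    ultimately show "real (card (nb u \<inter> (nb v - H))) * x u \<le> real (card (nb v \<inter> nb u)) * x u"
      using x_nonneg H by (intro mult_right_mono) auto
  qed
  finally show ?thesis by (simp add: algebra_simps)
qed

lemma walks_le:
  assumes A: "A \<subseteq> V" and B: "\<And>a u. a \<in> A \<Longrightarrow> u \<in> f a \<Longrightarrow> u \<in> nb a \<and> u \<in> B \<and> x u \<le> c" and c: "0 \<le> c"
  shows "(\<Sum>a\<in>A. \<Sum>u\<in>f a. x u) \<le> c * real (ed A B)"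
proof -
  have "(\<Sum>a\<in>A. \<Sum>u\<in>f a. x u) \<le> (\<Sum>a\<in>A. real (card (nb a \<inter> B)) * c)"
  proof (rule sum_mono)
    fix a assume a: "a \<in> A"
    have "(\<Sum>u\<in>f a. x u) \<le> (\<Sum>u\<in>f a. c)" by (rule sum_mono) (use B a in blast)
    also have "\<dots> = real (card (f a)) * c" by simp
    also have "\<dots> \<le> real (card (nb a \<inter> B)) * c"
    proof (rule mult_right_mono[OF _ c])
      have "card (f a) \<le> card (nb a \<inter> B)" by (rule card_mono) (use B a in auto)
      then show "real (card (f a)) \<le> real (card (nb a \<inter> B))" by simp
    qed
    finally show "(\<Sum>u\<in>f a. x u) \<le> real (card (nb a \<inter> B)) * c" .
  qed
  then show ?thesis by (simp add: ed_real sum_distrib_left mult.commute)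
qed

text \<open>Walks from the vertex of weight 1 with nothing set apart. It makes \<lambda> at most of
  order sqrt n, whence \<open>real s * lam \<le> \<delta> * n\<close> for large n.\<close>

lemma lam_upper: "lam\<^sup>2 \<le> real (4 * MM + 1) * n"
proof -
  have "lam\<^sup>2 * x z \<le> (\<Sum>a\<in>nb z. \<Sum>u\<in>nb a. x u)"
    using two_step[OF z(1), of "{}"] by simp
  also have "\<dots> \<le> 1 * real (ed (nb z) V)"
    by (rule walks_le) (use nb_V x_nb in auto)
  also have "\<dots> \<le> real ((4 * MM + 1) * card V)" using ed_nb_V[of z] by (simp del: of_nat_mult)
  finally show ?thesis using z by (simp add: algebra_simps)
qed

end

text \<open>\<open>s\<close> bounds the number of vertices of degree at least \<delta> n. The
  conditions \<open>large\<close> serve, in this order, to prove that bound; to absorb into \<delta>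
  n the exceptional vertices of \<open>sum_nb_inter_le\<close>, the walks whose middle vertex has
  large degree, and the \<kappa>^2 in \<open>lamsq\<close>; to give \<lambda>^2 \<ge> \<kappa> n - n
  / 4; and to limit the vertices of weight at least \<delta> in a second neighbourhood.\<close>

locale large_spectral_fan_free = spectral_fan_free V E I kk cyc x lam z
  for V :: "'a set" and E and I kk cyc x lam z +
  fixes \<delta> :: real and s :: nat
  assumes \<delta>: "0 < \<delta>" "\<delta> \<le> 1"
    and s: "real kap + 1 \<le> real s * \<delta>"
    and large: "real (s * (mm * 2 ^ s)) < n" "real (s * (mm * 2 ^ s)) \<le> \<delta> * n" "real s * lam \<le> \<delta> * n"
      "(real kap)\<^sup>2 \<le> \<delta> * n" "4 * (real kap)\<^sup>2 \<le> n"
      "6 * real MM + 6 \<le> \<delta>\<^sup>2 * lam"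
begin

definition H :: "'a set" where "H = {v\<in>V. \<delta> * n \<le> real (card (nb v))}"

lemma H_V: "H \<subseteq> V" by (auto simp: H_def)
lemma finH: "finite H" using finV by (simp add: H_def)

lemma notin_H: "v \<in> V \<Longrightarrow> v \<notin> H \<Longrightarrow> real (card (nb v)) \<le> \<delta> * n"
  by (auto simp: H_def)

text \<open>If \<open>s\<close> vertices had degree at least \<delta> n, they would have s \<delta>
  n \<ge> (\<kappa> + 1) n incidences, whereas all but boundedly many vertices have at most \<kappa>
  neighbours among them.\<close>

lemma card_H_less: "card H < s"
proof (rule ccontr)
  assume "\<not> card H < s"
  then obtain S where S: "S \<subseteq> H" "card S = s" by (meson linorder_not_less obtain_subset_with_card_n)
  have SV: "S \<subseteq> V" using S H_V by blast
  have fS: "finite S" using SV finV finite_subset by blast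
  have "real s * (\<delta> * n) \<le> (\<Sum>v\<in>S. real (card (nb v \<inter> V)))"
  proof -
    have "\<delta> * n \<le> real (card (nb v \<inter> V))" if "v \<in> S" for v
    proof -
      have "nb v \<inter> V = nb v" using nb_V by auto
      then show ?thesis using that S by (auto simp: H_def)
    qed
    then show ?thesis using sum_bounded_below[of S "\<delta> * n" "\<lambda>v. real (card (nb v \<inter> V))"] S(2) by simp
  qed
  also have "\<dots> = real (ed V S)" using ed_commute[OF finV fS] by (simp add: ed_real)
  also have "\<dots> \<le> real (kap * card V + s * (mm * 2 ^ s))"
    using sum_nb_inter_le[OF SV order_refl] S(2) unfolding ed_def by (simp only: of_nat_le_iff)
  also have "\<dots> < real kap * n + n" using large(1) by simp
  finally have "(real s * \<delta>) * n < (real kap + 1) * n" by (simp add: algebra_simps)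
  then show False using s n_pos by (simp add: mult_less_cancel_right)
qed

text \<open>The walks are counted at their middle vertex: a neighbour of \<open>v\<close> has at
  most \<kappa> neighbours in \<open>H\<close>, with boundedly many exceptions.\<close>

lemma H_codegree_le:
  "(\<Sum>u\<in>H. real (card (nb v \<inter> nb u))) \<le> real kap * real (card (nb v)) + \<delta> * n"
proof -
  have "(\<Sum>u\<in>H. card (nb v \<inter> nb u)) = ed H (nb v)" by (simp add: ed_def Int_commute)
  also have "\<dots> = ed (nb v) H" by (rule ed_commute) (use finH in auto)
  also have "\<dots> \<le> kap * card (nb v) + card H * (mm * 2 ^ card H)"
    unfolding ed_def by (rule sum_nb_inter_le[OF H_V nb_V])
  also have "card H * (mm * 2 ^ card H) \<le> s * (mm * 2 ^ s)"
    by (intro mult_le_mono power_increasing) (use card_H_less in auto)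
  finally have "real (\<Sum>u\<in>H. card (nb v \<inter> nb u)) \<le> real (kap * card (nb v) + s * (mm * 2 ^ s))"
    by (simp only: of_nat_le_iff)
  then show ?thesis using large(2) by simp
qed

definition T :: "'a \<Rightarrow> real" where "T v = (\<Sum>a\<in>nb v - H. \<Sum>u\<in>nb a - H. x u)"

lemma two_step_H:
  assumes "v \<in> V"
  shows "lam\<^sup>2 * x v \<le> \<delta> * n + (\<Sum>u\<in>H. real (card (nb v \<inter> nb u)) * x u) + T v"
proof -
  have "real (card H) * lam \<le> real s * lam" by (rule mult_right_mono) (use card_H_less lam0 in auto)
  then show ?thesis using two_step[OF assms H_V] large(3) unfolding T_def by linarith
qed

lemma H_weight_le: "(\<Sum>u\<in>H. real (card (nb v \<inter> nb u)) * x u) \<le> real kap * real (card (nb v)) + \<delta> * n"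
proof -
  have "(\<Sum>u\<in>H. real (card (nb v \<inter> nb u)) * x u) \<le> (\<Sum>u\<in>H. real (card (nb v \<inter> nb u)))"
    by (rule sum_mono) (use x_le_1 H_V in \<open>auto intro!: mult_left_le\<close>)
  then show ?thesis using H_codegree_le[of v] by linarith
qed

lemma weight_le_T:
  assumes "v \<in> V" "v \<notin> H"
  shows "lam\<^sup>2 * x v \<le> (real kap + 2) * (\<delta> * n) + T v"
proof -
  have "real kap * real (card (nb v)) \<le> real kap * (\<delta> * n)"
    by (rule mult_left_mono) (use notin_H[OF assms] in auto)
  then show ?thesis using two_step_H[OF assms(1)] H_weight_le[of v] by (simp add: algebra_simps)
qed

lemma ed_nb_nb: "real (ed (nb w) (nb w)) \<le> 4 * real MM * real (card (nb w))"
proof -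
  have "ed (nb w) (nb w) \<le> 2 * MM * (card (nb w) + card (nb w))" by (rule ed_nb_le[OF nb_V]) simp
  then have "real (ed (nb w) (nb w)) \<le> real (2 * MM * (card (nb w) + card (nb w)))" by (simp only: of_nat_le_iff)
  then show ?thesis by simp
qed

text \<open>
  As all degrees outside \<open>H\<close> are small, each branch can be found after deleting the previous ones at
  little cost; so the bound is governed by the longest single branch, and not by the whole fan.
\<close>

lemma T_le_branches:
  assumes K: "\<And>i. i \<in> I \<Longrightarrow> kk i \<le> kap"
    and w: "w \<in> V" "w \<notin> H" and max: "\<And>v. v \<in> V \<Longrightarrow> v \<notin> H \<Longrightarrow> x v \<le> x w"
  shows "T w \<le> x w * ((real kap - 1) * n + (1 + 7 * real MM) * (\<delta> * n))"
proof -
  define A where "A = nb w - H"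
  define B where "B = V - H - nb w - {w}"
  define \<Delta> where "\<Delta> = nat \<lfloor>\<delta> * n\<rfloor>"
  have \<delta>n: "0 \<le> \<delta> * n" using \<delta> by simp
  have \<Delta>: "real \<Delta> \<le> \<delta> * n" unfolding \<Delta>_def using \<delta>n by (simp add: of_nat_floor)
  have AV: "A \<subseteq> V" using nb_V by (auto simp: A_def)
  have finA: "finite A" by (simp add: A_def)
  have cA: "real (card A) \<le> \<delta> * n"
  proof -
    have "card A \<le> card (nb w)" unfolding A_def by (rule card_mono) auto
    then show ?thesis using notin_H[OF w] by linarith
  qed
  \<comment> \<open>The ends of these walks lie off \<open>H\<close>, where \<open>x w\<close> is
    the largest weight. They are \<open>w\<close> itself, neighbours of \<open>w\<close>, or
    vertices of \<open>B\<close>, and the first two kinds account for O(\<delta> n) edges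
    only.\<close>
  have "T w \<le> x w * real (ed A ({w} \<union> (nb w \<union> B)))"
    unfolding T_def A_def[symmetric]
  proof (rule walks_le[OF AV])
    fix a u assume "a \<in> A" and u: "u \<in> nb a - H"
    then have "u \<in> V" using nb_V by blast
    then show "u \<in> nb a \<and> u \<in> {w} \<union> (nb w \<union> B) \<and> x u \<le> x w" using u max by (auto simp: B_def)
  qed (use x_nonneg w in auto)
  also have "ed A ({w} \<union> (nb w \<union> B)) = ed A {w} + (ed A (nb w) + ed A B)"
  proof -
    have "ed A ({w} \<union> (nb w \<union> B)) = ed A {w} + ed A (nb w \<union> B)" by (rule ed_Un_right) (auto simp: B_def)
    also have "ed A (nb w \<union> B) = ed A (nb w) + ed A B" by (rule ed_Un_right) (auto simp: B_def)
    finally show ?thesis .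
  qed
  also have "x w * real (ed A {w} + (ed A (nb w) + ed A B)) \<le>
      x w * ((real kap - 1) * n + (1 + 7 * real MM) * (\<delta> * n))"
  proof (rule mult_left_mono)
    have "ed A {w} \<le> card A" using ed_le_mult[of "{w}" A] by simp
    then have 1: "real (ed A {w}) \<le> \<delta> * n" using cA by linarith
    have "ed A (nb w) \<le> ed (nb w) (nb w)" by (rule ed_mono) (auto simp: A_def)
    then have "real (ed A (nb w)) \<le> 4 * real MM * real (card (nb w))" using ed_nb_nb[of w] by linarith
    also have "\<dots> \<le> 4 * real MM * (\<delta> * n)" by (rule mult_left_mono) (use notin_H[OF w] in auto)
    finally have 2: "real (ed A (nb w)) \<le> 4 * real MM * (\<delta> * n)" .
    have "ed A B \<le> (kap - 1) * card B + MM * card A + MM * (\<Delta> + card A)"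
    proof (rule ed_nb_le_bounded_degree)
      fix a assume a: "a \<in> A"
      then have "real (card (nb a)) \<le> \<delta> * n" using notin_H AV by (auto simp: A_def)
      then have "card (nb a) \<le> \<Delta>" unfolding \<Delta>_def by (simp add: le_nat_floor)
      moreover have "card (nb a \<inter> B) \<le> card (nb a)" by (rule card_mono) auto
      ultimately show "card (nb a \<inter> B) \<le> \<Delta>" by linarith
    qed (auto simp: A_def B_def K)
    then have "real (ed A B) \<le> real ((kap - 1) * card B + MM * card A + MM * (\<Delta> + card A))"
      by (simp only: of_nat_le_iff)
    also have "\<dots> = (real kap - 1) * real (card B) + real MM * real (card A) + real MM * (real \<Delta> + real (card A))"
      using kap_pos by (simp add: of_nat_diff)
    also have "\<dots> \<le> (real kap - 1) * n + real MM * (\<delta> * n) + real MM * (\<delta> * n + \<delta> * n)"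
    proof (intro add_mono mult_left_mono cA \<Delta>)
      show "real (card B) \<le> n" unfolding of_nat_le_iff by (rule card_mono[OF finV]) (auto simp: B_def)
    qed (use kap_pos in auto)
    finally have 3: "real (ed A B) \<le> (real kap - 1) * n + 3 * real MM * (\<delta> * n)" by (simp add: algebra_simps)
    show "real (ed A {w} + (ed A (nb w) + ed A B)) \<le> (real kap - 1) * n + (1 + 7 * real MM) * (\<delta> * n)"
      using 1 2 3 by (simp add: algebra_simps)
  qed (use x_nonneg w in auto)
  finally show ?thesis .
qed

text \<open>A vertex of the second neighbourhood with weight at least \<delta> has degree at least
  \<lambda> \<delta>, while only O(n) edges meet that neighbourhood; for large \<lambda> there are
  at most \<delta> n such vertices. Walks ending in \<open>Big\<close> are then few by the linear
  bound on the edges at \<open>nb w\<close>, and those ending neither there nor at \<open>w\<close>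
  end at weights below \<delta>.\<close>

lemma T_le_single_cycle:
  assumes I: "I = {i}" "cyc i" "3 \<le> kk i" and w: "w \<in> V" "w \<notin> H"
  shows "T w \<le> (1 + 10 * real MM) * (\<delta> * n)"
proof -
  define Y where "Y = V - insert w (nb w)"
  define N2 where "N2 = {u\<in>Y. \<exists>a\<in>nb w. E a u}"
  define N2' where "N2' = {u\<in>N2. \<delta> \<le> x u}"
  have lam_pos: "0 < lam" 
  proof -
    have "lam \<noteq> 0" using large(6) by auto
    then show ?thesis using lam0 by simp
  qed
  have dw: "real (card (nb w)) \<le> \<delta> * n" by (rule notin_H[OF w])
  have fin: "finite Y" "finite N2" "finite N2'" using finV by (auto simp: Y_def N2_def N2'_def)
  have cY: "card Y \<le> card V" "card N2 \<le> card V"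
    by (rule card_mono[OF finV], auto simp: Y_def N2_def)+
  have "(\<Sum>j\<in>I. 2 * kk j) = 2 * kk i" unfolding I(1) by simp
  then have MMi: "2 * kk i = MM" using MM_def by simp
  have "real (card N2') * (lam * \<delta>) \<le> (\<Sum>u\<in>N2'. real (card (nb u)))"
  proof -
    have "lam * \<delta> \<le> real (card (nb u))" if "u \<in> N2'" for u
    proof -
      have "u \<in> V" "\<delta> \<le> x u" using that by (auto simp: N2'_def N2_def Y_def)
      then show ?thesis using lam_x_le_deg[of u] mult_left_mono[OF _ lam0, of \<delta> "x u"] by linarith
    qed
    then show ?thesis using sum_bounded_below[of N2' "lam * \<delta>" "\<lambda>u. real (card (nb u))"] by simp
  qed
  also have "\<dots> \<le> (\<Sum>u\<in>N2. real (card (nb u)))"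
    by (rule sum_mono2) (use fin in \<open>auto simp: N2'_def\<close>)
  also have "\<dots> = real (ed N2 (Y \<union> nb w))"
    unfolding ed_real
  proof (rule sum.cong[OF refl])
    fix u assume "u \<in> N2"
    then have "w \<notin> nb u" using nb_sym[of w u] by (auto simp: N2_def Y_def)
    then have "nb u \<inter> (Y \<union> nb w) = nb u" using nb_V[of u] by (auto simp: Y_def)
    then show "real (card (nb u)) = real (card (nb u \<inter> (Y \<union> nb w)))" by simp
  qed
  also have "ed N2 (Y \<union> nb w) = ed N2 Y + ed N2 (nb w)" by (rule ed_Un_right) (auto simp: Y_def)
  also have "real (ed N2 Y + ed N2 (nb w)) \<le> (6 * real MM + 6) * n"
  proof -
    have "ed N2 Y \<le> (2 * kk i + 3) * (card Y + card N2)"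
      by (rule ed_second_neighbourhood_le[OF I Y_def N2_def])
    also have "\<dots> \<le> (MM + 3) * (card V + card V)"
      unfolding MMi by (intro mult_le_mono add_mono cY order_refl)
    finally have 1: "real (ed N2 Y) \<le> real ((MM + 3) * (card V + card V))" by (simp only: of_nat_le_iff)
    have "ed N2 (nb w) = ed (nb w) N2" by (rule ed_commute) (use fin in auto)
    also have "\<dots> \<le> 2 * MM * (card (nb w) + card N2)"
      by (rule ed_nb_le) (auto simp: N2_def Y_def)
    also have "\<dots> \<le> 2 * MM * (card V + card V)" by (intro mult_le_mono add_mono cY card_nb_le order_refl)
    finally have "real (ed N2 (nb w)) \<le> real (2 * MM * (card V + card V))" by (simp only: of_nat_le_iff)
    then show ?thesis using 1 by (simp add: algebra_simps)
  qed
  finally have "real (card N2') * (lam * \<delta>) \<le> (6 * real MM + 6) * n" .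
  also have "\<dots> \<le> (\<delta>\<^sup>2 * lam) * n" by (rule mult_right_mono[OF large(6)]) simp
  also have "\<dots> = (\<delta> * n) * (lam * \<delta>)" by (simp add: power2_eq_square)
  finally have cN2': "real (card N2') \<le> \<delta> * n" using lam_pos \<delta> by (simp add: mult_le_cancel_right)
  define Big where "Big = nb w \<union> N2'"
  have BigV: "Big \<subseteq> V" "w \<notin> Big" "finite Big"
    using nb_V[of w] fin by (auto simp: Big_def N2'_def N2_def Y_def)
  have "card Big \<le> card (nb w) + card N2'" unfolding Big_def by (rule card_Un_le)
  then have cBig: "real (card Big) \<le> \<delta> * n + \<delta> * n" using dw cN2' by linarith
  define f1 where "f1 a = (nb a - H) \<inter> {w}" for a
  define f2 where "f2 a = ((nb a - H) - {w}) \<inter> Big" for a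
  define f3 where "f3 a = ((nb a - H) - {w}) - Big" for a
  have AV: "nb w - H \<subseteq> V" using nb_V by blast
  have "T w = (\<Sum>a\<in>nb w - H. (\<Sum>u\<in>f1 a. x u) + ((\<Sum>u\<in>f2 a. x u) + (\<Sum>u\<in>f3 a. x u)))"
    unfolding T_def
  proof (rule sum.cong[OF refl])
    fix a
    have "nb a - H = f1 a \<union> (f2 a \<union> f3 a)" by (auto simp: f1_def f2_def f3_def)
    then have "(\<Sum>u\<in>nb a - H. x u) = (\<Sum>u\<in>f1 a \<union> (f2 a \<union> f3 a). x u)" by simp
    also have "\<dots> = (\<Sum>u\<in>f1 a. x u) + (\<Sum>u\<in>f2 a \<union> f3 a. x u)"
      by (rule sum.union_disjoint) (auto simp: f1_def f2_def f3_def)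
    also have "(\<Sum>u\<in>f2 a \<union> f3 a. x u) = (\<Sum>u\<in>f2 a. x u) + (\<Sum>u\<in>f3 a. x u)"
      by (rule sum.union_disjoint) (auto simp: f2_def f3_def)
    finally show "(\<Sum>u\<in>nb a - H. x u) = (\<Sum>u\<in>f1 a. x u) + ((\<Sum>u\<in>f2 a. x u) + (\<Sum>u\<in>f3 a. x u))" .
  qed
  also have "\<dots> = (\<Sum>a\<in>nb w - H. \<Sum>u\<in>f1 a. x u) + ((\<Sum>a\<in>nb w - H. \<Sum>u\<in>f2 a. x u) + (\<Sum>a\<in>nb w - H. \<Sum>u\<in>f3 a. x u))"
    by (simp only: sum.distrib)
  also have "\<dots> \<le> 1 * real (ed (nb w - H) {w}) + (1 * real (ed (nb w - H) Big) + \<delta> * real (ed (nb w - H) (V - {w})))"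
  proof (intro add_mono walks_le AV)
    fix a u assume a: "a \<in> nb w - H"
    show "u \<in> nb a \<and> u \<in> {w} \<and> x u \<le> 1" if "u \<in> f1 a" using that x_nb by (auto simp: f1_def)
    show "u \<in> nb a \<and> u \<in> Big \<and> x u \<le> 1" if "u \<in> f2 a" using that x_nb by (auto simp: f2_def)
    show "u \<in> nb a \<and> u \<in> V - {w} \<and> x u \<le> \<delta>" if u: "u \<in> f3 a"
    proof -
      have ua: "u \<in> nb a" "u \<noteq> w" "u \<notin> nb w" "u \<notin> N2'" "u \<in> V"
        using u nb_V by (auto simp: f3_def Big_def)
      then have "u \<in> N2" using a by (auto simp: N2_def Y_def nb_def)
      then show ?thesis using ua by (auto simp: N2'_def)
    qed
  qed (use \<delta> in auto)
  also have "\<dots> \<le> \<delta> * n + (6 * real MM * (\<delta> * n) + \<delta> * (4 * real MM * n))"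
  proof (intro add_mono mult_left_mono)
    have "ed (nb w - H) {w} \<le> ed (nb w) {w}" by (rule ed_mono) auto
    also have "\<dots> \<le> card (nb w)" using ed_le_mult[of "{w}" "nb w"] by simp
    finally show "1 * real (ed (nb w - H) {w}) \<le> \<delta> * n" using dw by linarith
    have "ed (nb w - H) Big \<le> ed (nb w) Big" by (rule ed_mono) auto
    also have "\<dots> \<le> 2 * MM * (card (nb w) + card Big)" by (rule ed_nb_le) (use BigV in auto)
    finally have "real (ed (nb w - H) Big) \<le> real (2 * MM * (card (nb w) + card Big))" by (simp only: of_nat_le_iff)
    also have "\<dots> = 2 * real MM * (real (card (nb w)) + real (card Big))" by simp
    also have "\<dots> \<le> 2 * real MM * (\<delta> * n + (\<delta> * n + \<delta> * n))"
      by (intro mult_left_mono add_mono dw cBig) auto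
    finally show "1 * real (ed (nb w - H) Big) \<le> 6 * real MM * (\<delta> * n)" by simp
    have "ed (nb w - H) (V - {w}) \<le> ed (nb w) (V - {w})" by (rule ed_mono) auto
    also have "\<dots> \<le> 2 * MM * (card (nb w) + card (V - {w}))" by (rule ed_nb_le) auto
    also have "\<dots> \<le> 2 * MM * (card V + card V)"
      by (intro mult_le_mono add_mono card_nb_le card_mono order_refl) (use finV in auto)
    finally have "real (ed (nb w - H) (V - {w})) \<le> real (2 * MM * (card V + card V))" by (simp only: of_nat_le_iff)
    then show "real (ed (nb w - H) (V - {w})) \<le> 4 * real MM * n" by simp
  qed (use \<delta> in auto)
  finally show ?thesis by (simp add: algebra_simps)
qed

text \<open>The larger error term of the two cases in \<open>light_outside_H\<close>, doubled
  because at least n / 2 remains there as the coefficient of \<open>x w\<close>.\<close>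

definition C0 :: real where "C0 = 2 * (real kap + 3 + 10 * real MM)"

text \<open>The estimate is made at a vertex \<open>w\<close> of largest weight outside
  \<open>H\<close>. If every parameter is at most \<kappa>, then \<open>x w\<close> has coefficient
  about \<kappa> n on the left and at most about (\<kappa> - 1) n on the right; for a single cycle
  it does not occur on the right at all.\<close>

lemma light_outside_H:
  assumes fan_cases: "(\<forall>i\<in>I. kk i \<le> kap) \<or> (\<exists>i. I = {i} \<and> cyc i \<and> 3 \<le> kk i)"
    and small: "(1 + 7 * real MM) * \<delta> \<le> 1 / 4"
    and v: "v \<in> V" "v \<notin> H"
  shows "x v \<le> C0 * \<delta>"
proof -
  have ne: "V - H \<noteq> {}" "finite (V - H)" using v finV by auto
  have "Max (x ` (V - H)) \<in> x ` (V - H)" by (rule Max_in) (use ne in auto)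
  then obtain w where w: "w \<in> V" "w \<notin> H" "x w = Max (x ` (V - H))" by auto
  have max: "x v \<le> x w" if "v \<in> V" "v \<notin> H" for v
    unfolding w(3) by (rule Max_ge) (use ne that in auto)
  have xw: "0 \<le> x w" by (rule x_nonneg[OF w(1)])
  have base: "real kap * n - n / 4 \<le> lam\<^sup>2"
    using lamsq large(5) by (simp add: algebra_simps power2_eq_square)
  note wt = weight_le_T[OF w(1,2)]
  have "n * x w \<le> 2 * ((real kap + 3 + 10 * real MM) * (\<delta> * n))"
    using fan_cases
  proof
    assume K: "\<forall>i\<in>I. kk i \<le> kap"
    have "(real kap * n - n / 4) * x w \<le> lam\<^sup>2 * x w" by (rule mult_right_mono[OF base xw])
    also have "\<dots> \<le> (real kap + 2) * (\<delta> * n) + x w * ((real kap - 1) * n + (1 + 7 * real MM) * (\<delta> * n))"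
      using wt T_le_branches[OF _ w(1,2)] K max by fastforce
    also have "x w * ((real kap - 1) * n + (1 + 7 * real MM) * (\<delta> * n)) \<le> x w * ((real kap - 1) * n + 1 / 4 * n)"
    proof (rule mult_left_mono[OF _ xw])
      have "((1 + 7 * real MM) * \<delta>) * n \<le> 1 / 4 * n" by (rule mult_right_mono[OF small]) simp
      then show "(real kap - 1) * n + (1 + 7 * real MM) * (\<delta> * n) \<le> (real kap - 1) * n + 1 / 4 * n"
        by (simp add: mult.assoc)
    qed
    finally have "n * x w \<le> 2 * ((real kap + 2) * (\<delta> * n))" by (simp add: algebra_simps)
    also have "\<dots> \<le> 2 * ((real kap + 3 + 10 * real MM) * (\<delta> * n))"
      using \<delta> by (intro mult_left_mono mult_right_mono) auto
    finally show ?thesis .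
  next
    assume "\<exists>i. I = {i} \<and> cyc i \<and> 3 \<le> kk i"
    then have T: "T w \<le> (1 + 10 * real MM) * (\<delta> * n)" using T_le_single_cycle w by blast
    have "1 * n \<le> real kap * n" using kap_pos by (intro mult_right_mono) auto
    then have "1 / 2 * n \<le> lam\<^sup>2" using base n_pos by linarith
    then have "1 / 2 * n * x w \<le> lam\<^sup>2 * x w" by (rule mult_right_mono[OF _ xw])
    then have "1 / 2 * n * x w \<le> (real kap + 2) * (\<delta> * n) + (1 + 10 * real MM) * (\<delta> * n)" using wt T by linarith
    then show ?thesis by (simp add: algebra_simps)
  qed
  then have "n * x w \<le> n * (C0 * \<delta>)" by (simp add: C0_def algebra_simps)
  then have "x w \<le> C0 * \<delta>" using n_pos by (simp add: mult_le_cancel_left)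
  then show ?thesis using max[OF v] by linarith
qed

end

section \<open>The hub vertices\<close>

context large_spectral_fan_free
begin

text \<open>\<open>C2\<close> collects two errors \<delta> n, from the walks through
  \<open>H\<close> and from \<kappa>^2 in \<open>lamsq\<close>, and the weight of the walks avoiding
  \<open>H\<close>. In units of \<epsilon>, \<open>C4\<close> bounds the missing degree of a heavy
  vertex relative to n, and \<open>C5\<close> the weight of the others.\<close>

definition C2 :: real where "C2 = 2 + C0 * real (4 * MM + 1)"
definition C4 :: real where "C4 = C2 + 2"
definition C5 :: real where "C5 = 1 + real kap * C4 + C4"

lemma C_pos: "0 \<le> C0" "2 \<le> C2" "4 \<le> C4"
proof -
  show "0 \<le> C0" by (simp add: C0_def)
  then show "2 \<le> C2" by (simp add: C2_def)
  then show "4 \<le> C4" by (simp add: C4_def)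
qed

text \<open>As every vertex off \<open>H\<close> is now light, the walks avoiding \<open>H\<close>
  weigh little from any start \<open>v\<close>, also from one in \<open>H\<close>. For the second
  bound, the walks ending in \<open>H\<close> number at most \<kappa> times the degree of
  \<open>v\<close> plus \<delta> n, and the estimate is divided by \<kappa> n.\<close>

lemma weight_le_codegree:
  assumes fan_cases: "(\<forall>i\<in>I. kk i \<le> kap) \<or> (\<exists>i. I = {i} \<and> cyc i \<and> 3 \<le> kk i)"
    and small: "(1 + 7 * real MM) * \<delta> \<le> 1 / 4" and v: "v \<in> V"
  shows "real kap * n * x v \<le> (\<Sum>u\<in>H. real (card (nb v \<inter> nb u)) * x u) + C2 * (\<delta> * n)"
    and "x v \<le> real (card (nb v)) / n + (C2 + 1) * \<delta>"
proof -
  have C\<delta>: "0 \<le> C0 * \<delta>" using C_pos \<delta> by simp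
  have "T v \<le> (C0 * \<delta>) * real (ed (nb v - H) V)"
    unfolding T_def
  proof (rule walks_le[OF _ _ C\<delta>])
    show "nb v - H \<subseteq> V" using nb_V by blast
    fix a u assume "u \<in> nb a - H"
    then show "u \<in> nb a \<and> u \<in> V \<and> x u \<le> C0 * \<delta>" using light_outside_H[OF fan_cases small] nb_V by blast
  qed
  also have "\<dots> \<le> (C0 * \<delta>) * (real (4 * MM + 1) * n)"
  proof (rule mult_left_mono[OF _ C\<delta>])
    have "ed (nb v - H) V \<le> ed (nb v) V" by (rule ed_mono) auto
    also have "\<dots> \<le> (4 * MM + 1) * card V" by (rule ed_nb_V)
    finally have "real (ed (nb v - H) V) \<le> real ((4 * MM + 1) * card V)" by (simp only: of_nat_le_iff)
    then show "real (ed (nb v - H) V) \<le> real (4 * MM + 1) * n" by (simp only: of_nat_mult)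
  qed
  finally have T: "T v \<le> (C2 - 2) * (\<delta> * n)" by (simp add: C2_def algebra_simps)
  have "(real kap * (n - real kap)) * x v \<le> lam\<^sup>2 * x v"
    by (rule mult_right_mono[OF lamsq x_nonneg[OF v]])
  moreover have "(real kap)\<^sup>2 * x v \<le> \<delta> * n"
    using mult_left_le[OF x_le_1[OF v], of "(real kap)\<^sup>2"] large(4) by simp
  ultimately have "real kap * n * x v - \<delta> * n \<le> lam\<^sup>2 * x v"
    by (simp add: algebra_simps power2_eq_square)
  then show 1: "real kap * n * x v \<le> (\<Sum>u\<in>H. real (card (nb v \<inter> nb u)) * x u) + C2 * (\<delta> * n)"
    using two_step_H[OF v] T by (simp add: algebra_simps)
  have "real kap * (n * x v) \<le> real kap * real (card (nb v)) + (C2 + 1) * (\<delta> * n)"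
    using 1 H_weight_le[of v] by (simp add: algebra_simps)
  also have "(C2 + 1) * (\<delta> * n) \<le> real kap * ((C2 + 1) * (\<delta> * n))"
  proof -
    have "0 \<le> (C2 + 1) * (\<delta> * n)" using C_pos \<delta> by simp
    then show ?thesis using kap_pos mult_right_mono[of 1 "real kap"] by fastforce
  qed
  finally have "real kap * (n * x v) \<le> real kap * (real (card (nb v)) + (C2 + 1) * (\<delta> * n))"
    by (simp add: distrib_left)
  then have "n * x v \<le> real (card (nb v)) + (C2 + 1) * (\<delta> * n)"
    using kap_pos by (simp add: mult_le_cancel_left)
  then show "x v \<le> real (card (nb v)) / n + (C2 + 1) * \<delta>"
    using n_pos by (simp add: field_simps)
qed

text \<open>Vertices of weight at least 1 - \<epsilon> have degree close to n by
  \<open>weight_le_codegree\<close>. More than \<kappa> of them would have too many common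
  neighbours; fewer cannot supply the walks required at \<open>z\<close>. A vertex outside
  \<open>L\<close> has fewer than \<open>mm\<close> neighbours in \<open>common L\<close>, hence
  small degree and small weight.\<close>

lemma hub_structure:
  assumes fan_cases: "(\<forall>i\<in>I. kk i \<le> kap) \<or> (\<exists>i. I = {i} \<and> cyc i \<and> 3 \<le> kk i)"
    and small: "(1 + 7 * real MM) * \<delta> \<le> 1 / 4"
    and \<epsilon>: "0 < \<epsilon>" "\<delta> = \<epsilon>\<^sup>2" "2 * (real kap + 1) * (C4 * \<epsilon>) \<le> 1"
    and mm: "2 * real mm \<le> n" "real mm \<le> \<epsilon> * n"
  shows "\<exists>L\<subseteq>V. card L = kap \<and> (\<forall>v\<in>L. 1 - \<epsilon> \<le> x v) \<and> (\<forall>v\<in>V - L. x v \<le> C5 * \<epsilon>) \<and>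
     real (card (V - common L)) \<le> real kap * (C4 * \<epsilon> * n)"
proof -
  note wt = weight_le_codegree[OF fan_cases small]
  have C4e: "0 \<le> C4 * \<epsilon>" using C_pos \<epsilon> by simp
  have C4e2: "4 * (C4 * \<epsilon>) \<le> 1"
  proof -
    have "4 * (C4 * \<epsilon>) \<le> 2 * (real kap + 1) * (C4 * \<epsilon>)"
      by (rule mult_right_mono[OF _ C4e]) (use kap_pos in simp)
    then show ?thesis using \<epsilon> by linarith
  qed
  have "4 * \<epsilon> \<le> C4 * \<epsilon>" using C_pos \<epsilon> by (intro mult_right_mono) auto
  then have \<epsilon>1: "\<epsilon> \<le> 1" using C4e2 \<epsilon> by linarith
  have \<delta>\<epsilon>: "\<delta> \<le> \<epsilon>" using \<epsilon> \<epsilon>1 by (simp add: power2_eq_square mult_left_le)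
  define L where "L = {u\<in>H. 1 - \<epsilon> \<le> x u}"
  have LH: "L \<subseteq> H" and LV: "L \<subseteq> V" and finL: "finite L" using H_V finH by (auto simp: L_def)
  have deg: "n - real (card (nb u)) \<le> C4 * \<epsilon> * n" if "u \<in> L" for u
  proof -
    have "1 - \<epsilon> \<le> real (card (nb u)) / n + (C2 + 1) * \<delta>" using wt(2)[of u] that LV by (auto simp: L_def)
    moreover have "(C2 + 1) * \<delta> \<le> (C2 + 1) * \<epsilon>" by (rule mult_left_mono[OF \<delta>\<epsilon>]) (use C_pos in simp)
    ultimately have "1 - C4 * \<epsilon> \<le> real (card (nb u)) / n" by (simp add: C4_def algebra_simps)
    then have "(1 - C4 * \<epsilon>) * n \<le> real (card (nb u))" using n_pos by (simp add: pos_le_divide_eq)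
    then show ?thesis by (simp add: algebra_simps)
  qed
  have le: "card L \<le> kap"
  proof (rule ccontr)
    assume "\<not> card L \<le> kap"
    then obtain S where S: "S \<subseteq> L" "card S = Suc kap" by (meson not_less_eq_eq obtain_subset_with_card_n)
    have fS: "finite S" using S finL finite_subset by blast
    have "real (card (V - common S)) \<le> real (card S) * (C4 * \<epsilon> * n)"
      by (rule card_diff_common_le[OF fS]) (use deg S in blast)
    also have "\<dots> = ((real kap + 1) * (C4 * \<epsilon>)) * n" using S by (simp add: algebra_simps)
    also have "\<dots> \<le> 1 / 2 * n" by (rule mult_right_mono) ((use \<epsilon>(3) in linarith), simp)
    finally have 1: "real (card (V - common S)) \<le> n / 2" by simp
    have "card (V - common S) = card V - card (common S)"
      by (rule card_Diff_subset) (auto simp: common_def finV)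
    moreover have "card (common S) < mm" by (rule card_common_less) (use S LV in auto)
    moreover have "card (common S) \<le> card V" by (rule card_mono[OF finV]) (auto simp: common_def)
    ultimately show False using 1 mm by linarith
  qed
  let ?c = "\<lambda>u. real (card (nb z \<inter> nb u))"
  have zsum: "real kap * n \<le> (\<Sum>u\<in>H. ?c u * x u) + C2 * (\<delta> * n)" using wt(1)[OF z(1)] z(2) by simp
  have call: "(\<Sum>u\<in>H. ?c u) \<le> real kap * n + \<delta> * n"
  proof -
    have "real kap * real (card (nb z)) \<le> real kap * n" by (rule mult_left_mono[OF deg_le]) simp
    then show ?thesis using H_codegree_le[of z] by linarith
  qed
  have split: "(\<Sum>u\<in>H. h u) = (\<Sum>u\<in>L. h u) + (\<Sum>u\<in>H - L. h u)" for h :: "'a \<Rightarrow> real"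
    using sum.subset_diff[OF LH finH, of h] by simp
  \<comment> \<open>Over all of \<open>H\<close> the count at \<open>z\<close> can lose at most (C2
    + 1) \<delta> n to weights below 1, and a vertex of \<open>H - L\<close> loses at least the
    fraction \<epsilon> of its codegree. With \<delta> = \<epsilon>^2 the codegrees of
    \<open>H - L\<close> add up to at most (C2 + 1) \<epsilon> n.\<close>
  have "\<epsilon> * (\<Sum>u\<in>H - L. ?c u) \<le> (\<Sum>u\<in>H - L. ?c u * (1 - x u))"
    unfolding sum_distrib_left
  proof (rule sum_mono)
    fix u assume "u \<in> H - L"
    then have "\<epsilon> \<le> 1 - x u" by (auto simp: L_def)
    then have "?c u * \<epsilon> \<le> ?c u * (1 - x u)" by (rule mult_left_mono) simp
    then show "\<epsilon> * ?c u \<le> ?c u * (1 - x u)" by (simp add: mult.commute)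
  qed
  also have "\<dots> \<le> (\<Sum>u\<in>H. ?c u * (1 - x u))"
    by (rule sum_mono2) (use finH H_V x_le_1 in auto)
  also have "\<dots> = (\<Sum>u\<in>H. ?c u) - (\<Sum>u\<in>H. ?c u * x u)" by (simp add: right_diff_distrib sum_subtractf)
  also have "\<dots> \<le> (C2 + 1) * (\<delta> * n)" using zsum call by (simp add: algebra_simps)
  also have "\<dots> = \<epsilon> * ((C2 + 1) * (\<epsilon> * n))" using \<epsilon> by (simp add: power2_eq_square)
  finally have rest: "(\<Sum>u\<in>H - L. ?c u) \<le> (C2 + 1) * (\<epsilon> * n)" using \<epsilon>(1) by (simp add: mult_le_cancel_left)
  have restx: "(\<Sum>u\<in>H - L. ?c u * x u) \<le> (\<Sum>u\<in>H - L. ?c u)"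
    by (rule sum_mono) (use x_le_1 H_V in \<open>auto intro!: mult_left_le\<close>)
  have "(\<Sum>u\<in>L. ?c u * x u) \<le> (\<Sum>u\<in>L. n)"
  proof (rule sum_mono)
    fix u assume u: "u \<in> L"
    have "card (nb z \<inter> nb u) \<le> card V" by (rule card_mono[OF finV]) (use nb_V in auto)
    moreover have "?c u * x u \<le> ?c u" using x_le_1 u LV by (intro mult_left_le) auto
    ultimately show "?c u * x u \<le> n" by linarith
  qed
  then have "real kap * n \<le> real (card L) * n + (C2 + 1) * (\<epsilon> * n) + C2 * (\<delta> * n)"
    using zsum split[of "\<lambda>u. ?c u * x u"] rest restx by simp
  also have "C2 * (\<delta> * n) \<le> C2 * (\<epsilon> * n)"
    using C_pos \<delta>\<epsilon> by (intro mult_left_mono mult_right_mono) auto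
  finally have "real kap * n \<le> (real (card L) + (2 * C2 + 1) * \<epsilon>) * n" by (simp add: algebra_simps)
  then have "real kap \<le> real (card L) + (2 * C2 + 1) * \<epsilon>" using n_pos by (simp add: mult_le_cancel_right)
  \<comment> \<open>An error below 1 makes the integers \<open>card L\<close> and \<open>kap\<close>
    coincide.\<close>
  moreover have "(2 * C2 + 1) * \<epsilon> < 1"
  proof -
    have "(2 * C2 + 1) * \<epsilon> < (4 * C4) * \<epsilon>" by (rule mult_strict_right_mono) (use C_pos \<epsilon> in \<open>auto simp: C4_def\<close>)
    then show ?thesis using C4e2 by simp
  qed
  ultimately have cL: "card L = kap" using le by linarith
  have cR: "real (card (V - common L)) \<le> real kap * (C4 * \<epsilon> * n)"
    using card_diff_common_le[OF finL deg] cL by simp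
  have "x v \<le> C5 * \<epsilon>" if v: "v \<in> V - L" for v
  proof -
    have "card (nb v) \<le> card (nb v \<inter> common L) + card (V - common L)"
    proof -
      have "nb v \<subseteq> (nb v \<inter> common L) \<union> (V - common L)" using nb_V by blast
      then have "card (nb v) \<le> card ((nb v \<inter> common L) \<union> (V - common L))" by (intro card_mono) (use finV in auto)
      also have "\<dots> \<le> card (nb v \<inter> common L) + card (V - common L)" by (rule card_Un_le)
      finally show ?thesis .
    qed
    moreover have "card (nb v \<inter> common L) < mm" by (rule card_nb_common_less[OF LV cL v])
    ultimately have "real (card (nb v)) \<le> \<epsilon> * n + real kap * (C4 * \<epsilon> * n)" using cR mm(2) by linarith
    then have "real (card (nb v)) / n \<le> \<epsilon> + real kap * (C4 * \<epsilon>)" using n_pos by (simp add: field_simps)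
    moreover have "(C2 + 1) * \<delta> \<le> C4 * \<epsilon>" by (intro mult_mono) (use \<delta>\<epsilon> C_pos \<epsilon> \<delta> in \<open>auto simp: C4_def\<close>)
    ultimately show ?thesis using wt(2)[of v] v by (simp add: C5_def algebra_simps)
  qed
  moreover have "\<forall>v\<in>L. 1 - \<epsilon> \<le> x v" by (auto simp: L_def)
  ultimately show ?thesis using LV cL cR by blast
qed

end

section \<open>Comparison with the extremal graph\<close>

context fin_graph
begin

lemma double_sum_restrict:
  fixes f :: "'a \<Rightarrow> 'a \<Rightarrow> real"
  assumes "A \<subseteq> V" "B \<subseteq> V"
  shows "(\<Sum>v\<in>V. \<Sum>u\<in>V. if v \<in> A \<and> u \<in> B \<and> E v u then f v u else 0) = (\<Sum>v\<in>A. \<Sum>u\<in>nb v \<inter> B. f v u)"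
proof -
  have 1: "(\<Sum>u\<in>V. if v \<in> A \<and> u \<in> B \<and> E v u then f v u else 0)
      = (if v \<in> A then \<Sum>u\<in>nb v \<inter> B. f v u else 0)" for v
  proof (cases "v \<in> A")
    case True
    have "(\<Sum>u\<in>V. if v \<in> A \<and> u \<in> B \<and> E v u then f v u else 0) = (\<Sum>u\<in>{u\<in>V. v \<in> A \<and> u \<in> B \<and> E v u}. f v u)"
      by (rule sum.inter_filter[symmetric, OF finV])
    also have "{u\<in>V. v \<in> A \<and> u \<in> B \<and> E v u} = nb v \<inter> B" using True assms by (auto simp: nb_def)
    finally show ?thesis using True by simp
  qed simp
  have "(\<Sum>v\<in>V. if v \<in> A then \<Sum>u\<in>nb v \<inter> B. f v u else 0) = (\<Sum>v\<in>{v\<in>V. v \<in> A}. \<Sum>u\<in>nb v \<inter> B. f v u)"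
    by (rule sum.inter_filter[symmetric, OF finV])
  also have "{v\<in>V. v \<in> A} = A" using assms by auto
  finally show ?thesis unfolding 1 .
qed

end

context spectral_fan_free
begin

lemma edge_form_ge: "lam * (\<Sum>v\<in>V. (x v)\<^sup>2) \<le> (\<Sum>v\<in>V. \<Sum>u\<in>V. if E v u then x v * x u else 0)"
proof -
  have "lam * (\<Sum>v\<in>V. (x v)\<^sup>2) = (\<Sum>v\<in>V. x v * (lam * x v))"
    by (simp add: sum_distrib_left power2_eq_square mult.left_commute)
  also have "\<dots> \<le> (\<Sum>v\<in>V. x v * (\<Sum>u\<in>nb v. x u))"
    by (rule sum_mono) (use subinv x_nonneg in \<open>auto intro: mult_left_mono\<close>)
  also have "\<dots> = (\<Sum>v\<in>V. \<Sum>u\<in>nb v \<inter> V. x v * x u)"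
  proof (rule sum.cong[OF refl])
    fix v
    have "nb v \<inter> V = nb v" using nb_V by auto
    then show "x v * (\<Sum>u\<in>nb v. x u) = (\<Sum>u\<in>nb v \<inter> V. x v * x u)" by (simp add: sum_distrib_left)
  qed
  also have "\<dots> = (\<Sum>v\<in>V. \<Sum>u\<in>V. if v \<in> V \<and> u \<in> V \<and> E v u then x v * x u else 0)"
    by (rule double_sum_restrict[symmetric]) auto
  also have "\<dots> = (\<Sum>v\<in>V. \<Sum>u\<in>V. if E v u then x v * x u else 0)"
    by (intro sum.cong refl) auto
  finally show ?thesis .
qed

text \<open>The argument bounds the norm of the adjacency matrix induced on \<open>A\<close> by sqrt
  ((4 MM + 1) card A): Cauchy-Schwarz, used twice, reduces it to the row sums of the squared matrix,
  which count walks of length two inside \<open>A\<close>.\<close>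

lemma inner_form_sq_le:
  assumes A: "A \<subseteq> V"
  shows "(\<Sum>v\<in>A. \<Sum>u\<in>nb v \<inter> A. x v * x u)\<^sup>2 \<le> real (4 * MM + 1) * real (card A) * (\<Sum>v\<in>A. (x v)\<^sup>2)\<^sup>2"
proof -
  have finA: "finite A" using A finV finite_subset by blast
  let ?q = "\<Sum>v\<in>A. (x v)\<^sup>2"
  have "(\<Sum>v\<in>A. \<Sum>u\<in>nb v \<inter> A. x v * x u) = (\<Sum>v\<in>A. x v * (\<Sum>u\<in>nb v \<inter> A. x u))"
    by (simp add: sum_distrib_left)
  then have "(\<Sum>v\<in>A. \<Sum>u\<in>nb v \<inter> A. x v * x u)\<^sup>2 \<le> ?q * (\<Sum>v\<in>A. (\<Sum>u\<in>nb v \<inter> A. x u)\<^sup>2)"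
    using Cauchy_Schwarz_ineq_sum[of x "\<lambda>v. \<Sum>u\<in>nb v \<inter> A. x u" A] by simp
  also have "(\<Sum>v\<in>A. (\<Sum>u\<in>nb v \<inter> A. x u)\<^sup>2) \<le> (\<Sum>v\<in>A. real (card (nb v \<inter> A)) * (\<Sum>u\<in>nb v \<inter> A. (x u)\<^sup>2))"
  proof (rule sum_mono)
    fix v
    show "(\<Sum>u\<in>nb v \<inter> A. x u)\<^sup>2 \<le> real (card (nb v \<inter> A)) * (\<Sum>u\<in>nb v \<inter> A. (x u)\<^sup>2)"
      using Cauchy_Schwarz_ineq_sum[of "\<lambda>_. 1" x "nb v \<inter> A"] by simp
  qed
  also have "\<dots> = (\<Sum>v\<in>A. \<Sum>u\<in>nb v \<inter> A. real (card (nb v \<inter> A)) * (x u)\<^sup>2)"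
    by (simp add: sum_distrib_left)
  also have "\<dots> = (\<Sum>v\<in>V. \<Sum>u\<in>V. if v \<in> A \<and> u \<in> A \<and> E v u then real (card (nb v \<inter> A)) * (x u)\<^sup>2 else 0)"
    by (rule double_sum_restrict[OF A A, symmetric])
  also have "\<dots> = (\<Sum>u\<in>V. \<Sum>v\<in>V. if u \<in> A \<and> v \<in> A \<and> E u v then real (card (nb v \<inter> A)) * (x u)\<^sup>2 else 0)"
    by (subst sum.swap) (intro sum.cong refl, use E_sym in auto)
  also have "\<dots> = (\<Sum>u\<in>A. \<Sum>v\<in>nb u \<inter> A. real (card (nb v \<inter> A)) * (x u)\<^sup>2)"
    by (rule double_sum_restrict[OF A A])
  also have "\<dots> = (\<Sum>u\<in>A. real (ed (nb u \<inter> A) A) * (x u)\<^sup>2)"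
    by (simp add: ed_real sum_distrib_right)
  also have "\<dots> \<le> (\<Sum>u\<in>A. (real (4 * MM + 1) * real (card A)) * (x u)\<^sup>2)"
  proof (intro sum_mono mult_right_mono)
    fix w assume w: "w \<in> A"
    have le: "card (nb w \<inter> A) \<le> card A" "card (A - {w}) \<le> card A" by (auto intro: card_mono finA)
    have "ed (nb w \<inter> A) A = ed (nb w \<inter> A) ((A - {w}) \<union> {w})" using w by (simp add: insert_absorb)
    also have "\<dots> = ed (nb w \<inter> A) (A - {w}) + ed (nb w \<inter> A) {w}" by (rule ed_Un_right) auto
    also have "ed (nb w \<inter> A) {w} \<le> card (nb w \<inter> A) * card {w}" by (rule ed_le_mult) auto
    also have "ed (nb w \<inter> A) (A - {w}) \<le> 2 * MM * (card (nb w \<inter> A) + card (A - {w}))"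
      by (rule ed_nb_subset_le) (use A in auto)
    also have "2 * MM * (card (nb w \<inter> A) + card (A - {w})) \<le> 2 * MM * (card A + card A)"
      by (intro mult_le_mono add_mono le order_refl)
    finally have "ed (nb w \<inter> A) A \<le> (4 * MM + 1) * card A" using le(1) by (simp add: algebra_simps)
    then have "real (ed (nb w \<inter> A) A) \<le> real ((4 * MM + 1) * card A)" by (simp only: of_nat_le_iff)
    then show "real (ed (nb w \<inter> A) A) \<le> real (4 * MM + 1) * real (card A)" by (simp only: of_nat_mult)
  qed simp
  also have "\<dots> = (real (4 * MM + 1) * real (card A)) * ?q" by (simp add: sum_distrib_left)
  also have "?q * (real (4 * MM + 1) * real (card A) * ?q) = real (4 * MM + 1) * real (card A) * ?q\<^sup>2"
    by (simp add: power2_eq_square)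
  finally show ?thesis by (simp add: mult_left_mono sum_nonneg)
qed

lemma S_plus_structure:
  assumes i: "i \<in> I" "3 \<le> kk i"
    and L: "L \<subseteq> V" "card L = kap" and \<epsilon>: "0 < \<epsilon>" "\<epsilon> \<le> 1 / 4"
    and xL: "\<And>v. v \<in> L \<Longrightarrow> 1 - \<epsilon> \<le> x v"
    and x\<eta>: "\<And>v. v \<in> V - L \<Longrightarrow> x v \<le> \<eta>" and \<eta>: "16 * (real mm * \<eta>) \<le> 1"
    and cR: "real (card (V - common L)) \<le> \<rho> * n"
    and \<rho>: "128 * (real kap + 1)\<^sup>2 * (real (4 * MM + 1) * \<rho>) \<le> 1"
    and n: "2 * real mm + 4 \<le> n" "2 * (real kap)\<^sup>2 \<le> n"
    and \<mu>: "2 \<le> \<mu>" "\<mu> \<le> lam"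
    and root: "\<mu> = (real kap - 1) + 2 * (real kap / (\<mu> - 1)) + (n - real kap - 2) * (real kap / \<mu>)"
  shows "\<exists>L r s. L \<subseteq> V \<and> card L = kap \<and> r \<in> V - L \<and> s \<in> V - L \<and> r \<noteq> s \<and>
     (\<forall>u v. E u v \<longleftrightarrow> S_plus_rel V L r s u v)"
proof -
  have finL: "finite L" using L finV finite_subset by blast
  define R where "R = common L"
  define B where "B = V - L - R"
  have RV: "R \<subseteq> V" and BV: "B \<subseteq> V" by (auto simp: R_def common_def B_def)
  have finB: "finite B" and finR: "finite R" using BV RV finV finite_subset by blast+
  have LR: "L \<inter> R = {}" unfolding R_def by (rule common_disjoint)
  have \<rho>0: "0 \<le> \<rho>"
  proof -
    have "0 \<le> \<rho> * n" using cR of_nat_0_le_iff order_trans by blast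
    then show ?thesis using n_pos by (simp add: zero_le_mult_iff)
  qed
  have \<rho>half: "\<rho> \<le> 1 / 2"
  proof -
    have "2 * 1 * (1 * \<rho>) \<le> 128 * (real kap + 1)\<^sup>2 * (real (4 * MM + 1) * \<rho>)"
    proof (intro mult_mono)
      show "(2 :: real) \<le> 128" by simp
      show "1 \<le> (real kap + 1)\<^sup>2" by simp
    qed (use \<rho>0 in auto)
    then show ?thesis using \<rho> by linarith
  qed
  have cardR: "mm + 2 \<le> card R"
  proof -
    have "\<rho> * n \<le> 1 / 2 * n" by (rule mult_right_mono[OF \<rho>half]) simp
    moreover have "card (V - R) = card V - card R" by (rule card_Diff_subset[OF finR RV])
    moreover have "card R \<le> card V" by (rule card_mono[OF finV RV])
    ultimately have "n / 2 \<le> real (card R)" using cR unfolding R_def[symmetric] by linarith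
    then show ?thesis using n(1) by linarith
  qed
  have unique_edge: "\<exists>r s. r \<in> R \<and> s \<in> R \<and> r \<noteq> s \<and> (\<forall>u\<in>R. \<forall>v\<in>R. E u v \<longrightarrow> {u, v} = {r, s})"
  proof (cases "\<exists>r\<in>R. \<exists>s\<in>R. E r s")
    case True
    then obtain r s where rs: "r \<in> R" "s \<in> R" "E r s" by blast
    have "r \<noteq> s" using rs E_irrefl by auto
    have "{u, v} = {r, s}" if uv: "u \<in> R" "v \<in> R" "E u v" for u v
    proof (rule ccontr)
      assume ne: "{u, v} \<noteq> {r, s}"
      have P3: False if "p \<in> R" "q \<in> R" "t \<in> R" "p \<noteq> t" "E p q" "E q t" for p q t
        using common_no_P3[OF L cardR[unfolded R_def], of p q t] that by (simp add: R_def)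
      have "u \<noteq> v" using uv E_irrefl by auto
      have "u \<noteq> r"
      proof
        assume "u = r"
        then have "v \<noteq> s" using ne by auto
        then show False using P3[of v u s] uv rs E_sym \<open>u = r\<close> by blast
      qed
      moreover have "u \<noteq> s"
      proof
        assume "u = s"
        then have "v \<noteq> r" using ne by auto
        then show False using P3[of v u r] uv rs E_sym \<open>u = s\<close> by blast
      qed
      moreover have "v \<noteq> r"
      proof
        assume "v = r"
        then show False using P3[of u v s] uv rs \<open>u \<noteq> s\<close> by blast
      qed
      moreover have "v \<noteq> s"
      proof
        assume "v = s"
        then show False using P3[of u v r] uv rs E_sym \<open>u \<noteq> r\<close> by blast
      qed
      ultimately have "distinct [u, v, r, s]" using \<open>u \<noteq> v\<close> \<open>r \<noteq> s\<close> by auto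
      then show False
        using common_no_2K2[OF i L cardR[unfolded R_def], of u v r s] uv rs by (simp add: R_def)
    qed
    then show ?thesis using rs \<open>r \<noteq> s\<close> by blast
  next
    case False
    \<comment> \<open>Without an edge in \<open>R\<close> any two of its vertices serve as
      \<open>r\<close> and \<open>s\<close>; that they are adjacent after all results from the
      equality case.\<close>
    have "2 \<le> card R" using cardR by simp
    then obtain S where S: "S \<subseteq> R" "card S = 2" by (meson obtain_subset_with_card_n)
    then obtain r s where "S = {r, s}" "r \<noteq> s" by (meson card_2_iff)
    then show ?thesis using S False by blast
  qed
  then obtain r s where rs: "r \<in> R" "s \<in> R" "r \<noteq> s" and
    only: "\<And>u v. u \<in> R \<Longrightarrow> v \<in> R \<Longrightarrow> E u v \<Longrightarrow> {u, v} = {r, s}" by blast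
  have rsV: "r \<in> V - L" "s \<in> V - L" using rs RV LR by auto
  define W where "W = S_plus_rel V L r s"
  have W_sym: "W v u" if "W u v" for u v using that by (auto simp: W_def S_plus_rel_def insert_commute)
  have EW: "W v u" if "E v u" "v \<notin> B \<or> u \<in> L" "u \<notin> B \<or> v \<in> L" for v u
  proof -
    have vu: "v \<in> V" "u \<in> V" "v \<noteq> u" using that(1) E_V E_sym E_irrefl by blast+
    show ?thesis
    proof (cases "v \<in> L \<or> u \<in> L")
      case True
      then show ?thesis using vu by (auto simp: W_def S_plus_rel_def)
    next
      case False
      then have "v \<in> R" "u \<in> R" using that vu by (auto simp: B_def)
      then show ?thesis using only[of v u] that(1) vu by (auto simp: W_def S_plus_rel_def)
    qed
  qed
  have "\<forall>v\<in>B. \<exists>l\<in>L. \<not> E v l"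
    using E_sym by (auto simp: B_def R_def common_def)
  then obtain l where l: "\<And>v. v \<in> B \<Longrightarrow> l v \<in> L \<and> \<not> E v (l v)" by metis
  have lB: "l v \<notin> B" "l v \<in> V" "W v (l v)" if "v \<in> B" for v
  proof -
    have "l v \<in> L" using l that by blast
    moreover have "v \<in> V" "v \<notin> L" using that by (auto simp: B_def)
    ultimately show "l v \<notin> B" "l v \<in> V" "W v (l v)" using L(1) by (auto simp: B_def W_def S_plus_rel_def)
  qed
  have xx: "0 \<le> x v * x u" if "v \<in> V" "u \<in> V" for v u using x_nonneg that by simp

  define s1 where "s1 = (\<Sum>v\<in>B. x v)"
  define q where "q = (\<Sum>v\<in>B. (x v)\<^sup>2)"
  define P where "P = (\<Sum>v\<in>B. \<Sum>u\<in>nb v \<inter> B. x v * x u)"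
  define PR where "PR = (\<Sum>v\<in>B. \<Sum>u\<in>nb v \<inter> R. x v * x u)"
  have s10: "0 \<le> s1" unfolding s1_def by (rule sum_nonneg) (use x_nonneg BV in auto)
  have q0: "0 \<le> q" unfolding q_def by (rule sum_nonneg) simp
  have nbR: "(\<Sum>u\<in>nb v \<inter> R. x u) \<le> 1 / 16" if v: "v \<in> B" for v
  proof -
    have vL: "v \<in> V - L" using v by (auto simp: B_def)
    have \<eta>0: "0 \<le> \<eta>" using x\<eta>[OF vL] x_nonneg[of v] vL by auto
    have "(\<Sum>u\<in>nb v \<inter> R. x u) \<le> (\<Sum>u\<in>nb v \<inter> R. \<eta>)"
      by (rule sum_mono) (use x\<eta> RV LR in auto)
    also have "\<dots> = real (card (nb v \<inter> R)) * \<eta>" by simp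
    also have "\<dots> \<le> real mm * \<eta>"
      using card_nb_common_less[OF L vL] \<eta>0 unfolding R_def by (intro mult_right_mono) auto
    finally show ?thesis using \<eta> by linarith
  qed
  have PR: "PR \<le> s1 / 16"
  proof -
    have "PR = (\<Sum>v\<in>B. x v * (\<Sum>u\<in>nb v \<inter> R. x u))" by (simp add: PR_def sum_distrib_left)
    also have "\<dots> \<le> (\<Sum>v\<in>B. x v * (1 / 16))"
      by (intro sum_mono mult_left_mono nbR) (use x_nonneg BV in auto)
    finally show ?thesis by (simp add: s1_def sum_divide_distrib)
  qed
  have P: "P \<le> s1 / 4"
  proof -
    \<comment> \<open>Chosen so that 2 (\<kappa> + 1) \<theta> = 1/4. The factor 128 in the
      hypothesis on \<rho> is 64 from \<theta>^2 times 2 from \<lambda>^2 \<ge> n / 2.\<close>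
    define \<theta> where "\<theta> = 1 / (8 * (real kap + 1))"
    have \<theta>: "0 < \<theta>" "\<theta> \<le> 1 / 2" by (auto simp: \<theta>_def field_simps)
    have lam2: "n / 2 \<le> lam\<^sup>2"
    proof -
      have "1 * n \<le> real kap * n" using kap_pos by (intro mult_right_mono) auto
      moreover have "real kap * n - (real kap)\<^sup>2 \<le> lam\<^sup>2" using lamsq by (simp add: algebra_simps power2_eq_square)
      ultimately show ?thesis using n(2) by linarith
    qed
    have "real (4 * MM + 1) * real (card B) \<le> \<theta>\<^sup>2 * lam\<^sup>2"
    proof -
      have "card B \<le> card (V - R)" by (rule card_mono) (use finV in \<open>auto simp: B_def\<close>)
      then have "real (4 * MM + 1) * real (card B) \<le> real (4 * MM + 1) * (\<rho> * n)"
        using cR unfolding R_def[symmetric] by (intro mult_left_mono) auto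
      also have "\<dots> = (real (4 * MM + 1) * \<rho>) * n" by simp
      also have "\<dots> \<le> (\<theta>\<^sup>2 / 2) * n"
      proof (rule mult_right_mono)
        have k: "0 < 128 * (real kap + 1)\<^sup>2" by (simp add: add_pos_pos zero_less_power2 add_nonneg_eq_0_iff)
        have "\<theta>\<^sup>2 / 2 = 1 / (128 * (real kap + 1)\<^sup>2)" by (simp add: \<theta>_def power2_eq_square field_simps)
        then show "real (4 * MM + 1) * \<rho> \<le> \<theta>\<^sup>2 / 2"
          using \<rho> k by (simp only: pos_le_divide_eq mult.commute)
      qed simp
      also have "\<dots> = \<theta>\<^sup>2 * (n / 2)" by simp
      also have "\<dots> \<le> \<theta>\<^sup>2 * lam\<^sup>2" by (rule mult_left_mono[OF lam2]) simp
      finally show ?thesis .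
    qed
    then have "real (4 * MM + 1) * real (card B) * q\<^sup>2 \<le> \<theta>\<^sup>2 * lam\<^sup>2 * q\<^sup>2" by (rule mult_right_mono) simp
    then have "P\<^sup>2 \<le> (\<theta> * (lam * q))\<^sup>2"
      using inner_form_sq_le[OF BV] unfolding P_def[symmetric] q_def[symmetric] by (simp add: power_mult_distrib)
    then have P\<theta>: "P \<le> \<theta> * (lam * q)"
      by (rule power2_le_imp_le) (use \<theta> lam0 q0 in simp)
    \<comment> \<open>\<open>P\<close> is quadratic in the weights on \<open>B\<close> while the
      gain is linear in them; subinvariance at the vertices of \<open>B\<close> bounds \<lambda> q
      by (\<kappa> + 1) s1 + P and so makes the two comparable.\<close>
    have "lam * q = (\<Sum>v\<in>B. x v * (lam * x v))"
      by (simp add: q_def sum_distrib_left power2_eq_square mult.left_commute)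
    also have "\<dots> \<le> (\<Sum>v\<in>B. x v * (real kap + 1 / 16) + x v * (\<Sum>u\<in>nb v \<inter> B. x u))"
    proof (rule sum_mono)
      fix v assume v: "v \<in> B"
      have "(\<Sum>u\<in>nb v. x u) = (\<Sum>u\<in>nb v \<inter> L. x u) + ((\<Sum>u\<in>nb v \<inter> R. x u) + (\<Sum>u\<in>nb v \<inter> B. x u))"
      proof -
        have "nb v = (nb v \<inter> L) \<union> ((nb v \<inter> R) \<union> (nb v \<inter> B))" using nb_V[of v] by (auto simp: B_def)
        then have "(\<Sum>u\<in>nb v. x u) = (\<Sum>u\<in>(nb v \<inter> L) \<union> ((nb v \<inter> R) \<union> (nb v \<inter> B)). x u)" by simp
        also have "\<dots> = (\<Sum>u\<in>nb v \<inter> L. x u) + (\<Sum>u\<in>(nb v \<inter> R) \<union> (nb v \<inter> B). x u)"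
          by (rule sum.union_disjoint) (use LR in \<open>auto simp: B_def\<close>)
        also have "(\<Sum>u\<in>(nb v \<inter> R) \<union> (nb v \<inter> B). x u) = (\<Sum>u\<in>nb v \<inter> R. x u) + (\<Sum>u\<in>nb v \<inter> B. x u)"
          by (rule sum.union_disjoint) (auto simp: B_def)
        finally show ?thesis .
      qed
      moreover have "(\<Sum>u\<in>nb v \<inter> L. x u) \<le> real kap"
      proof -
        have "(\<Sum>u\<in>nb v \<inter> L. x u) \<le> (\<Sum>u\<in>nb v \<inter> L. 1)" by (rule sum_mono) (use x_nb in auto)
        moreover have "card (nb v \<inter> L) \<le> card L" by (rule card_mono[OF finL]) auto
        ultimately show ?thesis using L(2) by simp
      qed
      ultimately have "lam * x v \<le> (real kap + 1 / 16) + (\<Sum>u\<in>nb v \<inter> B. x u)"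
        using subinv[of v] nbR[OF v] v BV by auto
      then have "x v * (lam * x v) \<le> x v * ((real kap + 1 / 16) + (\<Sum>u\<in>nb v \<inter> B. x u))"
        by (rule mult_left_mono) (use x_nonneg v BV in auto)
      then show "x v * (lam * x v) \<le> x v * (real kap + 1 / 16) + x v * (\<Sum>u\<in>nb v \<inter> B. x u)"
        by (simp only: distrib_left)
    qed
    also have "\<dots> = s1 * (real kap + 1 / 16) + P"
      by (simp add: sum.distrib s1_def sum_distrib_right P_def sum_distrib_left)
    also have "s1 * (real kap + 1 / 16) \<le> s1 * (real kap + 1)" by (rule mult_left_mono[OF _ s10]) simp
    finally have lamq: "lam * q \<le> s1 * (real kap + 1) + P" by simp
    have "\<theta> * (lam * q) \<le> 1 / 2 * (lam * q)" by (rule mult_right_mono[OF \<theta>(2)]) (use lam0 q0 in simp)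
    then have "lam * q \<le> 2 * (s1 * (real kap + 1))" using lamq P\<theta> by linarith
    then have "\<theta> * (lam * q) \<le> \<theta> * (2 * (s1 * (real kap + 1)))" by (rule mult_left_mono) (use \<theta> in simp)
    also have "\<dots> = s1 / 4" by (simp add: \<theta>_def field_simps)
    finally show ?thesis using P\<theta> by linarith
  qed

  define g where "g v u = (if W v u then x v * x u else 0) - (if E v u then x v * x u else 0)" for v u
  define e where "e v u = (if v \<in> B \<and> u \<in> B \<and> E v u then x v * x u else 0)
     + (if v \<in> B \<and> u \<in> R \<and> E v u then x v * x u else 0)
     + (if v \<in> R \<and> u \<in> B \<and> E v u then x v * x u else 0)" for v u
  \<comment> \<open>Only the ordered pair of \<open>v\<close> and \<open>l v\<close> is credited,
    not its reverse, so the gain is counted once, whereas lost edges between \<open>B\<close> and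
    \<open>R\<close> are counted in both directions.\<close>
  have g_ge: "(if u = l v \<and> v \<in> B then x v * x u else 0) - e v u \<le> g v u" if vu: "v \<in> V" "u \<in> V" for v u
  proof (cases "u = l v \<and> v \<in> B")
    case True
    then have "\<not> E v u" "W v u" using l lB by auto
    then have "g v u = x v * x u" "e v u = 0" by (auto simp: g_def e_def)
    then show ?thesis using True by simp
  next
    case F: False
    show ?thesis
    proof (cases "E v u \<and> \<not> W v u")
      case True
      then have "\<not> (v \<notin> B \<or> u \<in> L) \<or> \<not> (u \<notin> B \<or> v \<in> L)" using EW by blast
      then have "v \<in> B \<and> u \<in> B \<or> v \<in> B \<and> u \<in> R \<or> v \<in> R \<and> u \<in> B" using vu by (auto simp: B_def)
      moreover have "B \<inter> R = {}" by (auto simp: B_def)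
      ultimately have "e v u \<ge> x v * x u" using True xx[OF vu] by (auto simp: e_def)
      moreover have "g v u = - (x v * x u)" using True by (simp add: g_def)
      ultimately show ?thesis using F by auto
    next
      case False
      then have "0 \<le> g v u" using xx[OF vu] by (auto simp: g_def)
      moreover have "0 \<le> e v u" using xx[OF vu] by (auto simp: e_def)
      ultimately show ?thesis using F by auto
    qed
  qed
  let ?W = "\<Sum>v\<in>V. \<Sum>u\<in>V. if W v u then x v * x u else 0"
  let ?E = "\<Sum>v\<in>V. \<Sum>u\<in>V. if E v u then x v * x u else 0"
  have gsum: "(\<Sum>v\<in>V. \<Sum>u\<in>V. g v u) = ?W - ?E" by (simp add: g_def sum_subtractf)
  have gain: "(1 - \<epsilon>) * s1 \<le> (\<Sum>v\<in>V. \<Sum>u\<in>V. if u = l v \<and> v \<in> B then x v * x u else 0)"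
  proof -
    have "(1 - \<epsilon>) * s1 = (\<Sum>v\<in>B. x v * (1 - \<epsilon>))" by (simp add: s1_def sum_distrib_left mult.commute)
    also have "\<dots> \<le> (\<Sum>v\<in>B. x v * x (l v))"
      by (intro sum_mono mult_left_mono xL) (use l x_nonneg BV in auto)
    also have "\<dots> = (\<Sum>v\<in>{v\<in>V. v \<in> B}. x v * x (l v))" using BV by (intro sum.cong) auto
    also have "\<dots> = (\<Sum>v\<in>V. if v \<in> B then x v * x (l v) else 0)" by (rule sum.inter_filter[OF finV])
    also have "\<dots> = (\<Sum>v\<in>V. \<Sum>u\<in>V. if u = l v \<and> v \<in> B then x v * x u else 0)"
    proof (rule sum.cong[OF refl])
      fix v assume "v \<in> V"
      show "(if v \<in> B then x v * x (l v) else 0) = (\<Sum>u\<in>V. if u = l v \<and> v \<in> B then x v * x u else 0)"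
        using finV lB(2)[of v] by (cases "v \<in> B") (auto simp: sum.delta)
    qed
    finally show ?thesis .
  qed
  have loss: "(\<Sum>v\<in>V. \<Sum>u\<in>V. e v u) = P + PR + PR"
  proof -
    have "(\<Sum>v\<in>V. \<Sum>u\<in>V. e v u) = P + PR + (\<Sum>v\<in>V. \<Sum>u\<in>V. if v \<in> R \<and> u \<in> B \<and> E v u then x v * x u else 0)"
      unfolding e_def sum.distrib P_def PR_def double_sum_restrict[OF BV BV] double_sum_restrict[OF BV RV] ..
    also have "(\<Sum>v\<in>V. \<Sum>u\<in>V. if v \<in> R \<and> u \<in> B \<and> E v u then x v * x u else 0)
        = (\<Sum>u\<in>V. \<Sum>v\<in>V. if u \<in> B \<and> v \<in> R \<and> E u v then x u * x v else 0)"
      by (subst sum.swap) (intro sum.cong refl, use E_sym in auto)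
    also have "\<dots> = PR" unfolding PR_def by (rule double_sum_restrict[OF BV RV])
    finally show ?thesis .
  qed
  have "(\<Sum>v\<in>V. \<Sum>u\<in>V. (if u = l v \<and> v \<in> B then x v * x u else 0) - e v u) \<le> (\<Sum>v\<in>V. \<Sum>u\<in>V. g v u)"
    by (intro sum_mono g_ge)
  then have "(1 - \<epsilon>) * s1 - (P + PR + PR) \<le> ?W - ?E"
    using gain loss gsum by (simp add: sum_subtractf)
  moreover have "3 / 4 * s1 \<le> (1 - \<epsilon>) * s1" by (rule mult_right_mono) (use \<epsilon> s10 in auto)
  \<comment> \<open>The balance is 3/4 - 1/4 - 2/16 = 3/8 of \<open>s1\<close>, which exceeds the
    1/4 claimed.\<close>
  ultimately have diff: "s1 / 4 \<le> ?W - ?E" using P PR s10 by linarith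

  define y where "y = S_plus_vec L r s \<mu>"
  have y_pos: "0 < y v" for v using kap_pos \<mu>(1) L(2) by (auto simp: y_def S_plus_vec_def)
  have ev: "(\<Sum>u\<in>V. if W v u then y u else 0) = \<mu> * y v" if "v \<in> V" for v
    unfolding W_def y_def by (rule S_plus_vec_eigen) (use finV L rsV rs kap_pos \<mu> root that in auto)
  have WR: "?W \<le> \<mu> * (\<Sum>v\<in>V. (x v)\<^sup>2)" by (rule rayleigh_le(1)[OF finV W_sym y_pos ev])
  have sq: "0 \<le> (\<Sum>v\<in>V. (x v)\<^sup>2)" by (rule sum_nonneg) simp
  have "\<mu> * (\<Sum>v\<in>V. (x v)\<^sup>2) \<le> lam * (\<Sum>v\<in>V. (x v)\<^sup>2)" by (rule mult_right_mono[OF \<mu>(2) sq])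
  \<comment> \<open>Writing X for the sum of the squares, ?W \<le> \<mu> X \<le> \<lambda> X \<le>
    ?E \<le> ?W - s1 / 4, so all these are equalities and \<open>s1\<close> vanishes.\<close>
  then have eqs: "?W = \<mu> * (\<Sum>v\<in>V. (x v)\<^sup>2)" "?W = ?E" "s1 = 0"
    using WR edge_form_ge diff s10 by linarith+
  have proportional: "x v * y u = x u * y v" if "u \<in> V" "v \<in> V" "W v u" for u v
    using rayleigh_le(2)[OF finV W_sym y_pos ev eqs(1)] that by blast
  \<comment> \<open>\<open>x\<close> is positive on \<open>L\<close>, and any other vertex is joined
    in \<open>W\<close> to a vertex \<open>c\<close> of \<open>L\<close>, so proportionality to
    \<open>y\<close> transfers positivity to it. With \<open>s1 = 0\<close> this empties
    \<open>B\<close>.\<close>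
  have x_pos: "0 < x v" if v: "v \<in> V" for v
  proof -
    obtain c where c: "c \<in> L" using L(2) kap_pos by (metis card.empty equals0I not_one_le_zero)
    have xc: "0 < x c" using xL[OF c] \<epsilon> by linarith
    show ?thesis
    proof (cases "v = c")
      case False
      then have "W v c" using v c L(1) by (auto simp: W_def S_plus_rel_def)
      then have "x v * y c = x c * y v" using proportional v c L(1) by blast
      then have "0 < x v * y c" using xc y_pos by simp
      then show ?thesis using y_pos[of c] by (simp add: zero_less_mult_iff)
    qed (use xc in simp)
  qed
  have B0: "B = {}"
  proof (rule ccontr)
    assume "B \<noteq> {}"
    then have "0 < s1" unfolding s1_def by (intro sum_pos finB) (use x_pos BV in auto)
    then show False using eqs by simp
  qed
  have g0: "0 \<le> g v u" if "v \<in> V" "u \<in> V" for v u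
    using EW[of v u] xx[OF that] B0 by (auto simp: g_def)
  have "(\<Sum>v\<in>V. \<Sum>u\<in>V. g v u) = 0" using gsum eqs by simp
  then have g_zero: "g v u = 0" if "v \<in> V" "u \<in> V" for v u
  proof -
    have "0 \<le> (\<Sum>u\<in>V. g v u)" if "v \<in> V" for v by (rule sum_nonneg) (use g0 that in auto)
    then have "(\<Sum>u\<in>V. g v u) = 0"
      using sum_nonneg_eq_0_iff[OF finV, of "\<lambda>v. \<Sum>u\<in>V. g v u"] \<open>(\<Sum>v\<in>V. \<Sum>u\<in>V. g v u) = 0\<close> that by blast
    then show ?thesis using sum_nonneg_eq_0_iff[OF finV, of "g v"] g0 that by blast
  qed
  have "E u v \<longleftrightarrow> W u v" for u v
  proof
    assume "E u v"
    then show "W u v" using EW[of u v] B0 by auto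
  next
    assume "W u v"
    then have uv: "u \<in> V" "v \<in> V" by (auto simp: W_def S_plus_rel_def)
    have "x u * x v \<noteq> 0" using x_pos uv by force
    then show "E u v" using g_zero[OF uv] \<open>W u v\<close> by (auto simp: g_def split: if_splits)
  qed
  then show ?thesis using L rsV rs(3) unfolding W_def by blast
qed

end

text \<open>The constants depend on \<kappa> and \<open>M\<close> only, so \<epsilon> and \<delta>
  can be chosen from them, then \<open>s\<close> from \<delta>, and the threshold \<open>N\<close>
  last. They enter as equations because the parameters are needed before the locale that defines
  them can be interpreted.\<close>

lemma extremal_parameters:
  fixes k m M :: nat and C0 C2 C4 C5 :: real
  assumes k: "1 \<le> k"
    and C: "C0 = 2 * (real k + 3 + 10 * real M)" "C2 = 2 + C0 * real (4 * M + 1)" "C4 = C2 + 2"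
      "C5 = 1 + real k * C4 + C4"
  shows "\<exists>\<epsilon> \<delta> (s :: nat) N :: real. 0 < \<epsilon> \<and> \<epsilon> \<le> 1 / 4 \<and> \<delta> = \<epsilon>\<^sup>2 \<and> 0 < \<delta> \<and> \<delta> \<le> 1 \<and>
    real k + 1 \<le> real s * \<delta> \<and> (1 + 7 * real M) * \<delta> \<le> 1 / 4 \<and> 2 * (real k + 1) * (C4 * \<epsilon>) \<le> 1 \<and>
    16 * (real m * (C5 * \<epsilon>)) \<le> 1 \<and>
    128 * (real k + 1)\<^sup>2 * (real (4 * M + 1) * (real k * (C4 * \<epsilon>))) \<le> 1 \<and>
    (\<forall>n lam. N \<le> n \<longrightarrow> 0 \<le> lam \<longrightarrow> real k * (n - real k) \<le> lam\<^sup>2 \<longrightarrow> lam\<^sup>2 \<le> real (4 * M + 1) * n \<longrightarrow>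
      real (s * (m * 2 ^ s)) < n \<and> real (s * (m * 2 ^ s)) \<le> \<delta> * n \<and> real s * lam \<le> \<delta> * n \<and>
      (real k)\<^sup>2 \<le> \<delta> * n \<and> 4 * (real k)\<^sup>2 \<le> n \<and> 6 * real M + 6 \<le> \<delta>\<^sup>2 * lam \<and>
      2 * real m + 4 \<le> n \<and> real m \<le> \<epsilon> * n)"
proof -
  have Cpos: "0 \<le> C0" "2 \<le> C2" "4 \<le> C4" "1 \<le> C5"
  proof -
    show "0 \<le> C0" unfolding C by simp
    then show "2 \<le> C2" unfolding C(2) by simp
    then show 4: "4 \<le> C4" unfolding C(3) by simp
    then show "1 \<le> C5" unfolding C(4) by simp
  qed
  define a1 where "a1 = 4 * (1 + 7 * real M)"
  define a2 where "a2 = 2 * (real k + 1) * C4"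
  define a3 where "a3 = 16 * (real m * C5)"
  define a4 where "a4 = 128 * (real k + 1)\<^sup>2 * (real (4 * M + 1) * (real k * C4))"
  have a0: "0 \<le> a1" "0 \<le> a2" "0 \<le> a3" "0 \<le> a4" using Cpos by (auto simp: a1_def a2_def a3_def a4_def)
  \<comment> \<open>With \<epsilon> = 1 / X each of the products of \<epsilon> with
    \<open>a1\<close>, ..., \<open>a4\<close> is at most 1, and \<epsilon> is at most 1/4.\<close>
  define X where "X = 4 + a1 + a2 + a3 + a4"
  define \<epsilon> where "\<epsilon> = 1 / X"
  define \<delta> where "\<delta> = \<epsilon>\<^sup>2"
  have X: "4 \<le> X" using a0 by (simp add: X_def)
  have \<epsilon>: "0 < \<epsilon>" "\<epsilon> \<le> 1 / 4" using X by (auto simp: \<epsilon>_def field_simps)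
  have le1: "a * \<epsilon> \<le> 1" if "a \<le> X" for a using that X by (simp add: \<epsilon>_def field_simps)
  have \<delta>0: "0 < \<delta>" using \<epsilon> by (simp add: \<delta>_def)
  have \<delta>\<epsilon>: "\<delta> \<le> \<epsilon>" using \<epsilon> by (simp add: \<delta>_def power2_eq_square mult_left_le)
  define s where "s = nat \<lceil>(real k + 1) / \<delta>\<rceil>"
  have s: "real k + 1 \<le> real s * \<delta>"
  proof -
    have "(real k + 1) / \<delta> \<le> real s" unfolding s_def by (rule real_nat_ceiling_ge)
    then show ?thesis using \<delta>0 by (simp add: field_simps)
  qed
  define b where "b = real (s * (m * 2 ^ s))"
  define b1 where "b1 = (real s)\<^sup>2 * real (4 * M + 1) / \<delta>\<^sup>2"
  define b2 where "b2 = ((6 * real M + 6) / \<delta>\<^sup>2)\<^sup>2"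
  define N where "N = b + 1 + b / \<delta> + b1 + (real k)\<^sup>2 / \<delta> + 4 * (real k)\<^sup>2 + 2 * b2 + (2 * real m + 4) + real m / \<epsilon>"
  have b0: "0 \<le> b" "0 \<le> b / \<delta>" "0 \<le> b1" "0 \<le> (real k)\<^sup>2 / \<delta>" "0 \<le> 4 * (real k)\<^sup>2" "0 \<le> b2" "0 \<le> real m / \<epsilon>"
    using \<delta>0 \<epsilon> by (auto simp: b_def b1_def b2_def)
  have *: "b < n \<and> b \<le> \<delta> * n \<and> real s * lam \<le> \<delta> * n \<and>
      (real k)\<^sup>2 \<le> \<delta> * n \<and> 4 * (real k)\<^sup>2 \<le> n \<and> 6 * real M + 6 \<le> \<delta>\<^sup>2 * lam \<and>
      2 * real m + 4 \<le> n \<and> real m \<le> \<epsilon> * n"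
    if n: "N \<le> n" and lam: "0 \<le> lam" "real k * (n - real k) \<le> lam\<^sup>2" "lam\<^sup>2 \<le> real (4 * M + 1) * n" for n lam
  proof -
    have n0: "0 \<le> n" using n b0 unfolding N_def by linarith
    have 1: "b < n" "b / \<delta> \<le> n" "b1 \<le> n" "(real k)\<^sup>2 / \<delta> \<le> n" "4 * (real k)\<^sup>2 \<le> n" "2 * b2 \<le> n"
      "2 * real m + 4 \<le> n" "real m / \<epsilon> \<le> n"
      using n b0 of_nat_0_le_iff[of m] unfolding N_def by linarith+
    have "(real s)\<^sup>2 * real (4 * M + 1) \<le> \<delta>\<^sup>2 * n" using 1(3) \<delta>0 by (simp add: b1_def field_simps)
    then have "(real s)\<^sup>2 * real (4 * M + 1) * n \<le> \<delta>\<^sup>2 * n * n" by (rule mult_right_mono[OF _ n0])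
    moreover have "(real s)\<^sup>2 * lam\<^sup>2 \<le> (real s)\<^sup>2 * (real (4 * M + 1) * n)" by (rule mult_left_mono[OF lam(3)]) simp
    ultimately have "(real s * lam)\<^sup>2 \<le> (\<delta> * n)\<^sup>2"
      by (simp only: power_mult_distrib power2_eq_square[of n] mult.assoc)
    then have 2: "real s * lam \<le> \<delta> * n" by (rule power2_le_imp_le) (use \<delta>0 n0 in simp)
    have "1 * n \<le> real k * n" by (rule mult_right_mono[OF _ n0]) (use k in simp)
    moreover have "real k * n - (real k)\<^sup>2 \<le> lam\<^sup>2" using lam(2) by (simp add: algebra_simps power2_eq_square)
    ultimately have "n / 2 \<le> lam\<^sup>2" using 1(5) n0 by linarith
    then have "b2 \<le> lam\<^sup>2" using 1(6) by linarith
    then have "(6 * real M + 6) / \<delta>\<^sup>2 \<le> lam" unfolding b2_def by (rule power2_le_imp_le[OF _ lam(1)])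
    then have 3: "6 * real M + 6 \<le> \<delta>\<^sup>2 * lam" using \<delta>0 by (simp add: field_simps)
    show ?thesis using 1 2 3 \<delta>0 \<epsilon>(1) by (simp add: field_simps)
  qed
  have "a1 * \<delta> \<le> a1 * \<epsilon>" by (rule mult_left_mono[OF \<delta>\<epsilon> a0(1)])
  also have "\<dots> \<le> 1" by (rule le1) (use a0 in \<open>simp add: X_def\<close>)
  finally have "(1 + 7 * real M) * \<delta> \<le> 1 / 4" unfolding a1_def by linarith
  moreover have "2 * (real k + 1) * (C4 * \<epsilon>) \<le> 1" using le1[of a2] a0 by (simp add: X_def a2_def mult.assoc)
  moreover have "16 * (real m * (C5 * \<epsilon>)) \<le> 1" using le1[of a3] a0 by (simp add: X_def a3_def mult.assoc)
  moreover have "128 * (real k + 1)\<^sup>2 * (real (4 * M + 1) * (real k * (C4 * \<epsilon>))) \<le> 1"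
    using le1[of a4] a0 by (simp add: X_def a4_def mult.assoc)
  moreover have "\<delta> \<le> 1" using \<delta>\<epsilon> \<epsilon> by linarith
  moreover have "\<forall>n lam. N \<le> n \<longrightarrow> 0 \<le> lam \<longrightarrow> real k * (n - real k) \<le> lam\<^sup>2 \<longrightarrow> lam\<^sup>2 \<le> real (4 * M + 1) * n \<longrightarrow>
      real (s * (m * 2 ^ s)) < n \<and> real (s * (m * 2 ^ s)) \<le> \<delta> * n \<and> real s * lam \<le> \<delta> * n \<and>
      (real k)\<^sup>2 \<le> \<delta> * n \<and> 4 * (real k)\<^sup>2 \<le> n \<and> 6 * real M + 6 \<le> \<delta>\<^sup>2 * lam \<and>
      2 * real m + 4 \<le> n \<and> real m \<le> \<epsilon> * n"
    unfolding b_def[symmetric] by (intro allI impI) (rule *)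
  ultimately show ?thesis
    using \<epsilon> \<delta>0 s \<delta>_def
    by - (rule exI[of _ \<epsilon>], rule exI[of _ \<delta>], rule exI[of _ s], rule exI[of _ N], (intro conjI; assumption))
qed

lemma sum_kk_minus_one:
  assumes "\<forall>k\<in>set xs. k \<ge> (1::nat)"
  shows "(\<Sum>i<length xs. xs ! i - 1) = sum_list xs - length xs" "length xs \<le> sum_list xs"
  using assms
proof (induction xs)
  case (Cons a xs)
  {
    case 1
    then show ?case using Cons by (simp add: sum.lessThan_Suc_shift del: sum.lessThan_Suc)
  next
    case 2
    then show ?case using Cons by simp
  }
qed simp_all

theorem theorem1p6:
  fixes ks ps :: "nat list" and \<kappa> :: nat
  assumes "length ks \<ge> 1 \<or> length ps \<ge> 2"
    and "\<forall>k\<in>set ks. k \<ge> 2"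
    and "\<forall>p\<in>set ps. p \<ge> 2"
    and "Max (set ks \<union> set ps) \<ge> 3"
    and "\<kappa> = sum_list ks + sum_list ps - (length ks + length ps)"
  shows "\<exists>n0. \<forall>n\<ge>n0. \<forall>G :: 'a pair_pre_digraph.
           pair_graph G \<and> card (pverts G) = n \<and>
           adj_spectral_radius G \<ge> adj_spectral_radius (S_plus_graph n \<kappa>) \<and>
           \<not> digraph_iso (with_proj G) (with_proj (S_plus_graph n \<kappa>)) \<longrightarrow>
           contains_subgraph G (CP_graph ks ps)"
proof -
  define t where "t = length ks + length ps"
  define I where "I = {..<t}"
  define kk where "kk = nth (ks @ ps)"
  define cyc where "cyc = (\<lambda>i. i < length ks)"
  define m where "m = (\<Sum>i\<in>I. kk i)"
  define M where "M = (\<Sum>i\<in>I. 2 * kk i)"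
  have ks_ps: "k \<ge> 2" if "k \<in> set (ks @ ps)" for k using that assms(2,3) by auto
  have t: "0 < t" using assms(1) by (auto simp: t_def)
  have finI: "finite I" and I_ne: "I \<noteq> {}" using t by (auto simp: I_def)
  have kk2: "2 \<le> kk i" if "i \<in> I" for i
    using that ks_ps[OF nth_mem, of i] by (simp add: I_def kk_def t_def)
  have \<kappa>: "\<kappa> = (\<Sum>i\<in>I. kk i - 1)"
    using sum_kk_minus_one(1)[of "ks @ ps"] ks_ps assms(5) unfolding I_def kk_def t_def by force
  have kk_le: "kk i - 1 \<le> \<kappa>" if "i \<in> I" for i
    unfolding \<kappa> by (rule member_le_sum) (use that finI in auto)
  have \<kappa>1: "1 \<le> \<kappa>"
  proof -
    obtain i where "i \<in> I" using I_ne by auto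
    then show ?thesis using kk_le[of i] kk2[of i] by linarith
  qed
  have "Max (set (ks @ ps)) \<in> set (ks @ ps)" by (rule Max_in) (use t in \<open>auto simp: t_def\<close>)
  then obtain i0 where i0: "i0 < length (ks @ ps)" "(ks @ ps) ! i0 = Max (set (ks @ ps))"
    by (metis in_set_conv_nth)
  then have i0: "i0 \<in> I" "3 \<le> kk i0" using assms(4) by (auto simp: I_def kk_def t_def)
  have fan_cases: "(\<forall>i\<in>I. kk i \<le> \<kappa>) \<or> (\<exists>i. I = {i} \<and> cyc i \<and> 3 \<le> kk i)"
  proof (cases "t = 1")
    case True
    then have "I = {0}" "i0 = 0" using i0 by (auto simp: I_def)
    \<comment> \<open>A single branch is a cycle, since without cycles there are at least two
      paths.\<close>
    moreover have "cyc 0" using True assms(1) by (auto simp: cyc_def t_def)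
    ultimately show ?thesis using i0 by blast
  next
    case False
    have "kk i \<le> \<kappa>" if i: "i \<in> I" for i
    proof -
      define j where "j = (if i = 0 then 1 else 0 :: nat)"
      have j: "j \<in> I" "j \<noteq> i" using False t by (auto simp: j_def I_def)
      have "(\<Sum>i\<in>{i, j}. kk i - 1) \<le> \<kappa>" unfolding \<kappa> by (rule sum_mono2) (use finI i j in auto)
      then show ?thesis using j(2) kk2[OF j(1)] kk2[OF i] by simp
    qed
    then show ?thesis by blast
  qed
  define c0 where "c0 = 2 * (real \<kappa> + 3 + 10 * real M)"
  define c2 where "c2 = 2 + c0 * real (4 * M + 1)"
  define c4 where "c4 = c2 + 2"
  define c5 where "c5 = 1 + real \<kappa> * c4 + c4"
  obtain \<epsilon> \<delta> :: real and s :: nat and N :: real where params: "0 < \<epsilon>" "\<epsilon> \<le> 1 / 4" "\<delta> = \<epsilon>\<^sup>2" "0 < \<delta>" "\<delta> \<le> 1"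
    "real \<kappa> + 1 \<le> real s * \<delta>" "(1 + 7 * real M) * \<delta> \<le> 1 / 4" "2 * (real \<kappa> + 1) * (c4 * \<epsilon>) \<le> 1"
    "16 * (real m * (c5 * \<epsilon>)) \<le> 1"
    "128 * (real \<kappa> + 1)\<^sup>2 * (real (4 * M + 1) * (real \<kappa> * (c4 * \<epsilon>))) \<le> 1"
    and large: "\<And>n lam. N \<le> n \<Longrightarrow> 0 \<le> lam \<Longrightarrow> real \<kappa> * (n - real \<kappa>) \<le> lam\<^sup>2 \<Longrightarrow> lam\<^sup>2 \<le> real (4 * M + 1) * n \<Longrightarrow>
      real (s * (m * 2 ^ s)) < n \<and> real (s * (m * 2 ^ s)) \<le> \<delta> * n \<and> real s * lam \<le> \<delta> * n \<and>
      (real \<kappa>)\<^sup>2 \<le> \<delta> * n \<and> 4 * (real \<kappa>)\<^sup>2 \<le> n \<and> 6 * real M + 6 \<le> \<delta>\<^sup>2 * lam \<and>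
      2 * real m + 4 \<le> n \<and> real m \<le> \<epsilon> * n"
    using extremal_parameters[OF \<kappa>1 c0_def c2_def c4_def c5_def, of m] by blast
  show ?thesis
  \<comment> \<open>\<open>\<kappa> + 6\<close> is the order from which
    \<open>S_plus_eigenvalue\<close> applies.\<close>
  proof (intro exI[of _ "max (nat \<lceil>N\<rceil>) (\<kappa> + 6)"] allI impI, elim conjE, rule ccontr)
    fix n and G :: "'a pair_pre_digraph"
    assume n: "max (nat \<lceil>N\<rceil>) (\<kappa> + 6) \<le> n" and G: "pair_graph G" "card (pverts G) = n"
      and rad: "adj_spectral_radius (S_plus_graph n \<kappa>) \<le> adj_spectral_radius G"
      and not_iso: "\<not> digraph_iso (with_proj G) (with_proj (S_plus_graph n \<kappa>))"
      and not_contains: "\<not> contains_subgraph G (CP_graph ks ps)"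
    have nN: "N \<le> real n" "\<kappa> + 6 \<le> n" using n by linarith+
    obtain \<mu> where \<mu>: "2 \<le> \<mu>" "real \<kappa> * (real n - real \<kappa>) \<le> \<mu>\<^sup>2"
      "\<mu> = (real \<kappa> - 1) + 2 * (real \<kappa> / (\<mu> - 1)) + (real n - real \<kappa> - 2) * (real \<kappa> / \<mu>)"
      using S_plus_eigenvalue[OF \<kappa>1 nN(2)] by blast
    define lam where "lam = adj_spectral_radius G"
    have \<mu>lam: "\<mu> \<le> lam" using S_plus_graph_radius_ge[OF \<kappa>1 nN(2) \<mu>(1,3)] rad by (simp add: lam_def)
    have lam_nonneg: "0 \<le> lam" using \<mu> \<mu>lam by linarith
    have "\<mu>\<^sup>2 \<le> lam\<^sup>2" using \<mu>lam \<mu>(1) by (intro power_mono) auto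
    then have lam_sq: "real \<kappa> * (real n - real \<kappa>) \<le> lam\<^sup>2" using \<mu>(2) by linarith
    define V where "V = pverts G"
    define E where "E = (\<lambda>u v. (u, v) \<in> parcs G)"
    have V: "card V = n" using G by (simp add: V_def)
    have "V \<noteq> {}" using V nN by auto
    then obtain x :: "'a \<Rightarrow> real" and z where x: "\<And>v. v \<in> V \<Longrightarrow> 0 \<le> x v" "\<And>v. v \<in> V \<Longrightarrow> x v \<le> 1"
        "z \<in> V" "x z = 1" "\<And>v. v \<in> V \<Longrightarrow> lam * x v \<le> (\<Sum>u\<in>{u. E v u}. x u)"
      using spectral_radius_subinvariant[OF G(1)] unfolding V_def E_def lam_def by blast
    interpret fin_graph V E unfolding V_def E_def by (rule fin_graph_of_pair_graph[OF G(1)])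
    interpret fan_free V E I kk cyc
    proof
      fix c xss
      show "\<not> fan I kk cyc c xss"
        using contains_CP_of_fan[OF G(1) assms(2,3), of c xss] not_contains t
        unfolding I_def kk_def cyc_def t_def E_def by blast
    qed (use finI I_ne kk2 in auto)
    have kap_eq: "kap = \<kappa>" "mm = m" "MM = M"
      by (simp_all add: kap_def mm_def MM_def \<kappa> m_def M_def)
    interpret spectral_fan_free V E I kk cyc x lam z
      by unfold_locales (use x lam_nonneg lam_sq in \<open>auto simp: kap_eq V nb_def\<close>)
    note lrg = large[OF nN(1) lam_nonneg lam_sq lam_upper[unfolded kap_eq V]]
    interpret large_spectral_fan_free V E I kk cyc x lam z \<delta> s
      by unfold_locales (use params lrg in \<open>auto simp: kap_eq V\<close>)
    have kap_eq': "C4 = c4" "C5 = c5"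
      by (simp_all add: C4_def C5_def C2_def C0_def c4_def c5_def c2_def c0_def kap_eq)
    have "\<exists>L\<subseteq>V. card L = kap \<and> (\<forall>v\<in>L. 1 - \<epsilon> \<le> x v) \<and> (\<forall>v\<in>V - L. x v \<le> C5 * \<epsilon>) \<and>
        real (card (V - common L)) \<le> real kap * (C4 * \<epsilon> * real (card V))"
      by (rule hub_structure) (use fan_cases params lrg in \<open>auto simp: kap_eq kap_eq' V\<close>)
    then obtain L where L: "L \<subseteq> V" "card L = kap" "\<And>v. v \<in> L \<Longrightarrow> 1 - \<epsilon> \<le> x v"
        "\<And>v. v \<in> V - L \<Longrightarrow> x v \<le> C5 * \<epsilon>"
        "real (card (V - common L)) \<le> (real kap * (C4 * \<epsilon>)) * real (card V)"
      by (auto simp: mult.assoc)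
    have "\<exists>L r s. L \<subseteq> V \<and> card L = kap \<and> r \<in> V - L \<and> s \<in> V - L \<and> r \<noteq> s \<and>
        (\<forall>u v. E u v \<longleftrightarrow> S_plus_rel V L r s u v)"
    proof (rule S_plus_structure[OF i0 L(1,2) params(1,2) L(3,4) _ L(5)])
      show "\<mu> = (real kap - 1) + 2 * (real kap / (\<mu> - 1)) + (real (card V) - real kap - 2) * (real kap / \<mu>)"
        using \<mu>(3) by (simp only: kap_eq V)
    qed (use params lrg \<mu> \<mu>lam in \<open>auto simp: kap_eq kap_eq' V\<close>)
    then obtain L r s where S: "L \<subseteq> V" "card L = \<kappa>" "r \<in> V - L" "s \<in> V - L" "r \<noteq> s"
        "\<And>u v. E u v \<longleftrightarrow> S_plus_rel V L r s u v"
      unfolding kap_eq by blast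
    have "digraph_iso (with_proj G) (with_proj (S_plus_graph n \<kappa>))"
      by (rule iso_S_plus_graph[OF G S[unfolded V_def E_def]])
    then show False using not_iso by contradiction
  qed
qed

end
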